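(* Let $(\mathbb{X},\Gamma/{\sim})$ be a triple with path category $C$ whose set $\mathscr{P}$ of screens is nonempty and closed under finite meets $\sqcap$. The functor $\mathcal{O}_{\overline{\mathscr{P}}}:\overline{\mathscr{P}}^{op}\to\boldsymbol{PCat}$ makes $(\overline{\mathscr{P}},\mathcal{O}_{\overline{\mathscr{P}}})$ a pathed site. That is, if $\{\mathfrak{P}_i\}_{i=1}^n\subset\mathscr{P}$ is such that $\mathfrak{P}=\bigsqcup_{i=1}^n\mathfrak{P}_i\in\mathscr{P}$ and $\mathfrak{P}_i$ is a finitary refinement of $\mathfrak{P}$ for $1\le i\le n$, then the following is an equalizer diagram in $\boldsymbol{PCat}$: $$C_{\mathfrak{P}}\xrightarrow{\ \prod_{i=1}^n\mathrm{Init}_i\ }\prod_{i=1}^nC_{\mathfrak{P}_i}\ \underset{pr_1}{\overset{pr_0}{\rightrightarrows}}\ \prod_{j=1}^n\prod_{k=1}^nC_{\mathfrak{P}_j\sqcap\mathfrak{P}_k}.$$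
   Context: TRIPLES. A path in a nonempty set $\mathbb{X}$ is any function $\gamma:[0,1]\to\mathbb{X}$; $\mathrm{im}(\gamma)$ is its image. If $\gamma(1)=\gamma'(0)$, then $\gamma\cdot\gamma'$ is the path equal to $\gamma(2t)$ for $0\le t\le\frac12$ and to $\gamma'(2t-1)$ for $\frac12\le t\le1$. A triple $(\mathbb{X},\Gamma/{\sim})$ consists of a nonempty set $\mathbb{X}$, a set $\Gamma$ of paths in $\mathbb{X}$, and an equivalence relation $\sim$ on $\Gamma$ (equivalent paths have the same endpoints) such that: (a) $\gamma,\gamma'\in\Gamma$ with $\gamma(1)=\gamma'(0)$ implies $\gamma\cdot\gamma'\in\Gamma$; (b) if $\gamma\in\Gamma$ and $\phi:[0,1]\to[0,1]$ is weakly order preserving and sends intervals to intervals, then $\gamma\circ\phi\in\Gamma$; (c) all constant paths are in $\Gamma$; (d) a path equivalent to a constant path is constant; (e) if in (b) also $\phi(0)=0$, $\phi(1)=1$, then $\gamma\sim\gamma\circ\phi$; (f) if $\gamma,\gamma',\rho,\rho'\in\Gamma$ and $\rho\cdot\gamma\cdot\rho'$, $\rho\cdot\gamma'\cdot\rho'$ are defined and in $\Gamma$, then $\gamma\sim\gamma'$ if and only if $\rho\cdot\gamma\cdot\rho'\sim\rho\cdot\gamma'\cdot\rho'$. The class of $\gamma$ is $[\gamma]$. SCREENS. A screen of $(\mathbb{X},\Gamma/{\sim})$ is a partition $\mathfrak{P}$ of $\mathbb{X}$, whose elements are called pixels, such that: (S1) if $\gamma,\gamma'\in\Gamma$ have the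 same start and the same end and $\mathrm{im}(\gamma)\subset\mathsf{X}\in\mathfrak{P}$, then $\gamma\sim\gamma'$ if and only if $\mathrm{im}(\gamma')\subset\mathsf{X}$; (S2) any two points $x,y$ of a pixel $\mathsf{X}$ are joined by a finite walk $\gamma_0\cdot\gamma_1^{-1}\cdot\gamma_2\cdots\gamma_{2n-1}^{-1}\cdot\gamma_{2n}$ from $x$ to $y$ (where $\gamma^{-1}$ is $\gamma$ run backwards, and any $\gamma_i$ may be constant) with all $\gamma_i\in\Gamma$ and $\mathrm{im}(\gamma_i)\subset\mathsf{X}$; (S3) if $\rho,\gamma\in\Gamma$, $\rho(0)=\gamma(0)$ and $\mathrm{im}(\rho)$ lies in a pixel, then there are $\rho',\gamma'\in\Gamma$ with $\mathrm{im}(\rho')$ in a pixel and $\gamma\cdot\rho'\sim\rho\cdot\gamma'$; dually, if $\rho',\gamma'\in\Gamma$, $\rho'(1)=\gamma'(1)$ and $\mathrm{im}(\rho')$ lies in a pixel, then there are $\rho,\gamma\in\Gamma$ with $\mathrm{im}(\rho)$ in a pixel and $\gamma\cdot\rho'\sim\rho\cdot\gamma'$; (S4) for every $\gamma\in\Gamma$ there are a finite partition $\{I_i\}_{i=1}^n$ of $[0,1]$ into subintervals (listed in increasing order) and pixels $(\mathsf{X}_1,\dots,\mathsf{X}_n)$ with $\gamma(I_i)\subset\mathsf{X}_i$, where for $i\ne j$ the equality $\mathsf{X}_i=\mathsf{X}_j$ is allowed only if $|i-j|>1$; (S5) if $\gamma,\gamma'\in\Gamma$ have the same start and the same end and admit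 the same partition $\{I_i\}$ and the same list of pixels as in (S4), then $\gamma\sim\gamma'$. MEETS, JOINS, FINITARY REFINEMENTS. For partitions, $\mathfrak{P}\sqcap\mathfrak{P}'$ is the partition into the nonempty sets $\mathsf{X}\cap\mathsf{X}'$ with $\mathsf{X}\in\mathfrak{P},\mathsf{X}'\in\mathfrak{P}'$, and $\mathfrak{P}\sqcup\mathfrak{P}'$ is the pushout of $\mathfrak{P}\twoheadleftarrow\mathbb{X}\twoheadrightarrow\mathfrak{P}'$ in sets (the finest partition coarser than both). A screen $\mathfrak{P}$ refining a screen $\mathfrak{P}'$ is a finitary refinement of $\mathfrak{P}'$ if every $\mathsf{X}'\in\mathfrak{P}'$ contains at most finitely many pixels of $\mathfrak{P}$. PATH CATEGORY AND PIXELATION. The path category of a triple has objects the points of $\mathbb{X}$, morphisms $x\to y$ the classes $[\gamma]$ with $\gamma\in\Gamma$, $\gamma(0)=x$, $\gamma(1)=y$, and composition $[\gamma']\circ[\gamma]=[\gamma\cdot\gamma']$. $\boldsymbol{PCat}$ is the category of path categories (of all triples) and all functors between them. $\Sigma_{\mathfrak{P}}$ is the class of $[\rho]$ in $C$ with $\mathrm{im}(\rho)$ in a pixel of $\mathfrak{P}$ (it admits a calculus of fractions), and $p:C\to C[\Sigma_{\mathfrak{P}}^{-1}]$ is the localization. Choose $s_{\mathsf{X}}\in\mathsf{X}$ in each pixel. A pseudo arrow is a morphism $[\rho]^{-1}[\gamma]$ of $C[\Sigma_{\mathfrak{P}}^{-1}]$ with $[\rho]\in\Sigma_{\mathfrak{P}}$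 such that $\gamma$ has a partition as in (S4) with exactly two elements. $Q(C,\mathfrak{P})$ is the quiver with vertex set $\mathfrak{P}$ and arrows $\mathsf{X}\to\mathsf{Y}$ the pseudo arrows $s_{\mathsf{X}}\to s_{\mathsf{Y}}$ (at most one). $\Psi$ is the functor from the free category on it to $C[\Sigma_{\mathfrak{P}}^{-1}]$, $\mathsf{X}\mapsto s_{\mathsf{X}}$, sending arrows to their pseudo arrows; $\overline{Q(C,\mathfrak{P})}$ is the quotient of the free category identifying parallel $f,g$ with $\Psi(f)=\Psi(g)$. $H:C[\Sigma_{\mathfrak{P}}^{-1}]\to\overline{Q(C,\mathfrak{P})}$ is the equivalence sending $x\in\mathsf{X}$ to $\mathsf{X}$, morphisms $[\rho]^{-1}[\rho']$ with $[\rho],[\rho']\in\Sigma_{\mathfrak{P}}$ to identities, and pseudo arrows $x\to y$ ($x\in\mathsf{X},y\in\mathsf{Y}$) to the arrow $\mathsf{X}\to\mathsf{Y}$. The category $\overline{Q(C,\mathfrak{P})}$ is isomorphic to a path category with object set $\mathfrak{P}$, denoted $C_{\mathfrak{P}}$. THE FUNCTORS $\mathrm{Init}$. Let $\mathfrak{P}$ be a finitary refinement of $\mathfrak{P}'$, with functors $p,H$ and $p',H'$ respectively. Each $\mathsf{X}'\in\mathfrak{P}'$ contains a pixel $\mathrm{Init}(\mathsf{X}')\in\mathfrak{P}$ that is initial, in the sense that for every $\mathsf{X}_i\in\mathfrak{P}$ with $\mathsf{X}_i\subset\mathsf{X}'$ and every $x_i\in\mathsf{X}_i$ there are $x\in\mathrm{Init}(\mathsf{X}')$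 and $\gamma\in\Gamma$ with $\gamma(0)=x$ and $\gamma(1)=x_i$. The functor $\mathrm{Init}:C_{\mathfrak{P}'}\to C_{\mathfrak{P}}$ is given on objects by $\mathsf{X}'\mapsto\mathrm{Init}(\mathsf{X}')$, and sends $f:\mathsf{X}'\to\mathsf{Y}'$ to $Hp([\tilde\gamma])$ for any $\tilde\gamma\in\Gamma$ with $\tilde\gamma(0)\in\mathrm{Init}(\mathsf{X}')$, $\tilde\gamma(1)\in\mathrm{Init}(\mathsf{Y}')$, $H'p'([\tilde\gamma])=f$. THE SITE AND THE PRESHEAF. $\overline{\mathscr{P}}$ is the category with objects the screens in $\mathscr{P}$ and a unique morphism $\mathfrak{P}\to\mathfrak{P}'$ when $\mathfrak{P}$ is a finitary refinement of $\mathfrak{P}'$ (no other morphisms). Its coverage consists of the empty covering of each screen together with the families $\{\mathfrak{P}_i\to\bigsqcup_{i=1}^n\mathfrak{P}_i\}_{i=1}^n$ such that $\bigsqcup_{i=1}^n\mathfrak{P}_i\in\mathscr{P}$ and each $\mathfrak{P}_i$ is a finitary refinement of $\bigsqcup_{i=1}^n\mathfrak{P}_i$. $\mathcal{O}_{\overline{\mathscr{P}}}$ sends $\mathfrak{P}$ to $C_{\mathfrak{P}}$ and a morphism $\mathfrak{P}\to\mathfrak{P}'$ (finitary refinement) to $\mathrm{Init}:C_{\mathfrak{P}'}\to C_{\mathfrak{P}}$. A pathed site is a site $E$ together with a sheaf of path categories $\mathcal{O}_E:E^{op}\to\boldsymbol{PCat}$. In the diagram, $\mathrm{Init}_i:C_{\mathfrak{P}}\to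 C_{\mathfrak{P}_i}$ is the $\mathrm{Init}$ functor; with $\mathrm{Init}_{jk0}:C_{\mathfrak{P}_j}\to C_{\mathfrak{P}_j\sqcap\mathfrak{P}_k}$ and $\mathrm{Init}_{jk1}:C_{\mathfrak{P}_k}\to C_{\mathfrak{P}_j\sqcap\mathfrak{P}_k}$ the $\mathrm{Init}$ functors, the $(j,k)$ component of $pr_0$ is $\mathrm{Init}_{jk0}$ applied to the $j$th coordinate and that of $pr_1$ is $\mathrm{Init}_{jk1}$ applied to the $k$th coordinate.
   Formalization: The sheaf condition is stated only for families with n ≥ 1, since for empty coverings it would force each C_P to be terminal, which is false; and the paths witnessing that Init(X') is initial are required to run inside X', since otherwise Init(X') is not determined. *)

theory Defs
  imports "HOL-Analysis.Analysis" "Graph_Theory.Arc_Walk"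
begin

section \<open>Categories\<close>

record ('o, 'm) category =
  Obj :: "'o set"
  Arr :: "'m set"
  Dom :: "'m \<Rightarrow> 'o"
  Cod :: "'m \<Rightarrow> 'o"
  Ident :: "'o \<Rightarrow> 'm"
  Comp :: "'m \<Rightarrow> 'm \<Rightarrow> 'm"  \<comment> \<open>\<open>Comp C g f\<close> is "g after f"\<close>

locale is_category =
  fixes C :: "('o, 'm) category"
  assumes dom_obj: "f \<in> Arr C \<Longrightarrow> Dom C f \<in> Obj C"
    and cod_obj: "f \<in> Arr C \<Longrightarrow> Cod C f \<in> Obj C"
    and ident: "x \<in> Obj C \<Longrightarrow> Ident C x \<in> Arr C \<and> Dom C (Ident C x) = x \<and> Cod C (Ident C x) = x"
    and comp: "\<lbrakk>f \<in> Arr C; g \<in> Arr C; Cod C f = Dom C g\<rbrakk> \<Longrightarrow>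
      Comp C g f \<in> Arr C \<and> Dom C (Comp C g f) = Dom C f \<and> Cod C (Comp C g f) = Cod C g"
    and comp_ident_right: "f \<in> Arr C \<Longrightarrow> Comp C f (Ident C (Dom C f)) = f"
    and comp_ident_left: "f \<in> Arr C \<Longrightarrow> Comp C (Ident C (Cod C f)) f = f"
    and comp_assoc: "\<lbrakk>f \<in> Arr C; g \<in> Arr C; h \<in> Arr C; Cod C f = Dom C g; Cod C g = Dom C h\<rbrakk> \<Longrightarrow>
      Comp C h (Comp C g f) = Comp C (Comp C h g) f"

definition hom :: "('o, 'm) category \<Rightarrow> 'o \<Rightarrow> 'o \<Rightarrow> 'm set" where
  "hom C x y = {f \<in> Arr C. Dom C f = x \<and> Cod C f = y}"

record ('o, 'm, 'p, 'n) cfunctor =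
  FObj :: "'o \<Rightarrow> 'p"
  FArr :: "'m \<Rightarrow> 'n"

definition is_functor ::
  "('o, 'm) category \<Rightarrow> ('p, 'n) category \<Rightarrow> ('o, 'm, 'p, 'n) cfunctor \<Rightarrow> bool" where
  "is_functor C D F \<longleftrightarrow> is_category C \<and> is_category D \<and>
     (\<forall>x\<in>Obj C. FObj F x \<in> Obj D) \<and>
     (\<forall>x\<in>Obj C. \<forall>y\<in>Obj C. \<forall>f\<in>hom C x y. FArr F f \<in> hom D (FObj F x) (FObj F y)) \<and>
     (\<forall>x\<in>Obj C. FArr F (Ident C x) = Ident D (FObj F x)) \<and>
     (\<forall>f\<in>Arr C. \<forall>g\<in>Arr C. Cod C f = Dom C g \<longrightarrow>
        FArr F (Comp C g f) = Comp D (FArr F g) (FArr F f))"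

text \<open>The values of a functor outside its source category are junk, so functors are compared
  with \<open>functor_eq\<close> and not with equality.\<close>

definition functor_eq ::
  "('o, 'm) category \<Rightarrow> ('o, 'm, 'p, 'n) cfunctor \<Rightarrow> ('o, 'm, 'p, 'n) cfunctor \<Rightarrow> bool" where
  "functor_eq C F G \<longleftrightarrow> (\<forall>x\<in>Obj C. FObj F x = FObj G x) \<and> (\<forall>f\<in>Arr C. FArr F f = FArr G f)"

definition id_functor :: "('o, 'm, 'o, 'm) cfunctor" where
  "id_functor = \<lparr>FObj = (\<lambda>x. x), FArr = (\<lambda>f. f)\<rparr>"

definition comp_functor ::
  "('p, 'n, 'q, 'k) cfunctor \<Rightarrow> ('o, 'm, 'p, 'n) cfunctor \<Rightarrow> ('o, 'm, 'q, 'k) cfunctor" where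
  "comp_functor G F = \<lparr>FObj = FObj G \<circ> FObj F, FArr = FArr G \<circ> FArr F\<rparr>"

definition isomorphic :: "('o, 'm) category \<Rightarrow> ('p, 'n) category \<Rightarrow> bool" where
  "isomorphic C D \<longleftrightarrow> (\<exists>F. is_functor C D F \<and>
     bij_betw (FObj F) (Obj C) (Obj D) \<and> bij_betw (FArr F) (Arr C) (Arr D))"

definition isomorphic_objects :: "('o, 'm) category \<Rightarrow> 'o \<Rightarrow> 'o \<Rightarrow> bool" where
  "isomorphic_objects C x y \<longleftrightarrow>
     (\<exists>f\<in>hom C x y. \<exists>g\<in>hom C y x. Comp C g f = Ident C x \<and> Comp C f g = Ident C y)"

definition is_equivalence ::
  "('o, 'm) category \<Rightarrow> ('p, 'n) category \<Rightarrow> ('o, 'm, 'p, 'n) cfunctor \<Rightarrow> bool" where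
  "is_equivalence C D F \<longleftrightarrow> is_functor C D F \<and>
     (\<forall>x\<in>Obj C. \<forall>y\<in>Obj C. bij_betw (FArr F) (hom C x y) (hom D (FObj F x) (FObj F y))) \<and>
     (\<forall>y\<in>Obj D. \<exists>x\<in>Obj C. isomorphic_objects D (FObj F x) y)"

definition prod_cat :: "'i set \<Rightarrow> ('i \<Rightarrow> ('o, 'm) category) \<Rightarrow> ('i \<Rightarrow> 'o, 'i \<Rightarrow> 'm) category" where
  "prod_cat I C = \<lparr>
     Obj = (\<Pi>\<^sub>E i\<in>I. Obj (C i)),
     Arr = (\<Pi>\<^sub>E i\<in>I. Arr (C i)),
     Dom = (\<lambda>f. \<lambda>i\<in>I. Dom (C i) (f i)),
     Cod = (\<lambda>f. \<lambda>i\<in>I. Cod (C i) (f i)),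
     Ident = (\<lambda>x. \<lambda>i\<in>I. Ident (C i) (x i)),
     Comp = (\<lambda>g f. \<lambda>i\<in>I. Comp (C i) (g i) (f i))\<rparr>"

text \<open>Arrows of the free category on a quiver are walks \<open>(u, p, v)\<close> from \<open>u\<close> to \<open>v\<close>; the list
  \<open>p\<close> is read in the order in which the arcs are traversed.\<close>

definition free_cat :: "('v, 'a) pre_digraph \<Rightarrow> ('v, 'v \<times> 'a list \<times> 'v) category" where
  "free_cat G = \<lparr>
     Obj = verts G,
     Arr = {(u, p, v). pre_digraph.awalk G u p v},
     Dom = (\<lambda>(u, p, v). u),
     Cod = (\<lambda>(u, p, v). v),
     Ident = (\<lambda>u. (u, [], u)),
     Comp = (\<lambda>(v', q, w) (u, p, v). (u, p @ q, w))\<rparr>"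

text \<open>Quotient of a category by a congruence \<open>r\<close> on its arrows.\<close>

definition quot_cat :: "('o, 'm) category \<Rightarrow> ('m \<times> 'm) set \<Rightarrow> ('o, 'm set) category" where
  "quot_cat C r = \<lparr>
     Obj = Obj C,
     Arr = Arr C // r,
     Dom = (\<lambda>c. the_elem (Dom C ` c)),
     Cod = (\<lambda>c. the_elem (Cod C ` c)),
     Ident = (\<lambda>x. r `` {Ident C x}),
     Comp = (\<lambda>d c. r `` {Comp C g f | g f. g \<in> d \<and> f \<in> c \<and> Cod C f = Dom C g})\<rparr>"

inductive_set congruence_closure :: "('o, 'm) category \<Rightarrow> ('m \<times> 'm) set \<Rightarrow> ('m \<times> 'm) set"
  for C :: "('o, 'm) category" and r :: "('m \<times> 'm) set" where
  base: "(f, g) \<in> r \<Longrightarrow> (f, g) \<in> congruence_closure C r"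
| refl: "f \<in> Arr C \<Longrightarrow> (f, f) \<in> congruence_closure C r"
| sym: "(f, g) \<in> congruence_closure C r \<Longrightarrow> (g, f) \<in> congruence_closure C r"
| trans: "(f, g) \<in> congruence_closure C r \<Longrightarrow> (g, h) \<in> congruence_closure C r \<Longrightarrow>
    (f, h) \<in> congruence_closure C r"
| comp: "(f, f') \<in> congruence_closure C r \<Longrightarrow> (g, g') \<in> congruence_closure C r \<Longrightarrow>
    Cod C f = Dom C g \<Longrightarrow> (Comp C g f, Comp C g' f') \<in> congruence_closure C r"

subsection \<open>Localization\<close>

text \<open>The localization of \<open>C\<close> at \<open>S\<close> in the sense of Gabriel and Zisman: the arrows of \<open>C\<close>
  (tagged \<open>Inl\<close>) and a formal inverse (tagged \<open>Inr\<close>) of each element of \<open>S\<close> generate a free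
  category, which is divided by the smallest congruence that makes \<open>C\<close> map functorially to it and
  the formal inverses inverse.\<close>

definition zigzag_quiver :: "('o, 'm) category \<Rightarrow> 'm set \<Rightarrow> ('o, 'm + 'm) pre_digraph" where
  "zigzag_quiver C S = \<lparr>
     verts = Obj C,
     arcs = Inl ` Arr C \<union> Inr ` S,
     tail = case_sum (Dom C) (Cod C),
     head = case_sum (Cod C) (Dom C)\<rparr>"

definition localization_relations ::
  "('o, 'm) category \<Rightarrow> 'm set \<Rightarrow> (('o \<times> ('m + 'm) list \<times> 'o) \<times> ('o \<times> ('m + 'm) list \<times> 'o)) set" where
  "localization_relations C S =
     {((x, [Inl (Ident C x)], x), (x, [], x)) | x. x \<in> Obj C} \<union>
     {((Dom C f, [Inl f, Inl g], Cod C g), (Dom C f, [Inl (Comp C g f)], Cod C g)) | f g.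
        f \<in> Arr C \<and> g \<in> Arr C \<and> Cod C f = Dom C g} \<union>
     {((Dom C s, [Inl s, Inr s], Dom C s), (Dom C s, [], Dom C s)) | s. s \<in> S} \<union>
     {((Cod C s, [Inr s, Inl s], Cod C s), (Cod C s, [], Cod C s)) | s. s \<in> S}"

definition localization_cong ::
  "('o, 'm) category \<Rightarrow> 'm set \<Rightarrow> (('o \<times> ('m + 'm) list \<times> 'o) \<times> ('o \<times> ('m + 'm) list \<times> 'o)) set" where
  "localization_cong C S =
     congruence_closure (free_cat (zigzag_quiver C S)) (localization_relations C S)"

type_synonym ('o, 'm) loc_arrow = "('o \<times> ('m + 'm) list \<times> 'o) set"

definition localization :: "('o, 'm) category \<Rightarrow> 'm set \<Rightarrow> ('o, ('o, 'm) loc_arrow) category" where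
  "localization C S = quot_cat (free_cat (zigzag_quiver C S)) (localization_cong C S)"

definition loc_functor ::
  "('o, 'm) category \<Rightarrow> 'm set \<Rightarrow> ('o, 'm, 'o, ('o, 'm) loc_arrow) cfunctor" where
  "loc_functor C S = \<lparr>FObj = (\<lambda>x. x),
     FArr = (\<lambda>f. localization_cong C S `` {(Dom C f, [Inl f], Cod C f)})\<rparr>"

definition loc_inverse :: "('o, 'm) category \<Rightarrow> 'm set \<Rightarrow> 'm \<Rightarrow> ('o, 'm) loc_arrow" where
  "loc_inverse C S s = localization_cong C S `` {(Cod C s, [Inr s], Dom C s)}"

text \<open>The morphism \<open>s\<^sup>-\<^sup>1 f\<close>.\<close>

definition fraction :: "('o, 'm) category \<Rightarrow> 'm set \<Rightarrow> 'm \<Rightarrow> 'm \<Rightarrow> ('o, 'm) loc_arrow" where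
  "fraction C S s f =
     Comp (localization C S) (loc_inverse C S s) (FArr (loc_functor C S) f)"


section \<open>Triples and path categories\<close>

text \<open>A path is a function on the unit interval, represented by the function on \<open>real\<close> that is
  \<open>undefined\<close> outside of it.\<close>

type_synonym 'x pth = "real \<Rightarrow> 'x"

definition all_paths :: "'x set \<Rightarrow> 'x pth set" where
  "all_paths X = {0..1} \<rightarrow>\<^sub>E X"

definition im :: "'x pth \<Rightarrow> 'x set" where
  "im \<gamma> = \<gamma> ` {0..1}"

definition const_path :: "'x \<Rightarrow> 'x pth" where
  "const_path x = (\<lambda>t\<in>{0..1}. x)"

definition concat_path :: "'x pth \<Rightarrow> 'x pth \<Rightarrow> 'x pth"  (infixl \<open>\<cdot>\<close> 75) where
  "\<gamma> \<cdot> \<gamma>' = (\<lambda>t\<in>{0..1}. if t \<le> 1/2 then \<gamma> (2 * t) else \<gamma>' (2 * t - 1))"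

definition reparam :: "'x pth \<Rightarrow> (real \<Rightarrow> real) \<Rightarrow> 'x pth" where
  "reparam \<gamma> \<phi> = (\<lambda>t\<in>{0..1}. \<gamma> (\<phi> t))"

definition reparametrization :: "(real \<Rightarrow> real) \<Rightarrow> bool" where
  "reparametrization \<phi> \<longleftrightarrow> \<phi> ` {0..1} \<subseteq> {0..1} \<and> mono_on {0..1} \<phi> \<and>
     (\<forall>I\<subseteq>{0..1}. is_interval I \<longrightarrow> is_interval (\<phi> ` I))"

record 'x path_structure =
  Points :: "'x set"
  Paths :: "'x pth set"
  Equiv :: "('x pth \<times> 'x pth) set"

locale triple =
  fixes T :: "'x path_structure"
  assumes points_nonempty: "Points T \<noteq> {}"
    and paths: "Paths T \<subseteq> all_paths (Points T)"
    and equiv: "equiv (Paths T) (Equiv T)"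
    and equiv_endpoints: "(\<gamma>, \<gamma>') \<in> Equiv T \<Longrightarrow> \<gamma> 0 = \<gamma>' 0 \<and> \<gamma> 1 = \<gamma>' 1"
    and concat: "\<lbrakk>\<gamma> \<in> Paths T; \<gamma>' \<in> Paths T; \<gamma> 1 = \<gamma>' 0\<rbrakk> \<Longrightarrow> \<gamma> \<cdot> \<gamma>' \<in> Paths T"
    and reparam: "\<lbrakk>\<gamma> \<in> Paths T; reparametrization \<phi>\<rbrakk> \<Longrightarrow> reparam \<gamma> \<phi> \<in> Paths T"
    and const: "x \<in> Points T \<Longrightarrow> const_path x \<in> Paths T"
    and equiv_const: "\<lbrakk>x \<in> Points T; (\<gamma>, const_path x) \<in> Equiv T\<rbrakk> \<Longrightarrow> \<exists>y. \<gamma> = const_path y"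
    and equiv_reparam: "\<lbrakk>\<gamma> \<in> Paths T; reparametrization \<phi>; \<phi> 0 = 0; \<phi> 1 = 1\<rbrakk> \<Longrightarrow>
      (\<gamma>, reparam \<gamma> \<phi>) \<in> Equiv T"
    and equiv_cancel: "\<lbrakk>\<gamma> \<in> Paths T; \<gamma>' \<in> Paths T; \<rho> \<in> Paths T; \<rho>' \<in> Paths T;
        \<rho> 1 = \<gamma> 0; \<gamma> 1 = \<rho>' 0; \<rho> 1 = \<gamma>' 0; \<gamma>' 1 = \<rho>' 0;
        \<rho> \<cdot> \<gamma> \<cdot> \<rho>' \<in> Paths T; \<rho> \<cdot> \<gamma>' \<cdot> \<rho>' \<in> Paths T\<rbrakk> \<Longrightarrow>
      (\<gamma>, \<gamma>') \<in> Equiv T \<longleftrightarrow> (\<rho> \<cdot> \<gamma> \<cdot> \<rho>', \<rho> \<cdot> \<gamma>' \<cdot> \<rho>') \<in> Equiv T"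

definition path_class :: "'x path_structure \<Rightarrow> 'x pth \<Rightarrow> 'x pth set" where
  "path_class T \<gamma> = Equiv T `` {\<gamma>}"

definition path_cat :: "'x path_structure \<Rightarrow> ('x, 'x pth set) category" where
  "path_cat T = \<lparr>
     Obj = Points T,
     Arr = path_class T ` Paths T,
     Dom = (\<lambda>c. the_elem ((\<lambda>\<gamma>. \<gamma> 0) ` c)),
     Cod = (\<lambda>c. the_elem ((\<lambda>\<gamma>. \<gamma> 1) ` c)),
     Ident = (\<lambda>x. path_class T (const_path x)),
     Comp = (\<lambda>d c. Equiv T `` {\<gamma> \<cdot> \<gamma>' | \<gamma> \<gamma>'. \<gamma> \<in> c \<and> \<gamma>' \<in> d})\<rparr>"

text \<open>PCat is taken closed under isomorphism of categories. The points of the triple may be taken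
  from the type of the objects, since they can be renamed along the isomorphism.\<close>

definition in_PCat :: "('o, 'm) category \<Rightarrow> bool" where
  "in_PCat C \<longleftrightarrow> (\<exists>T :: 'o path_structure. triple T \<and> isomorphic C (path_cat T))"

text \<open>\<open>E : A \<rightarrow> B\<close> is an equalizer of \<open>F, G : B \<rightarrow> D\<close> in PCat. The test objects are the path
  categories of all triples with points in an arbitrary type \<open>'z\<close>.\<close>

definition PCat_equalizer :: "'z itself \<Rightarrow> ('o, 'm) category \<Rightarrow> ('p, 'n) category \<Rightarrow>
    ('q, 'k) category \<Rightarrow> ('o, 'm, 'p, 'n) cfunctor \<Rightarrow> ('p, 'n, 'q, 'k) cfunctor \<Rightarrow>
    ('p, 'n, 'q, 'k) cfunctor \<Rightarrow> bool" where
  "PCat_equalizer _ A B D E F G \<longleftrightarrow>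
     in_PCat A \<and> in_PCat B \<and> in_PCat D \<and>
     is_functor A B E \<and> is_functor B D F \<and> is_functor B D G \<and>
     functor_eq A (comp_functor F E) (comp_functor G E) \<and>
     (\<forall>(Z :: 'z path_structure) K. triple Z \<and> is_functor (path_cat Z) B K \<and>
        functor_eq (path_cat Z) (comp_functor F K) (comp_functor G K) \<longrightarrow>
        (\<exists>L. is_functor (path_cat Z) A L \<and> functor_eq (path_cat Z) (comp_functor E L) K \<and>
           (\<forall>L'. is_functor (path_cat Z) A L' \<and> functor_eq (path_cat Z) (comp_functor E L') K \<longrightarrow>
              functor_eq (path_cat Z) L' L)))"


section \<open>Screens\<close>

definition in_pixel :: "'x set set \<Rightarrow> 'x pth \<Rightarrow> bool" where
  "in_pixel P \<gamma> \<longleftrightarrow> (\<exists>A\<in>P. im \<gamma> \<subseteq> A)"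

text \<open>\<open>Is\<close> is a partition of the unit interval into subintervals, and \<open>As\<close> a list of pixels, that
  \<open>\<gamma>\<close> admits.\<close>

definition admits :: "'x set set \<Rightarrow> 'x pth \<Rightarrow> real set list \<Rightarrow> 'x set list \<Rightarrow> bool" where
  "admits P \<gamma> Is As \<longleftrightarrow>
     partition_on {0..1} (set Is) \<and> (\<forall>I\<in>set Is. is_interval I) \<and>
     (\<forall>i j. i < j \<and> j < length Is \<longrightarrow> (\<forall>a \<in> Is ! i. \<forall>b \<in> Is ! j. a < b)) \<and>
     length As = length Is \<and> set As \<subseteq> P \<and>
     (\<forall>i < length Is. \<gamma> ` (Is ! i) \<subseteq> As ! i) \<and>
     (\<forall>i < length Is. \<forall>j < length Is. i \<noteq> j \<and> As ! i = As ! j \<longrightarrow> \<bar>int i - int j\<bar> > 1)"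

text \<open>The walk \<open>g 0, (g 1)\<^sup>-\<^sup>1, g 2, \<dots>, g (2 n)\<close>: the odd steps are run backwards.\<close>

definition step_start :: "(nat \<Rightarrow> 'x pth) \<Rightarrow> nat \<Rightarrow> 'x" where
  "step_start g i = (if even i then g i 0 else g i 1)"

definition step_end :: "(nat \<Rightarrow> 'x pth) \<Rightarrow> nat \<Rightarrow> 'x" where
  "step_end g i = (if even i then g i 1 else g i 0)"

locale screen =
  fixes T :: "'x path_structure" and P :: "'x set set"
  assumes partition: "partition_on (Points T) P"
    and S1: "\<lbrakk>\<gamma> \<in> Paths T; \<gamma>' \<in> Paths T; \<gamma> 0 = \<gamma>' 0; \<gamma> 1 = \<gamma>' 1; A \<in> P; im \<gamma> \<subseteq> A\<rbrakk> \<Longrightarrow>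
      (\<gamma>, \<gamma>') \<in> Equiv T \<longleftrightarrow> im \<gamma>' \<subseteq> A"
    and S2: "\<lbrakk>A \<in> P; x \<in> A; y \<in> A\<rbrakk> \<Longrightarrow>
      \<exists>n g. (\<forall>i \<le> 2 * n. g i \<in> Paths T \<and> im (g i) \<subseteq> A) \<and>
        step_start g 0 = x \<and> step_end g (2 * n) = y \<and>
        (\<forall>i < 2 * n. step_end g i = step_start g (Suc i))"
    and S3: "\<lbrakk>\<rho> \<in> Paths T; \<gamma> \<in> Paths T; \<rho> 0 = \<gamma> 0; in_pixel P \<rho>\<rbrakk> \<Longrightarrow>
      \<exists>\<rho>'\<in>Paths T. \<exists>\<gamma>'\<in>Paths T. in_pixel P \<rho>' \<and> \<gamma> 1 = \<rho>' 0 \<and> \<rho> 1 = \<gamma>' 0 \<and>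
        (\<gamma> \<cdot> \<rho>', \<rho> \<cdot> \<gamma>') \<in> Equiv T"
    and S3_dual: "\<lbrakk>\<rho>' \<in> Paths T; \<gamma>' \<in> Paths T; \<rho>' 1 = \<gamma>' 1; in_pixel P \<rho>'\<rbrakk> \<Longrightarrow>
      \<exists>\<rho>\<in>Paths T. \<exists>\<gamma>\<in>Paths T. in_pixel P \<rho> \<and> \<gamma> 1 = \<rho>' 0 \<and> \<rho> 1 = \<gamma>' 0 \<and>
        (\<gamma> \<cdot> \<rho>', \<rho> \<cdot> \<gamma>') \<in> Equiv T"
    and S4: "\<gamma> \<in> Paths T \<Longrightarrow> \<exists>Is As. admits P \<gamma> Is As"
    and S5: "\<lbrakk>\<gamma> \<in> Paths T; \<gamma>' \<in> Paths T; \<gamma> 0 = \<gamma>' 0; \<gamma> 1 = \<gamma>' 1;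
        admits P \<gamma> Is As; admits P \<gamma>' Is As\<rbrakk> \<Longrightarrow> (\<gamma>, \<gamma>') \<in> Equiv T"

definition screens :: "'x path_structure \<Rightarrow> 'x set set set" where
  "screens T = {P. screen T P}"

definition meet :: "'x set set \<Rightarrow> 'x set set \<Rightarrow> 'x set set"  (infixl \<open>\<sqinter>\<^sub>P\<close> 70) where
  "P \<sqinter>\<^sub>P Q = {A \<inter> B | A B. A \<in> P \<and> B \<in> Q \<and> A \<inter> B \<noteq> {}}"

text \<open>The pushout of the partitions \<open>P i\<close> of \<open>X\<close>: two points are in the same block iff a finite
  chain of points joins them in which neighbours share a block of some \<open>P i\<close>.\<close>

definition join :: "'x set \<Rightarrow> 'i set \<Rightarrow> ('i \<Rightarrow> 'x set set) \<Rightarrow> 'x set set" where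
  "join X I P = X // ((\<Union>i\<in>I. \<Union>A\<in>P i. A \<times> A)\<^sup>*)"

definition finitary_refinement ::
  "'x path_structure \<Rightarrow> 'x set set \<Rightarrow> 'x set set \<Rightarrow> bool" where
  "finitary_refinement T P P' \<longleftrightarrow> P \<in> screens T \<and> P' \<in> screens T \<and>
     refines (Points T) P P' \<and> (\<forall>A'\<in>P'. finite {A \<in> P. A \<subseteq> A'})"


section \<open>Pixelation\<close>

definition Sigma_P :: "'x path_structure \<Rightarrow> 'x set set \<Rightarrow> 'x pth set set" where
  "Sigma_P T P = {path_class T \<rho> | \<rho>. \<rho> \<in> Paths T \<and> in_pixel P \<rho>}"

type_synonym 'x pix_loc_arrow = "('x, 'x pth set) loc_arrow"
type_synonym 'x pix_arc = "'x set \<times> 'x pix_loc_arrow \<times> 'x set"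
type_synonym 'x pix_arrow = "('x set \<times> 'x pix_arc list \<times> 'x set) set"

definition pix_loc :: "'x path_structure \<Rightarrow> 'x set set \<Rightarrow> ('x, 'x pix_loc_arrow) category" where
  "pix_loc T P = localization (path_cat T) (Sigma_P T P)"

definition pix_p ::
  "'x path_structure \<Rightarrow> 'x set set \<Rightarrow> ('x, 'x pth set, 'x, 'x pix_loc_arrow) cfunctor" where
  "pix_p T P = loc_functor (path_cat T) (Sigma_P T P)"

definition pix_fraction ::
  "'x path_structure \<Rightarrow> 'x set set \<Rightarrow> 'x pth \<Rightarrow> 'x pth \<Rightarrow> 'x pix_loc_arrow" where
  "pix_fraction T P \<rho> \<gamma> =
     fraction (path_cat T) (Sigma_P T P) (path_class T \<rho>) (path_class T \<gamma>)"

definition pseudo_arrow :: "'x path_structure \<Rightarrow> 'x set set \<Rightarrow> 'x pix_loc_arrow \<Rightarrow> bool" where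
  "pseudo_arrow T P m \<longleftrightarrow>
     (\<exists>\<rho>\<in>Paths T. \<exists>\<gamma>\<in>Paths T. \<gamma> 1 = \<rho> 1 \<and> path_class T \<rho> \<in> Sigma_P T P \<and>
        (\<exists>Is As. length Is = 2 \<and> admits P \<gamma> Is As) \<and> m = pix_fraction T P \<rho> \<gamma>)"

text \<open>The quiver \<open>Q(C, P)\<close>, where \<open>s A\<close> is the chosen point of the pixel \<open>A\<close>. An arc
  \<open>(A, m, B)\<close> is a pseudo arrow \<open>m\<close> together with its source and target pixels.\<close>

definition pix_quiver ::
  "'x path_structure \<Rightarrow> 'x set set \<Rightarrow> ('x set \<Rightarrow> 'x) \<Rightarrow> ('x set, 'x pix_arc) pre_digraph" where
  "pix_quiver T P s = \<lparr>
     verts = P,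
     arcs = {(A, m, B). A \<in> P \<and> B \<in> P \<and> m \<in> hom (pix_loc T P) (s A) (s B) \<and> pseudo_arrow T P m},
     tail = (\<lambda>(A, m, B). A),
     head = (\<lambda>(A, m, B). B)\<rparr>"

text \<open>\<open>\<Psi>\<close> on arrows: a walk is sent to the composite of its pseudo arrows.\<close>

definition Psi :: "'x path_structure \<Rightarrow> 'x set set \<Rightarrow> ('x set \<Rightarrow> 'x) \<Rightarrow>
    'x set \<times> 'x pix_arc list \<times> 'x set \<Rightarrow> 'x pix_loc_arrow" where
  "Psi T P s = (\<lambda>(A, p, B).
     foldr (\<lambda>(_, m, _) g. Comp (pix_loc T P) g m) p (Ident (pix_loc T P) (s B)))"

definition Psi_cong :: "'x path_structure \<Rightarrow> 'x set set \<Rightarrow> ('x set \<Rightarrow> 'x) \<Rightarrow>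
    (('x set \<times> 'x pix_arc list \<times> 'x set) \<times> ('x set \<times> 'x pix_arc list \<times> 'x set)) set" where
  "Psi_cong T P s = {(f, g). \<exists>A B. f \<in> hom (free_cat (pix_quiver T P s)) A B \<and>
     g \<in> hom (free_cat (pix_quiver T P s)) A B \<and> Psi T P s f = Psi T P s g}"

text \<open>The category \<open>C\<^sub>P\<close>, with the pixels as objects.\<close>

definition pixelation ::
  "'x path_structure \<Rightarrow> 'x set set \<Rightarrow> ('x set \<Rightarrow> 'x) \<Rightarrow> ('x set, 'x pix_arrow) category" where
  "pixelation T P s = quot_cat (free_cat (pix_quiver T P s)) (Psi_cong T P s)"

definition quiver_arrows ::
  "'x path_structure \<Rightarrow> 'x set set \<Rightarrow> ('x set \<Rightarrow> 'x) \<Rightarrow> 'x set \<Rightarrow> 'x set \<Rightarrow> 'x pix_arrow set" where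
  "quiver_arrows T P s A B =
     {Psi_cong T P s `` {(A, [(A, m, B)], B)} | m. (A, m, B) \<in> arcs (pix_quiver T P s)}"

text \<open>\<open>H\<close> is an equivalence from the localization to \<open>C\<^sub>P\<close> that sends a point to its pixel,
  fractions of elements of \<open>Sigma_P\<close> to identities, and pseudo arrows from \<open>A\<close> to \<open>B\<close> to the
  arrow from \<open>A\<close> to \<open>B\<close> of the quiver. Pseudo arrows between the points of \<open>A\<close> and \<open>B\<close> need
  not imply one between the chosen points \<open>s A\<close> and \<open>s B\<close>; the last clause asks nothing then.\<close>

definition pix_equivalence :: "'x path_structure \<Rightarrow> 'x set set \<Rightarrow> ('x set \<Rightarrow> 'x) \<Rightarrow>
    ('x, 'x pix_loc_arrow, 'x set, 'x pix_arrow) cfunctor \<Rightarrow> bool" where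
  "pix_equivalence T P s H \<longleftrightarrow>
     is_equivalence (pix_loc T P) (pixelation T P s) H \<and>
     (\<forall>A\<in>P. \<forall>x\<in>A. FObj H x = A) \<and>
     (\<forall>A\<in>P. \<forall>\<rho>\<in>Paths T. \<forall>\<rho>'\<in>Paths T. \<rho> 1 = \<rho>' 1 \<and> im \<rho> \<subseteq> A \<and> im \<rho>' \<subseteq> A \<longrightarrow>
        FArr H (pix_fraction T P \<rho> \<rho>') = Ident (pixelation T P s) A) \<and>
     (\<forall>A\<in>P. \<forall>B\<in>P. \<forall>x\<in>A. \<forall>y\<in>B. \<forall>m\<in>hom (pix_loc T P) x y.
        pseudo_arrow T P m \<and> quiver_arrows T P s A B \<noteq> {} \<longrightarrow>
        FArr H m \<in> quiver_arrows T P s A B)"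

text \<open>The composite \<open>H p\<close> on the class of a path.\<close>

definition Hp :: "'x path_structure \<Rightarrow>
    ('x set set \<Rightarrow> ('x, 'x pix_loc_arrow, 'x set, 'x pix_arrow) cfunctor) \<Rightarrow>
    'x set set \<Rightarrow> 'x pth \<Rightarrow> 'x pix_arrow" where
  "Hp T H P \<gamma> = FArr (comp_functor (H P) (pix_p T P)) (path_class T \<gamma>)"


section \<open>The functors Init\<close>

text \<open>The paths that witness initiality run inside the pixel \<open>A'\<close>: only then is the initial pixel
  unique, because \<open>A'\<close> may also be left and entered again.\<close>

definition is_initial_pixel :: "'x path_structure \<Rightarrow> 'x set set \<Rightarrow> 'x set \<Rightarrow> 'x set \<Rightarrow> bool" where
  "is_initial_pixel T P A' A \<longleftrightarrow> A \<in> P \<and> A \<subseteq> A' \<and>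
     (\<forall>B\<in>P. B \<subseteq> A' \<longrightarrow> (\<forall>y\<in>B. \<exists>x\<in>A. \<exists>\<gamma>\<in>Paths T. \<gamma> 0 = x \<and> \<gamma> 1 = y \<and> im \<gamma> \<subseteq> A'))"

definition init_pixel :: "'x path_structure \<Rightarrow> 'x set set \<Rightarrow> 'x set \<Rightarrow> 'x set" where
  "init_pixel T P A' = (THE A. is_initial_pixel T P A' A)"

text \<open>\<open>Init T s H P Q : C\<^sub>Q \<rightarrow> C\<^sub>P\<close> for a finitary refinement \<open>P\<close> of \<open>Q\<close>. The definite
  description on arrows makes the independence of the lift part of what has to be shown.\<close>

definition Init :: "'x path_structure \<Rightarrow> ('x set set \<Rightarrow> 'x set \<Rightarrow> 'x) \<Rightarrow>
    ('x set set \<Rightarrow> ('x, 'x pix_loc_arrow, 'x set, 'x pix_arrow) cfunctor) \<Rightarrow>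
    'x set set \<Rightarrow> 'x set set \<Rightarrow> ('x set, 'x pix_arrow, 'x set, 'x pix_arrow) cfunctor" where
  "Init T s H P Q = \<lparr>
     FObj = init_pixel T P,
     FArr = (\<lambda>f. THE g. \<exists>\<gamma>\<in>Paths T.
        \<gamma> 0 \<in> init_pixel T P (Dom (pixelation T Q (s Q)) f) \<and>
        \<gamma> 1 \<in> init_pixel T P (Cod (pixelation T Q (s Q)) f) \<and>
        Hp T H Q \<gamma> = f \<and> g = Hp T H P \<gamma>)\<rparr>"


section \<open>The site of screens\<close>

text \<open>The site is a thin category, given by its set \<open>S\<close> of objects and the relation \<open>le U V\<close> that
  there is a morphism from \<open>U\<close> to \<open>V\<close>.\<close>

definition thin_category :: "'u set \<Rightarrow> ('u \<Rightarrow> 'u \<Rightarrow> bool) \<Rightarrow> bool" where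
  "thin_category S le \<longleftrightarrow> (\<forall>U V. le U V \<longrightarrow> U \<in> S \<and> V \<in> S) \<and> (\<forall>U\<in>S. le U U) \<and>
     (\<forall>U V W. le U V \<and> le V W \<longrightarrow> le U W)"

text \<open>A family \<open>(U, n, V)\<close> consists of the morphisms from \<open>V 1, \<dots>, V n\<close> to \<open>U\<close>; for \<open>n = 0\<close> it is
  the empty family.\<close>

definition is_coverage ::
  "'u set \<Rightarrow> ('u \<Rightarrow> 'u \<Rightarrow> bool) \<Rightarrow> ('u \<times> nat \<times> (nat \<Rightarrow> 'u)) set \<Rightarrow> bool" where
  "is_coverage S le Cov \<longleftrightarrow>
     (\<forall>(U, n, V)\<in>Cov. U \<in> S \<and> (\<forall>i\<in>{1..n}. le (V i) U)) \<and>
     (\<forall>(U, n, V)\<in>Cov. \<forall>U'. le U' U \<longrightarrow>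
        (\<exists>n' V'. (U', n', V') \<in> Cov \<and> (\<forall>j\<in>{1..n'}. \<exists>i\<in>{1..n}. le (V' j) (V i))))"

definition is_join_cover ::
  "'x path_structure \<Rightarrow> 'x set set \<Rightarrow> nat \<Rightarrow> (nat \<Rightarrow> 'x set set) \<Rightarrow> bool" where
  "is_join_cover T P n Ps \<longleftrightarrow> n \<ge> 1 \<and> (\<forall>i\<in>{1..n}. Ps i \<in> screens T) \<and>
     P = join (Points T) {1..n} Ps \<and> P \<in> screens T \<and>
     (\<forall>i\<in>{1..n}. finitary_refinement T (Ps i) P)"

definition screen_coverage ::
  "'x path_structure \<Rightarrow> ('x set set \<times> nat \<times> (nat \<Rightarrow> 'x set set)) set" where
  "screen_coverage T = {(P, 0, Ps) | P Ps. P \<in> screens T} \<union> {(P, n, Ps). is_join_cover T P n Ps}"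

text \<open>A functor from the opposite of a thin category to PCat, given by \<open>O\<close> on objects and by the
  functor \<open>res U V\<close> from \<open>O V\<close> to \<open>O U\<close> on the morphism from \<open>U\<close> to \<open>V\<close>.\<close>

definition PCat_presheaf :: "'u set \<Rightarrow> ('u \<Rightarrow> 'u \<Rightarrow> bool) \<Rightarrow> ('u \<Rightarrow> ('o, 'm) category) \<Rightarrow>
    ('u \<Rightarrow> 'u \<Rightarrow> ('o, 'm, 'o, 'm) cfunctor) \<Rightarrow> bool" where
  "PCat_presheaf S le Ob res \<longleftrightarrow>
     (\<forall>U\<in>S. in_PCat (Ob U)) \<and>
     (\<forall>U V. le U V \<longrightarrow> is_functor (Ob V) (Ob U) (res U V)) \<and>
     (\<forall>U\<in>S. functor_eq (Ob U) (res U U) id_functor) \<and>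
     (\<forall>U V W. le U V \<and> le V W \<longrightarrow>
        functor_eq (Ob W) (res U W) (comp_functor (res U V) (res V W)))"

text \<open>The functors of the equalizer diagram.\<close>

definition Init_prod :: "'x path_structure \<Rightarrow> ('x set set \<Rightarrow> 'x set \<Rightarrow> 'x) \<Rightarrow>
    ('x set set \<Rightarrow> ('x, 'x pix_loc_arrow, 'x set, 'x pix_arrow) cfunctor) \<Rightarrow>
    'x set set \<Rightarrow> nat \<Rightarrow> (nat \<Rightarrow> 'x set set) \<Rightarrow>
    ('x set, 'x pix_arrow, nat \<Rightarrow> 'x set, nat \<Rightarrow> 'x pix_arrow) cfunctor" where
  "Init_prod T s H P n Ps = \<lparr>
     FObj = (\<lambda>A. \<lambda>i\<in>{1..n}. FObj (Init T s H (Ps i) P) A),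
     FArr = (\<lambda>f. \<lambda>i\<in>{1..n}. FArr (Init T s H (Ps i) P) f)\<rparr>"

definition pr0 :: "'x path_structure \<Rightarrow> ('x set set \<Rightarrow> 'x set \<Rightarrow> 'x) \<Rightarrow>
    ('x set set \<Rightarrow> ('x, 'x pix_loc_arrow, 'x set, 'x pix_arrow) cfunctor) \<Rightarrow>
    nat \<Rightarrow> (nat \<Rightarrow> 'x set set) \<Rightarrow>
    (nat \<Rightarrow> 'x set, nat \<Rightarrow> 'x pix_arrow, nat \<Rightarrow> nat \<Rightarrow> 'x set, nat \<Rightarrow> nat \<Rightarrow> 'x pix_arrow) cfunctor" where
  "pr0 T s H n Ps = \<lparr>
     FObj = (\<lambda>A. \<lambda>j\<in>{1..n}. \<lambda>k\<in>{1..n}. FObj (Init T s H (Ps j \<sqinter>\<^sub>P Ps k) (Ps j)) (A j)),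
     FArr = (\<lambda>f. \<lambda>j\<in>{1..n}. \<lambda>k\<in>{1..n}. FArr (Init T s H (Ps j \<sqinter>\<^sub>P Ps k) (Ps j)) (f j))\<rparr>"

definition pr1 :: "'x path_structure \<Rightarrow> ('x set set \<Rightarrow> 'x set \<Rightarrow> 'x) \<Rightarrow>
    ('x set set \<Rightarrow> ('x, 'x pix_loc_arrow, 'x set, 'x pix_arrow) cfunctor) \<Rightarrow>
    nat \<Rightarrow> (nat \<Rightarrow> 'x set set) \<Rightarrow>
    (nat \<Rightarrow> 'x set, nat \<Rightarrow> 'x pix_arrow, nat \<Rightarrow> nat \<Rightarrow> 'x set, nat \<Rightarrow> nat \<Rightarrow> 'x pix_arrow) cfunctor" where
  "pr1 T s H n Ps = \<lparr>
     FObj = (\<lambda>A. \<lambda>j\<in>{1..n}. \<lambda>k\<in>{1..n}. FObj (Init T s H (Ps j \<sqinter>\<^sub>P Ps k) (Ps k)) (A k)),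
     FArr = (\<lambda>f. \<lambda>j\<in>{1..n}. \<lambda>k\<in>{1..n}. FArr (Init T s H (Ps j \<sqinter>\<^sub>P Ps k) (Ps k)) (f k))\<rparr>"

end

theory Submission
  imports Defs
begin

text \<open>
  Let \<open>C\<close> be the path category and \<open>\<Sigma>\<close> the set of classes of paths inside a pixel of a screen.
  The arrows of \<open>C\<close> are cancellable, and \<open>\<Sigma>\<close> is thin, closed under factors and satisfies both Ore
  conditions. Hence \<open>C \<rightarrow> C[\<Sigma>\<^sup>-\<^sup>1]\<close> is faithful, and \<open>\<Phi> = H p\<close> is a functor from \<open>C\<close> to the category of
  pixels that is surjective on arrows, faithful on parallel arrows and sends \<open>\<Sigma>\<close> to identities.
  This makes every \<open>Init\<close> fully faithful and injective on objects, and makes the \<open>Init\<close> compose.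

  A family of pixels \<open>A\<^sub>i\<close> on which the two projections agree satisfies that \<open>A\<^sub>j \<inter> A\<^sub>k\<close> is initial
  in \<open>A\<^sub>j\<close> and in \<open>A\<^sub>k\<close>. So a point that can be reached, inside its pixel of the join, from one \<open>A\<^sub>j\<close>
  can be reached from all of them, and the set of these points is closed under sharing a pixel of
  some screen of the family. It is therefore the pixel of the join, and each \<open>A\<^sub>i\<close> is its initial
  pixel. The components of an arrow then lift along the fully faithful \<open>Init\<close>, and the lifts agree
  since \<open>Init\<close> into the meet of two screens is faithful.

  The category of pixels is a path category because a piecewise image of paths in the space of
  pixels determines its arrow, by (S5).
\<close>

text \<open>Equality in \<open>localization\<close> is derivability in a generated congruence, so
  faithfulness cannot be read off from it. It comes from a second category \<open>dcat\<close>,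
  whose arrows are arrows of \<open>C\<close> up to the explicit relation \<open>apx\<close>: the
  functor from \<open>C\<close> to \<open>dcat\<close> sends \<open>S\<close> to identities, so
  evaluating zigzags in \<open>dcat\<close> shows that it identifies whatever the localization
  identifies. Surjectivity of \<open>H p\<close> is obtained by straightening a zigzag letter by
  letter: formal inverses go to identities, and an arrow of \<open>C\<close> can be moved to end at
  any point of the pixel of its end. The obstacle in making the pixels a path category is that pixel
  traces of paths of \<open>T\<close> need not be closed under concatenation, because consecutive
  paths may meet only up to a pixel. Paths of pixels are therefore glued from finitely many traces,
  and the represented arrow has to be shown independent of the cutting. For initial pixels,
  finitariness of the refinement gives existence, and thinness of the coarse pixels gives
  uniqueness.\<close>

context is_category begin

lemma hom_iff: "f \<in> hom C x y \<longleftrightarrow> f \<in> Arr C \<and> Dom C f = x \<and> Cod C f = y"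
  by (simp add: hom_def)

lemma hom_obj: "f \<in> hom C x y \<Longrightarrow> x \<in> Obj C \<and> y \<in> Obj C"
  using dom_obj cod_obj by (auto simp: hom_def)

lemma comp_hom: "f \<in> hom C x y \<Longrightarrow> g \<in> hom C y z \<Longrightarrow> Comp C g f \<in> hom C x z"
  using comp by (auto simp: hom_def)

lemma ident_hom: "x \<in> Obj C \<Longrightarrow> Ident C x \<in> hom C x x"
  using ident by (auto simp: hom_def)

lemma assoc_hom:
  "\<lbrakk>f \<in> hom C x y; g \<in> hom C y z; h \<in> hom C z w\<rbrakk> \<Longrightarrow> Comp C h (Comp C g f) = Comp C (Comp C h g) f"
  using comp_assoc by (auto simp: hom_def)

lemma comp_ident_hom:
  "f \<in> hom C x y \<Longrightarrow> Comp C f (Ident C x) = f"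
  "f \<in> hom C x y \<Longrightarrow> Comp C (Ident C y) f = f"
  using comp_ident_left comp_ident_right by (auto simp: hom_def)

end

lemma arr_hom: "f \<in> Arr C \<Longrightarrow> f \<in> hom C (Dom C f) (Cod C f)"
  by (simp add: hom_def)

lemma homD: "f \<in> hom C x y \<Longrightarrow> f \<in> Arr C \<and> Dom C f = x \<and> Cod C f = y"
  by (simp add: hom_def)

lemma functor_hom:
  assumes "is_functor C D F" "f \<in> hom C x y"
  shows "FArr F f \<in> hom D (FObj F x) (FObj F y)"
proof -
  interpret is_category C using assms(1) by (simp add: is_functor_def)
  show ?thesis using assms hom_obj[OF assms(2)] by (simp add: is_functor_def)
qed

lemma functor_obj: "is_functor C D F \<Longrightarrow> x \<in> Obj C \<Longrightarrow> FObj F x \<in> Obj D"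
  by (simp add: is_functor_def)

lemma functor_ident:
  "is_functor C D F \<Longrightarrow> x \<in> Obj C \<Longrightarrow> FArr F (Ident C x) = Ident D (FObj F x)"
  by (simp add: is_functor_def)

lemma functor_comp:
  "\<lbrakk>is_functor C D F; f \<in> hom C x y; g \<in> hom C y z\<rbrakk> \<Longrightarrow>
    FArr F (Comp C g f) = Comp D (FArr F g) (FArr F f)"
  by (simp add: is_functor_def hom_def)

lemma is_functorI:
  assumes "is_category C" "is_category D"
    and "\<And>x. x \<in> Obj C \<Longrightarrow> FObj F x \<in> Obj D"
    and "\<And>x y f. f \<in> hom C x y \<Longrightarrow> FArr F f \<in> hom D (FObj F x) (FObj F y)"
    and "\<And>x. x \<in> Obj C \<Longrightarrow> FArr F (Ident C x) = Ident D (FObj F x)"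
    and "\<And>x y z f g. f \<in> hom C x y \<Longrightarrow> g \<in> hom C y z \<Longrightarrow>
      FArr F (Comp C g f) = Comp D (FArr F g) (FArr F f)"
  shows "is_functor C D F"
  using assms(1-5) unfolding is_functor_def
  by (auto intro!: assms(6) simp: hom_def)

lemma functor_comp_functor:
  assumes F: "is_functor A B F" and G: "is_functor B D G"
  shows "is_functor A D (comp_functor G F)"
proof (rule is_functorI)
  show "is_category A" "is_category D" using assms by (auto simp: is_functor_def)
next
  fix x assume "x \<in> Obj A"
  then show "FObj (comp_functor G F) x \<in> Obj D"
    "FArr (comp_functor G F) (Ident A x) = Ident D (FObj (comp_functor G F) x)"
    using functor_obj[OF F] functor_obj[OF G] functor_ident[OF F] functor_ident[OF G]
    by (auto simp: comp_functor_def)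
next
  fix x y f assume "f \<in> hom A x y"
  then show "FArr (comp_functor G F) f \<in> hom D (FObj (comp_functor G F) x) (FObj (comp_functor G F) y)"
    using functor_hom[OF F] functor_hom[OF G] by (auto simp: comp_functor_def)
next
  fix x y z f g assume "f \<in> hom A x y" "g \<in> hom A y z"
  then show "FArr (comp_functor G F) (Comp A g f) =
      Comp D (FArr (comp_functor G F) g) (FArr (comp_functor G F) f)"
    using functor_comp[OF F, of f x y g z]
      functor_comp[OF G functor_hom[OF F, of f x y] functor_hom[OF F, of g y z]]
    by (simp add: comp_functor_def)
qed

section \<open>Quotients and localizations\<close>

text \<open>\<open>quot_cat\<close> composes two classes through all composable pairs of
  representatives at once. The congruence property puts all these composites into one class, so a
  single pair computes it.\<close>

lemma quot_class_comp:
  assumes eq: "equiv (Arr C) r"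
    and ends: "\<And>f g. (f, g) \<in> r \<Longrightarrow> Dom C f = Dom C g \<and> Cod C f = Cod C g"
    and cong: "\<And>f f' g g'. \<lbrakk>(f, f') \<in> r; (g, g') \<in> r; Cod C f = Dom C g\<rbrakk> \<Longrightarrow>
      (Comp C g f, Comp C g' f') \<in> r"
    and fg: "f \<in> Arr C" "g \<in> Arr C" "Cod C f = Dom C g"
  shows "Comp (quot_cat C r) (r `` {g}) (r `` {f}) = r `` {Comp C g f}"
proof -
  have refl: "(f, f) \<in> r" "(g, g) \<in> r" using eq fg by (auto simp: equiv_def refl_on_def)
  have "r `` {Comp C g' f' | g' f'. g' \<in> r `` {g} \<and> f' \<in> r `` {f} \<and> Cod C f' = Dom C g'} =
      r `` {Comp C g f}" (is "?L = ?R")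
  proof (intro equalityI subsetI)
    fix h assume "h \<in> ?L"
    then obtain g' f' where "(g, g') \<in> r" "(f, f') \<in> r" "Cod C f' = Dom C g'" "(Comp C g' f', h) \<in> r"
      by auto
    then show "h \<in> ?R" using cong[of f f' g g'] fg eq by (auto simp: equiv_def dest: transD)
  next
    fix h assume "h \<in> ?R"
    then show "h \<in> ?L" using refl fg(3) by blast
  qed
  then show ?thesis by (simp add: quot_cat_def)
qed

lemma quot_class_ends:
  assumes eq: "equiv (Arr C) r"
    and ends: "\<And>f g. (f, g) \<in> r \<Longrightarrow> Dom C f = Dom C g \<and> Cod C f = Cod C g"
    and f: "f \<in> Arr C"
  shows "r `` {f} \<in> hom (quot_cat C r) (Dom C f) (Cod C f)"
proof -
  have "(f, f) \<in> r" using eq f by (auto simp: equiv_def refl_on_def)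
  moreover have "Dom C ` (r `` {f}) \<subseteq> {Dom C f}" "Cod C ` (r `` {f}) \<subseteq> {Cod C f}"
    using ends[of f] by (simp_all add: image_subset_iff)
  ultimately have "Dom C ` (r `` {f}) = {Dom C f}" "Cod C ` (r `` {f}) = {Cod C f}"
    by blast+
  then show ?thesis using f by (auto simp: hom_def quot_cat_def quotient_def)
qed

lemma free_cat_simps [simp]:
  "Obj (free_cat G) = verts G"
  "(u, p, v) \<in> Arr (free_cat G) \<longleftrightarrow> pre_digraph.awalk G u p v"
  "Dom (free_cat G) (u, p, v) = u" "Cod (free_cat G) (u, p, v) = v"
  "Ident (free_cat G) u = (u, [], u)"
  "Comp (free_cat G) (v', q, w) (u, p, v) = (u, p @ q, w)"
  by (auto simp: free_cat_def)

lemma free_cat_comp: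
  assumes "wf_digraph G" "f \<in> Arr (free_cat G)" "g \<in> Arr (free_cat G)"
    "Cod (free_cat G) f = Dom (free_cat G) g"
  shows "Comp (free_cat G) g f \<in> Arr (free_cat G) \<and>
    Dom (free_cat G) (Comp (free_cat G) g f) = Dom (free_cat G) f \<and>
    Cod (free_cat G) (Comp (free_cat G) g f) = Cod (free_cat G) g"
proof -
  obtain u p v v' q w where "f = (u, p, v)" "g = (v', q, w)" by (metis prod.exhaust)
  then show ?thesis using assms wf_digraph.awalk_appendI by auto
qed

locale localizing = is_category C for C :: "('o, 'm) category" +
  fixes S :: "'m set"
  assumes S_arr: "S \<subseteq> Arr C"
begin

abbreviation "zigzags \<equiv> zigzag_quiver C S"
abbreviation "walk \<equiv> pre_digraph.awalk zigzags"
abbreviation "W \<equiv> free_cat zigzags"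
abbreviation "rel \<equiv> localization_cong C S"

lemma wf_zigzag: "wf_digraph zigzags"
  using dom_obj cod_obj S_arr by (unfold_locales) (auto simp: zigzag_quiver_def)

lemma zigzag_simps [simp]:
  "verts zigzags = Obj C"
  "arcs zigzags = Inl ` Arr C \<union> Inr ` S"
  "tail zigzags (Inl f) = Dom C f" "head zigzags (Inl f) = Cod C f"
  "tail zigzags (Inr f) = Cod C f" "head zigzags (Inr f) = Dom C f"
  by (auto simp: zigzag_quiver_def)

lemma walk_Nil [simp]: "walk x [] y \<longleftrightarrow> x = y \<and> x \<in> Obj C"
  using wf_digraph.awalk_Nil_iff[OF wf_zigzag] by auto

lemma walk_Cons [simp]: "walk x (e # p) y \<longleftrightarrow>
  e \<in> Inl ` Arr C \<union> Inr ` S \<and> x = tail zigzags e \<and>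
    walk (head zigzags e) p y"
  using wf_digraph.awalk_Cons_iff[OF wf_zigzag] by simp

lemma walk_end: "walk x p y \<Longrightarrow> x \<in> Obj C \<and> y \<in> Obj C"
  using wf_digraph.awalk_hd_in_verts[OF wf_zigzag] wf_digraph.awalk_last_in_verts[OF wf_zigzag]
  by auto

lemma relations_parallel:
  assumes "(u, v) \<in> localization_relations C S"
  shows "u \<in> Arr W \<and> v \<in> Arr W \<and> Dom W u = Dom W v \<and> Cod W u = Cod W v"
proof -
  consider (a) x where "x \<in> Obj C" "u = (x, [Inl (Ident C x)], x)" "v = (x, [], x)"
    | (b) f g where "f \<in> Arr C" "g \<in> Arr C" "Cod C f = Dom C g"
        "u = (Dom C f, [Inl f, Inl g], Cod C g)" "v = (Dom C f, [Inl (Comp C g f)], Cod C g)"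
    | (c) s where "s \<in> S" "u = (Dom C s, [Inl s, Inr s], Dom C s)" "v = (Dom C s, [], Dom C s)"
    | (d) s where "s \<in> S" "u = (Cod C s, [Inr s, Inl s], Cod C s)" "v = (Cod C s, [], Cod C s)"
    using assms unfolding localization_relations_def by blast
  then show ?thesis
    using S_arr ident comp dom_obj cod_obj by cases auto
qed

lemma cong_parallel:
  assumes "(u, v) \<in> rel"
  shows "u \<in> Arr W \<and> v \<in> Arr W \<and> Dom W u = Dom W v \<and> Cod W u = Cod W v"
  using assms unfolding localization_cong_def
proof (induction rule: congruence_closure.induct)
  case (comp f f' g g')
  then show ?case using free_cat_comp[OF wf_zigzag] by metis
qed (use relations_parallel in auto)

lemma cong_equiv: "equiv (Arr W) rel"
proof (rule equivI)
  show "refl_on (Arr W) rel"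
    by (auto simp: refl_on_def localization_cong_def intro: congruence_closure.refl)
  show "sym rel" by (auto simp: sym_def localization_cong_def intro: congruence_closure.sym)
  show "trans rel" by (auto simp: trans_def localization_cong_def intro: congruence_closure.trans)
  show "rel \<subseteq> Arr W \<times> Arr W" using cong_parallel by force
qed

lemma word_hom:
  assumes "walk x p y"
  shows "rel `` {(x, p, y)} \<in> hom (localization C S) x y"
  using quot_class_ends[OF cong_equiv, of "(x, p, y)"] cong_parallel assms
  by (auto simp: localization_def)

lemma word_comp:
  assumes "walk x p y" "walk y q z"
  shows "Comp (localization C S) (rel `` {(y, q, z)}) (rel `` {(x, p, y)}) = rel `` {(x, p @ q, z)}"
proof -
  have "Comp (quot_cat W rel) (rel `` {(y, q, z)}) (rel `` {(x, p, y)}) =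
      rel `` {Comp W (y, q, z) (x, p, y)}"
  proof (rule quot_class_comp[OF cong_equiv])
    show "(Comp W g f, Comp W g' f') \<in> rel"
      if "(f, f') \<in> rel" "(g, g') \<in> rel" "Cod W f = Dom W g" for f f' g g'
      using that unfolding localization_cong_def by (rule congruence_closure.comp)
  qed (use cong_parallel assms in auto)
  then show ?thesis by (simp add: localization_def)
qed

lemma arr_word:
  assumes "m \<in> hom (localization C S) x y"
  obtains p where "walk x p y" "m = rel `` {(x, p, y)}"
proof -
  have "m \<in> Arr W // rel" "Dom (localization C S) m = x" "Cod (localization C S) m = y"
    using assms by (auto simp: hom_def localization_def quot_cat_def)
  then obtain u p v where w: "(u, p, v) \<in> Arr W" "m = rel `` {(u, p, v)}"
    by (auto simp: quotient_def)
  then show ?thesis using word_hom[of u p v] assms that by (auto simp: hom_def)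
qed

lemma ident_word: "Ident (localization C S) x = rel `` {(x, [], x)}"
  by (simp add: localization_def quot_cat_def)

lemma word_eq: "(u, v) \<in> rel \<Longrightarrow> rel `` {u} = rel `` {v}"
  using cong_equiv equiv_class_eq by metis

text \<open>That the localization is a category is taken as a hypothesis: it will be supplied by the
  equivalence \<open>H\<close> out of it, since \<open>is_functor\<close> includes that both ends
  are categories.\<close>

lemma loc_functor_functor:
  assumes "is_category (localization C S)"
  shows "is_functor C (localization C S) (loc_functor C S)"
proof (rule is_functorI[OF is_category_axioms assms])
  show "FObj (loc_functor C S) x \<in> Obj (localization C S)" if "x \<in> Obj C" for x
    using that by (simp add: loc_functor_def localization_def quot_cat_def)
  show "FArr (loc_functor C S) f \<in> hom (localization C S) (FObj (loc_functor C S) x) (FObj (loc_functor C S) y)"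
    if "f \<in> hom C x y" for f x y
    using that cod_obj word_hom by (auto simp: loc_functor_def hom_iff)
  show "FArr (loc_functor C S) (Ident C x) = Ident (localization C S) (FObj (loc_functor C S) x)"
    if "x \<in> Obj C" for x
  proof -
    have "((x, [Inl (Ident C x)], x), (x, [], x)) \<in> rel"
      unfolding localization_cong_def
      by (rule congruence_closure.base) (use that in \<open>auto simp: localization_relations_def\<close>)
    then show ?thesis using ident[OF that] word_eq by (simp add: ident_word loc_functor_def)
  qed
  show "FArr (loc_functor C S) (Comp C g f) =
      Comp (localization C S) (FArr (loc_functor C S) g) (FArr (loc_functor C S) f)"
    if fg: "f \<in> hom C x y" "g \<in> hom C y z" for f g x y z
  proof -
    have *: "f \<in> Arr C" "g \<in> Arr C" "Dom C f = x" "Cod C f = y" "Dom C g = y" "Cod C g = z"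
      using fg by (auto simp: hom_iff)
    have "((x, [Inl f, Inl g], z), (x, [Inl (Comp C g f)], z)) \<in> rel"
      unfolding localization_cong_def
      by (rule congruence_closure.base) (use * in \<open>auto simp: localization_relations_def\<close>)
    then have "rel `` {(x, [Inl f, Inl g], z)} = rel `` {(x, [Inl (Comp C g f)], z)}"
      by (rule word_eq)
    then show ?thesis
      using word_comp[of x "[Inl f]" y "[Inl g]" z] * cod_obj[of f] cod_obj[of g] comp[of f g]
      by (simp add: loc_functor_def)
  qed
qed

text \<open>The functor on zigzags induced by \<open>F\<close> and a choice \<open>J\<close> of inverses in \<open>D\<close>.\<close>

definition zigzag_value ::
  "('p, 'n) category \<Rightarrow> ('o, 'm, 'p, 'n) cfunctor \<Rightarrow> ('m \<Rightarrow> 'n) \<Rightarrow> 'o \<times> ('m + 'm) list \<times> 'o \<Rightarrow> 'n" where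
  "zigzag_value D F J = (\<lambda>(x, p, y).
     foldr (\<lambda>e g. Comp D g (case_sum (FArr F) J e)) p (Ident D (FObj F y)))"

text \<open>The part of the universal property that faithfulness requires. If \<open>F\<close> makes
  every element of \<open>S\<close> invertible, zigzags can be evaluated in \<open>D\<close>, and
  the value is constant on congruence classes; so arrows that the localization identifies have the
  same image under \<open>F\<close>.\<close>

lemma localization_functor_inj:
  assumes F: "is_functor C D F"
    and J: "\<And>s. s \<in> S \<Longrightarrow> J s \<in> hom D (FObj F (Cod C s)) (FObj F (Dom C s))"
      "\<And>s. s \<in> S \<Longrightarrow> Comp D (J s) (FArr F s) = Ident D (FObj F (Dom C s))"
      "\<And>s. s \<in> S \<Longrightarrow> Comp D (FArr F s) (J s) = Ident D (FObj F (Cod C s))"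
    and fg: "f \<in> hom C x y" "g \<in> hom C x y" "FArr (loc_functor C S) f = FArr (loc_functor C S) g"
  shows "FArr F f = FArr F g"
proof -
  interpret D: is_category D using F by (simp add: is_functor_def)
  have value_hom: "zigzag_value D F J (x, p, y) \<in> hom D (FObj F x) (FObj F y)"
    if "walk x p y" for x p y
    using that
  proof (induction p arbitrary: x)
    case Nil
    then show ?case using D.ident_hom functor_obj[OF F] by (auto simp: zigzag_value_def)
  next
    case (Cons e p)
    let ?z = "head zigzags e"
    have "zigzag_value D F J (?z, p, y) \<in> hom D (FObj F ?z) (FObj F y)"
      using Cons by auto
    moreover have "case_sum (FArr F) J e \<in> hom D (FObj F x) (FObj F ?z)"
      using Cons.prems J(1) functor_hom[OF F] arr_hom[of _ C] by auto
    ultimately show ?case using D.comp_hom by (simp add: zigzag_value_def)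
  qed
  have value_append: "zigzag_value D F J (x, p @ q, z) =
      Comp D (zigzag_value D F J (y, q, z)) (zigzag_value D F J (x, p, y))"
    if "walk x p y" "walk y q z"
    for x y z p q
    using that(1)
  proof (induction p arbitrary: x)
    case Nil
    then show ?case using D.comp_ident_hom value_hom[OF that(2)] by (auto simp: zigzag_value_def)
  next
    case (Cons e p)
    let ?z = "head zigzags e"
    have p: "walk ?z p y" using Cons.prems by simp
    have e: "case_sum (FArr F) J e \<in> hom D (FObj F x) (FObj F ?z)"
      using Cons.prems J(1) functor_hom[OF F] arr_hom[of _ C] by auto
    show ?case
      using Cons.IH[OF p] D.assoc_hom[OF e value_hom[OF p] value_hom[OF that(2)]]
      by (simp add: zigzag_value_def)
  qed
  \<comment> \<open>Induction on the generation of the congruence. The four base cases are the four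
    families of relations; closure under composition is \<open>value_append\<close>.\<close>
  have "zigzag_value D F J u = zigzag_value D F J v" if "(u, v) \<in> rel" for u v
    using that unfolding localization_cong_def
  proof (induction rule: congruence_closure.induct)
    case (base u v)
    then consider (a) x where "x \<in> Obj C" "u = (x, [Inl (Ident C x)], x)" "v = (x, [], x)"
      | (b) f g where "f \<in> Arr C" "g \<in> Arr C" "Cod C f = Dom C g"
          "u = (Dom C f, [Inl f, Inl g], Cod C g)" "v = (Dom C f, [Inl (Comp C g f)], Cod C g)"
      | (c) s where "s \<in> S" "u = (Dom C s, [Inl s, Inr s], Dom C s)" "v = (Dom C s, [], Dom C s)"
      | (d) s where "s \<in> S" "u = (Cod C s, [Inr s, Inl s], Cod C s)" "v = (Cod C s, [], Cod C s)"
      unfolding localization_relations_def by blast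
    then show ?case
    proof cases
      case a
      then show ?thesis
        using functor_ident[OF F] D.comp_ident_hom(1)[OF D.ident_hom[OF functor_obj[OF F a(1)]]]
        by (auto simp: zigzag_value_def)
    next
      case b
      then have fg: "f \<in> hom C (Dom C f) (Dom C g)" "g \<in> hom C (Dom C g) (Cod C g)"
        by (auto simp: hom_def)
      show ?thesis
        using b functor_comp[OF F fg] functor_hom[OF F fg(1)] functor_hom[OF F fg(2)]
          functor_hom[OF F comp_hom[OF fg]] D.comp_ident_hom
        by (simp add: zigzag_value_def)
    next
      case c
      then show ?thesis using J(2) D.comp_ident_hom(2)[OF J(1)] by (simp add: zigzag_value_def)
    next
      case d
      then have "FArr F s \<in> hom D (FObj F (Dom C s)) (FObj F (Cod C s))"
        using functor_hom[OF F arr_hom] S_arr by auto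
      then show ?thesis using d J(3) D.comp_ident_hom(2) by (simp add: zigzag_value_def)
    qed
  next
    case (comp u u' v v')
    obtain x p y where u: "u = (x, p, y)" by (cases u)
    obtain x' p' y' where u': "u' = (x', p', y')" by (cases u')
    obtain a q b where v: "v = (a, q, b)" by (cases v)
    obtain a' q' b' where v': "v' = (a', q', b')" by (cases v')
    have 1: "walk x p y" "walk x' p' y'"
      "x = x'" "y = y'"
      using cong_parallel[of u u'] comp.hyps(1) by (auto simp: localization_cong_def u u')
    have 2: "walk a q b" "walk a' q' b'"
      "a = a'" "b = b'"
      using cong_parallel[of v v'] comp.hyps(2) by (auto simp: localization_cong_def v v')
    have "y = a" using comp.hyps by (simp add: u v)
    then show ?case
      using value_append[of x p y q b] value_append[of x' p' y' q' b'] comp.IH 1 2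
      by (simp add: u u' v v')
  qed auto
  moreover have "((x, [Inl f], y), (x, [Inl g], y)) \<in> rel"
    using fg cod_obj by (intro eq_equiv_class[OF _ cong_equiv]) (auto simp: loc_functor_def hom_iff)
  ultimately have "zigzag_value D F J (x, [Inl f], y) = zigzag_value D F J (x, [Inl g], y)"
    by blast
  then show ?thesis
    using D.comp_ident_hom(2)[OF functor_hom[OF F fg(1)]] D.comp_ident_hom(2)[OF functor_hom[OF F fg(2)]]
    by (simp add: zigzag_value_def)
qed

end

section \<open>Categories with a calculus of pixels\<close>

text \<open>A screen as seen from the path category alone. Cancellation is axiom (f) of a triple,
  \<open>S_thin\<close> and \<open>S_factor\<close> rest on (S1), the Ore conditions are (S3), and
  \<open>span\<close> and \<open>cospan\<close> condense the walks of (S2). Conditions (S4) and (S5)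
  enter only with paths, in \<open>V_track_unique\<close>.\<close>

locale pixel_category = localizing C S for C :: "('o, 'm) category" and S :: "'m set" +
  fixes P :: "'o set set"
  assumes partition: "partition_on (Obj C) P"
    and cancel_left: "\<lbrakk>f \<in> hom C x y; f' \<in> hom C x y; g \<in> hom C y z; Comp C g f = Comp C g f'\<rbrakk> \<Longrightarrow> f = f'"
    and cancel_right: "\<lbrakk>f \<in> hom C x y; g \<in> hom C y z; g' \<in> hom C y z; Comp C g f = Comp C g' f\<rbrakk> \<Longrightarrow> g = g'"
    and S_block: "s \<in> S \<Longrightarrow> \<exists>A\<in>P. Dom C s \<in> A \<and> Cod C s \<in> A"
    and S_ident: "x \<in> Obj C \<Longrightarrow> Ident C x \<in> S"
    and S_comp: "\<lbrakk>s \<in> S; t \<in> S; Cod C s = Dom C t\<rbrakk> \<Longrightarrow> Comp C t s \<in> S"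
    and S_factor: "\<lbrakk>f \<in> hom C x y; g \<in> hom C y z; Comp C g f \<in> S\<rbrakk> \<Longrightarrow> f \<in> S \<and> g \<in> S"
    and S_thin: "\<lbrakk>s \<in> S; t \<in> S; s \<in> hom C x y; t \<in> hom C x y\<rbrakk> \<Longrightarrow> s = t"
    and ore: "\<lbrakk>f \<in> hom C x y; s \<in> S; s \<in> hom C x z\<rbrakk> \<Longrightarrow>
      \<exists>w s' f'. s' \<in> S \<and> s' \<in> hom C y w \<and> f' \<in> hom C z w \<and> Comp C s' f = Comp C f' s"
    and ore_dual: "\<lbrakk>f \<in> hom C y x; s \<in> S; s \<in> hom C z x\<rbrakk> \<Longrightarrow>
      \<exists>w s' f'. s' \<in> S \<and> s' \<in> hom C w y \<and> f' \<in> hom C w z \<and> Comp C f s' = Comp C s f'"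
    and span: "\<lbrakk>A \<in> P; x \<in> A; y \<in> A\<rbrakk> \<Longrightarrow>
      \<exists>w s t. s \<in> S \<and> t \<in> S \<and> s \<in> hom C w x \<and> t \<in> hom C w y"
    and cospan: "\<lbrakk>A \<in> P; x \<in> A; y \<in> A\<rbrakk> \<Longrightarrow>
      \<exists>w s t. s \<in> S \<and> t \<in> S \<and> s \<in> hom C x w \<and> t \<in> hom C y w"
begin

definition blk :: "'o \<Rightarrow> 'o set" where
  "blk x = (THE A. A \<in> P \<and> x \<in> A)"

lemma blk_eq: "A \<in> P \<Longrightarrow> x \<in> A \<Longrightarrow> blk x = A"
  unfolding blk_def using partition by (intro the_equality) (auto simp: partition_on_def disjoint_def)

lemma blk_mem:
  assumes "x \<in> Obj C" shows "blk x \<in> P \<and> x \<in> blk x"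
proof -
  obtain A where "A \<in> P" "x \<in> A" using assms partition by (auto simp: partition_on_def)
  then show ?thesis using blk_eq by simp
qed

lemma block_obj: "A \<in> P \<Longrightarrow> x \<in> A \<Longrightarrow> x \<in> Obj C"
  using partition by (auto simp: partition_on_def)

lemma block_nonempty: "A \<in> P \<Longrightarrow> A \<noteq> {}"
  using partition by (auto simp: partition_on_def)

lemma S_hom_block: "s \<in> S \<Longrightarrow> s \<in> hom C x y \<Longrightarrow> A \<in> P \<Longrightarrow> x \<in> A \<longleftrightarrow> y \<in> A"
  using S_block[of s] blk_eq by (auto simp: hom_def)

lemma S_blk: "s \<in> S \<Longrightarrow> s \<in> hom C x y \<Longrightarrow> blk x = blk y"
  using S_block[of s] blk_eq by (auto simp: hom_def)

text \<open>The Ore square of two arrows in \<open>S\<close> lies in \<open>S\<close> entirely: its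
  diagonal is a composite of elements of \<open>S\<close>, and the remaining side is a factor of the
  diagonal.\<close>

lemma S_square:
  assumes "s \<in> S" "t \<in> S" "s \<in> hom C x y" "t \<in> hom C x z"
  obtains w s' t' where "s' \<in> S" "t' \<in> S" "s' \<in> hom C y w" "t' \<in> hom C z w" "Comp C s' s = Comp C t' t"
proof -
  obtain w s' t' where *: "s' \<in> S" "s' \<in> hom C y w" "t' \<in> hom C z w" "Comp C s' s = Comp C t' t"
    using ore[OF assms(3) assms(2,4)] by blast
  have "Comp C t' t \<in> S" using S_comp[of s s'] * assms by (auto simp: hom_def)
  then show ?thesis using that * S_factor[OF assms(4) *(3)] by blast
qed

lemma S_square_dual:
  assumes "s \<in> S" "t \<in> S" "s \<in> hom C y x" "t \<in> hom C z x"
  obtains w s' t' where "s' \<in> S" "t' \<in> S" "s' \<in> hom C w y" "t' \<in> hom C w z" "Comp C s s' = Comp C t t'"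
proof -
  obtain w s' t' where *: "s' \<in> S" "s' \<in> hom C w y" "t' \<in> hom C w z" "Comp C s s' = Comp C t t'"
    using ore_dual[OF assms(3) assms(2,4)] by blast
  have "Comp C t t' \<in> S" using S_comp[of s' s] * assms by (auto simp: hom_def)
  then show ?thesis using that * S_factor[OF *(3) assms(4)] by blast
qed

lemma S_comp_hom: "\<lbrakk>s \<in> S; t \<in> S; s \<in> hom C x y; t \<in> hom C y z\<rbrakk> \<Longrightarrow> Comp C t s \<in> S \<and> Comp C t s \<in> hom C x z"
  using S_comp comp_hom by (auto simp: hom_def)

text \<open>\<open>a\<close> and \<open>b\<close> agree once \<open>S\<close> is collapsed. Their
  endpoints need only share pixels, so both are extended by arrows of \<open>S\<close> on either
  side until they are parallel, and are then compared in \<open>C\<close>.\<close>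

definition apx :: "'m \<Rightarrow> 'm \<Rightarrow> bool" where
  "apx a b \<longleftrightarrow> (\<exists>x y x' y' u v s s' t t'. a \<in> hom C x y \<and> b \<in> hom C x' y' \<and>
     s \<in> S \<and> s' \<in> S \<and> t \<in> S \<and> t' \<in> S \<and>
     s \<in> hom C u x \<and> s' \<in> hom C y v \<and> t \<in> hom C u x' \<and> t' \<in> hom C y' v \<and>
     Comp C s' (Comp C a s) = Comp C t' (Comp C b t))"

lemma apxI:
  assumes "a \<in> hom C x y" "b \<in> hom C x' y'" "s \<in> S" "s' \<in> S" "t \<in> S" "t' \<in> S"
    "s \<in> hom C u x" "s' \<in> hom C y v" "t \<in> hom C u x'" "t' \<in> hom C y' v"
    "Comp C s' (Comp C a s) = Comp C t' (Comp C b t)"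
  shows "apx a b"
  unfolding apx_def
  by (rule exI[of _ x], rule exI[of _ y], rule exI[of _ x'], rule exI[of _ y'], rule exI[of _ u],
      rule exI[of _ v], rule exI[of _ s], rule exI[of _ s'], rule exI[of _ t], rule exI[of _ t'])
    (simp add: assms)

lemma apx_sym: "apx a b \<Longrightarrow> apx b a"
  unfolding apx_def by metis

lemma apx_blk: "apx a b \<Longrightarrow> a \<in> Arr C \<and> b \<in> Arr C \<and> blk (Dom C a) = blk (Dom C b) \<and> blk (Cod C a) = blk (Cod C b)"
  unfolding apx_def using S_blk by (metis homD)

lemmas arr_simps = hom_iff comp comp_assoc[symmetric]

lemma apx_pre:
  assumes "a \<in> hom C x y" "s \<in> S" "s \<in> hom C w x"
  shows "apx a (Comp C a s)"
proof -
  have "Ident C w \<in> S" "Ident C w \<in> hom C w w" "Ident C y \<in> S" "Ident C y \<in> hom C y y"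
    using assms hom_obj S_ident ident_hom by blast+
  moreover have "Comp C (Ident C y) (Comp C a s) = Comp C (Ident C y) (Comp C (Comp C a s) (Ident C w))"
    using comp_ident_hom comp_hom[OF assms(3,1)] by simp
  ultimately show ?thesis
    unfolding apx_def using assms comp_hom[OF assms(3,1)] by blast
qed

lemma apx_post:
  assumes "a \<in> hom C x y" "s \<in> S" "s \<in> hom C y w"
  shows "apx a (Comp C s a)"
proof -
  have "Ident C x \<in> S" "Ident C x \<in> hom C x x" "Ident C w \<in> S" "Ident C w \<in> hom C w w"
    using assms hom_obj S_ident ident_hom by blast+
  moreover have "Comp C s (Comp C a (Ident C x)) = Comp C (Ident C w) (Comp C (Comp C s a) (Ident C x))"
    using comp_ident_hom(1)[OF assms(1)] comp_ident_hom[OF comp_hom[OF assms(1,3)]] by simp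
  ultimately show ?thesis
    unfolding apx_def using assms comp_hom[OF assms(1,3)] by blast
qed

lemma apx_refl: "a \<in> Arr C \<Longrightarrow> apx a a"
  using apx_post[OF arr_hom S_ident ident_hom, of a] comp_ident_left cod_obj by auto

text \<open>The two witnesses extend the middle arrow \<open>b\<close> differently. A dual Ore
  square at its source and an Ore square at its target merge the extensions into a common
  one.\<close>

lemma apx_trans:
  assumes "apx a b" "apx b c"
  shows "apx a c"
proof -
  obtain x y x' y' u v s s' t t' where 1: "a \<in> hom C x y" "b \<in> hom C x' y'"
     "s \<in> S" "s' \<in> S" "t \<in> S" "t' \<in> S"
     "s \<in> hom C u x" "s' \<in> hom C y v" "t \<in> hom C u x'" "t' \<in> hom C y' v"
     "Comp C s' (Comp C a s) = Comp C t' (Comp C b t)"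
    using assms(1) unfolding apx_def by blast
  obtain X Y X' Y' z w p p' q q' where 2: "b \<in> hom C X Y" "c \<in> hom C X' Y'"
     "p \<in> S" "p' \<in> S" "q \<in> S" "q' \<in> S"
     "p \<in> hom C z X" "p' \<in> hom C Y w" "q \<in> hom C z X'" "q' \<in> hom C Y' w"
     "Comp C p' (Comp C b p) = Comp C q' (Comp C c q)"
    using assms(2) unfolding apx_def by blast
  have XY: "X = x'" "Y = y'" using 1 2 by (auto simp: hom_def)
  obtain d \<alpha> \<beta> where ab: "\<alpha> \<in> S" "\<beta> \<in> S" "\<alpha> \<in> hom C d u" "\<beta> \<in> hom C d z" "Comp C t \<alpha> = Comp C p \<beta>"
    using S_square_dual[OF 1(5) 2(3) 1(9) 2(7)[unfolded XY]] by metis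
  obtain e \<alpha>' \<beta>' where ab': "\<alpha>' \<in> S" "\<beta>' \<in> S" "\<alpha>' \<in> hom C v e" "\<beta>' \<in> hom C w e" "Comp C \<alpha>' t' = Comp C \<beta>' p'"
    using S_square[OF 1(6) 2(4) 1(10) 2(8)[unfolded XY]] by metis
  have "Comp C (Comp C \<alpha>' s') (Comp C a (Comp C s \<alpha>)) = Comp C \<alpha>' (Comp C (Comp C s' (Comp C a s)) \<alpha>)"
    using 1(1-10) 2(1-10) ab(1-4) ab'(1-4) by (simp add: arr_simps)
  also have "\<dots> = Comp C (Comp C \<alpha>' t') (Comp C b (Comp C t \<alpha>))"
    unfolding 1(11) using 1(1-10) 2(1-10) ab(1-4) ab'(1-4) by (simp add: arr_simps)
  also have "\<dots> = Comp C \<beta>' (Comp C (Comp C p' (Comp C b p)) \<beta>)"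
    unfolding ab(5) ab'(5) using 1(1-10) 2(1-10) ab(1-4) ab'(1-4) XY by (simp add: arr_simps)
  also have "\<dots> = Comp C (Comp C \<beta>' q') (Comp C c (Comp C q \<beta>))"
    unfolding 2(11) using 1(1-10) 2(1-10) ab(1-4) ab'(1-4) XY by (simp add: arr_simps)
  finally have eq: "Comp C (Comp C \<alpha>' s') (Comp C a (Comp C s \<alpha>)) =
      Comp C (Comp C \<beta>' q') (Comp C c (Comp C q \<beta>))" .
  show ?thesis
    using S_comp_hom[OF ab(1) 1(3) ab(3) 1(7)] S_comp_hom[OF 1(4) ab'(1) 1(8) ab'(3)]
      S_comp_hom[OF ab(2) 2(5) ab(4) 2(9)] S_comp_hom[OF 2(6) ab'(2) 2(10) ab'(4)]
    by (intro apxI[OF 1(1) 2(2) _ _ _ _ _ _ _ _ eq]) auto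
qed

text \<open>For parallel arrows thinness makes the two extensions coincide, and they can be
  cancelled. Faithfulness of the localization reduces to this.\<close>

lemma apx_parallel:
  assumes "apx a b" "a \<in> hom C x y" "b \<in> hom C x y"
  shows "a = b"
proof -
  obtain u v s s' t t' where 1: "s \<in> S" "s' \<in> S" "t \<in> S" "t' \<in> S"
     "s \<in> hom C u x" "s' \<in> hom C y v" "t \<in> hom C u x" "t' \<in> hom C y v"
     "Comp C s' (Comp C a s) = Comp C t' (Comp C b t)"
    using assms unfolding apx_def by (metis homD)
  have "s = t" "s' = t'" using S_thin 1 by blast+
  then have "Comp C a s = Comp C b s"
    using cancel_left[OF comp_hom[OF 1(5) assms(2)] comp_hom[OF 1(5) assms(3)] 1(6)] 1(9) by simp
  then show ?thesis using cancel_right[OF 1(5) assms(2,3)] by simp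
qed

text \<open>A span in \<open>S\<close> joins the old end \<open>y\<close> to the prescribed end
  \<open>z\<close>; pulling \<open>a\<close> back along its leg to \<open>y\<close> moves the start,
  but only inside its pixel.\<close>

lemma apx_end:
  assumes "a \<in> hom C x y" "A \<in> P" "y \<in> A" "z \<in> A"
  obtains x' a' where "a' \<in> hom C x' z" "apx a a'" "blk x' = blk x"
proof -
  obtain w s t where st: "s \<in> S" "t \<in> S" "s \<in> hom C w y" "t \<in> hom C w z"
    using span[OF assms(2-4)] by blast
  obtain v s' a' where a: "s' \<in> S" "s' \<in> hom C v x" "a' \<in> hom C v w" "Comp C a s' = Comp C s a'"
    using ore_dual[OF assms(1) st(1,3)] by blast
  have "apx a (Comp C a s')" using apx_pre assms a by blast
  moreover have "apx a' (Comp C s a')" "apx a' (Comp C t a')" using apx_post a st by blast+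
  ultimately have "apx a (Comp C t a')" using apx_trans apx_sym a(4) by metis
  then show ?thesis using that[of "Comp C t a'" v] comp_hom a st S_blk by metis
qed

text \<open>The witnesses of \<open>apx a a'\<close> extend both arrows to one and the same arrow
  \<open>?e\<close>. It then suffices to replace \<open>b\<close> and \<open>b'\<close> by arrows
  that start at the end of \<open>?e\<close>, and to show that these become equal after composition
  with \<open>S\<close>.\<close>

lemma apx_comp:
  assumes "apx a a'" "apx b b'" "a \<in> hom C x y" "b \<in> hom C y z" "a' \<in> hom C x' y'" "b' \<in> hom C y' z'"
  shows "apx (Comp C b a) (Comp C b' a')"
proof -
  obtain u v s s' t t' where 1: "s \<in> S" "s' \<in> S" "t \<in> S" "t' \<in> S"
     "s \<in> hom C u x" "s' \<in> hom C y v" "t \<in> hom C u x'" "t' \<in> hom C y' v"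
     "Comp C s' (Comp C a s) = Comp C t' (Comp C a' t)"
    using assms unfolding apx_def by (metis homD)
  let ?e = "Comp C s' (Comp C a s)"
  have e: "?e \<in> hom C u v" using 1 assms comp_hom by metis
  \<comment> \<open>The Ore condition pushes \<open>b\<close> along \<open>s'\<close>, and below
    \<open>b'\<close> along \<open>t'\<close>, so that \<open>c\<close> and \<open>c'\<close> have
    the common source \<open>v\<close>.\<close>
  obtain w p c where pc: "p \<in> S" "p \<in> hom C z w" "c \<in> hom C v w" "Comp C p b = Comp C c s'"
    using ore[OF assms(4) 1(2,6)] by blast
  obtain w' p' c' where pc': "p' \<in> S" "p' \<in> hom C z' w'" "c' \<in> hom C v w'" "Comp C p' b' = Comp C c' t'"
    using ore[OF assms(6) 1(4,8)] by blast
  have "apx c b" "apx c' b'"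
    using apx_trans[OF apx_pre[OF pc(3) 1(2,6)] apx_sym[OF apx_post[OF assms(4) pc(1,2), unfolded pc(4)]]]
      apx_trans[OF apx_pre[OF pc'(3) 1(4,8)] apx_sym[OF apx_post[OF assms(6) pc'(1,2), unfolded pc'(4)]]]
    by auto
  then have "apx c c'" using assms(2) apx_trans apx_sym by blast
  then obtain m k q q' r r' where 2: "q \<in> S" "q' \<in> S" "r \<in> S" "r' \<in> S"
     "q \<in> hom C m v" "q' \<in> hom C w k" "r \<in> hom C m v" "r' \<in> hom C w' k"
     "Comp C q' (Comp C c q) = Comp C r' (Comp C c' r)"
    using pc pc' unfolding apx_def by (metis homD)
  \<comment> \<open>Since \<open>c\<close> and \<open>c'\<close> share their source, the arrows of
    \<open>S\<close> in front of them are parallel, hence equal by thinness, and cancel from the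
    right.\<close>
  have "q = r" using S_thin 2 by blast
  moreover have "Comp C (Comp C q' c) q = Comp C q' (Comp C c q)" "Comp C (Comp C r' c') r = Comp C r' (Comp C c' r)"
    using 2 pc pc' by (simp_all add: arr_simps)
  ultimately have c: "Comp C q' c = Comp C r' c'"
    using cancel_right[OF 2(5) comp_hom[OF pc(3) 2(6)] comp_hom[OF pc'(3) 2(8)]] 2(9) by simp
  have "apx (Comp C b a) (Comp C p (Comp C (Comp C b a) s))"
    using apx_trans[OF apx_pre[OF comp_hom[OF assms(3,4)] 1(1,5)]
      apx_post[OF comp_hom[OF 1(5) comp_hom[OF assms(3,4)]] pc(1,2)]] .
  also have "Comp C p (Comp C (Comp C b a) s) = Comp C (Comp C p b) (Comp C a s)"
    using 1(1-8) pc(1-3) assms by (simp add: arr_simps)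
  also have "\<dots> = Comp C c ?e"
    unfolding pc(4) using 1(1-8) pc(1-3) assms by (simp add: arr_simps)
  finally have l: "apx (Comp C b a) (Comp C c ?e)" .
  have "apx (Comp C b' a') (Comp C p' (Comp C (Comp C b' a') t))"
    using apx_trans[OF apx_pre[OF comp_hom[OF assms(5,6)] 1(3,7)]
      apx_post[OF comp_hom[OF 1(7) comp_hom[OF assms(5,6)]] pc'(1,2)]] .
  also have "Comp C p' (Comp C (Comp C b' a') t) = Comp C (Comp C p' b') (Comp C a' t)"
    using 1(1-8) pc'(1-3) assms by (simp add: arr_simps)
  also have "\<dots> = Comp C c' ?e"
    unfolding pc'(4) 1(9) using 1(1-8) pc'(1-3) assms by (simp add: arr_simps)
  finally have r: "apx (Comp C b' a') (Comp C c' ?e)" .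
  have "Comp C q' (Comp C c ?e) = Comp C r' (Comp C c' ?e)"
    using c assoc_hom[OF e pc(3) 2(6)] assoc_hom[OF e pc'(3) 2(8)] by simp
  moreover have "apx (Comp C c ?e) (Comp C q' (Comp C c ?e))" "apx (Comp C c' ?e) (Comp C r' (Comp C c' ?e))"
    using apx_post[OF comp_hom[OF e pc(3)] 2(2,6)] apx_post[OF comp_hom[OF e pc'(3)] 2(4,8)] by auto
  ultimately show ?thesis using l r apx_trans apx_sym by metis
qed

section \<open>The localization modelled on pixels, and faithfulness\<close>

definition cls :: "'m \<Rightarrow> 'm set" where
  "cls a = {b. apx a b}"

lemma cls_eqI: "apx a b \<Longrightarrow> cls a = cls b"
  unfolding cls_def using apx_trans apx_sym by blast

lemma cls_eq_iff: "a \<in> Arr C \<Longrightarrow> cls a = cls b \<longleftrightarrow> apx a b"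
  using cls_eqI apx_refl apx_sym unfolding cls_def by blast

text \<open>A model of the localization in which the pixels are the objects.\<close>

definition dcat :: "('o set, 'm set) category" where
  "dcat = \<lparr>Obj = P, Arr = cls ` Arr C,
     Dom = (\<lambda>c. blk (Dom C (SOME a. a \<in> c))), Cod = (\<lambda>c. blk (Cod C (SOME a. a \<in> c))),
     Ident = (\<lambda>A. cls (Ident C (SOME x. x \<in> A))),
     Comp = (\<lambda>d c. {e. \<exists>a\<in>c. \<exists>b\<in>d. Cod C a = Dom C b \<and> apx (Comp C b a) e})\<rparr>"

lemma dcat_hom: 
  assumes "a \<in> hom C x y" shows "cls a \<in> hom dcat (blk x) (blk y)"
proof -
  have "apx a (SOME b. b \<in> cls a)"
    using apx_refl[of a] assms unfolding cls_def hom_def by (metis (mono_tags, lifting) mem_Collect_eq someI)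
  then show ?thesis
    using apx_blk assms by (auto simp: hom_def dcat_def)
qed

lemma dcat_arr:
  assumes "c \<in> hom dcat X Y"
  obtains a x y where "a \<in> hom C x y" "c = cls a" "blk x = X" "blk y = Y" "x \<in> X" "y \<in> Y" "X \<in> P" "Y \<in> P"
proof -
  obtain a where a: "a \<in> Arr C" "c = cls a" using assms by (auto simp: hom_def dcat_def)
  then have "blk (Dom C a) = X" "blk (Cod C a) = Y"
    using assms dcat_hom[OF arr_hom, of a] by (auto simp: hom_def)
  then show ?thesis using that[OF arr_hom a(2)] a blk_mem dom_obj cod_obj by metis
qed

lemma dcat_comp:
  assumes "a \<in> hom C x y" "b \<in> hom C y z"
  shows "Comp dcat (cls b) (cls a) = cls (Comp C b a)"
proof -
  have ab: "Comp dcat (cls b) (cls a) =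
    {e. \<exists>a'. apx a a' \<and> (\<exists>b'. apx b b' \<and> Cod C a' = Dom C b' \<and> apx (Comp C b' a') e)}"
    by (auto simp: dcat_def cls_def)
  have "apx (Comp C b a) (Comp C b' a')" if "apx a a'" "apx b b'" "Cod C a' = Dom C b'" for a' b'
    using apx_comp[OF that(1,2) assms] apx_blk[OF that(1)] apx_blk[OF that(2)] that(3)
      arr_hom[of a' C] arr_hom[of b' C] by auto
  moreover have "apx a a" "apx b b" "Cod C a = Dom C b" using assms apx_refl by (auto simp: hom_def)
  ultimately show ?thesis unfolding ab unfolding cls_def using apx_trans apx_sym by blast
qed

lemma cls_S:
  assumes "s \<in> S" "s \<in> hom C x y"
  shows "cls s = cls (Ident C x)" "cls s = cls (Ident C y)"
  using apx_post[OF ident_hom assms] apx_pre[OF ident_hom assms] comp_ident_hom[OF assms(2)]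
    hom_obj[OF assms(2)] cls_eqI by auto

lemma dcat_ident:
  assumes "A \<in> P" "x \<in> A"
  shows "Ident dcat A = cls (Ident C x)"
proof -
  have "(SOME x. x \<in> A) \<in> A" using assms by (auto intro: someI)
  then obtain w s t where "s \<in> S" "t \<in> S" "s \<in> hom C w x" "t \<in> hom C w (SOME x. x \<in> A)"
    using span assms by blast
  then show ?thesis using cls_S by (simp add: dcat_def)
qed

text \<open>Composability in \<open>dcat\<close> is mere equality of pixels. The first arrow is
  moved by \<open>apx_end\<close> so that the composite exists in \<open>C\<close> itself; this
  yields associativity from that of \<open>C\<close>.\<close>

lemma dcat_comp_lift:
  assumes "c \<in> hom dcat X Y" "b \<in> hom C y z" "blk y = Y"
  obtains a x where "a \<in> hom C x y" "c = cls a" "blk x = X"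
proof -
  obtain a x y' where a: "a \<in> hom C x y'" "c = cls a" "blk x = X" "blk y' = Y" "y' \<in> Y" "Y \<in> P"
    using dcat_arr[OF assms(1)] by metis
  have "y \<in> Y" using assms blk_mem hom_obj by blast
  then obtain x' a' where "a' \<in> hom C x' y" "apx a a'" "blk x' = blk x"
    using apx_end[OF a(1) a(6) a(5)] by metis
  then show ?thesis using that[of a' x'] a cls_eqI by simp
qed

lemma dcat_category: "is_category dcat"
proof
  fix f assume "f \<in> Arr dcat"
  then obtain X Y where f: "f \<in> hom dcat X Y" by (auto simp: hom_def)
  obtain a x y where a: "a \<in> hom C x y" "f = cls a" "blk x = X" "blk y = Y" "x \<in> X" "y \<in> Y" "X \<in> P" "Y \<in> P"
    using dcat_arr[OF f] by metis
  have XY: "Dom dcat f = X" "Cod dcat f = Y" using f by (auto simp: hom_def)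
  show "Dom dcat f \<in> Obj dcat" "Cod dcat f \<in> Obj dcat" unfolding XY using a by (auto simp: dcat_def)
  have id: "Ident C x \<in> hom C x x" "Ident C y \<in> hom C y y"
    using ident_hom hom_obj[OF a(1)] by auto
  show "Comp dcat f (Ident dcat (Dom dcat f)) = f" "Comp dcat (Ident dcat (Cod dcat f)) f = f"
    using dcat_comp[OF id(1) a(1)] dcat_comp[OF a(1) id(2)] comp_ident_hom[OF a(1)] a(2)
      dcat_ident[OF a(7,5)] dcat_ident[OF a(8,6)] XY by auto
next
  fix A assume "A \<in> Obj dcat"
  then obtain x where x: "A \<in> P" "x \<in> A" using block_nonempty by (auto simp: dcat_def)
  show "Ident dcat A \<in> Arr dcat \<and> Dom dcat (Ident dcat A) = A \<and> Cod dcat (Ident dcat A) = A"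
    using dcat_hom[OF ident_hom] block_obj[OF x] blk_eq[OF x] dcat_ident[OF x] by (auto simp: hom_def)
next
  fix f g assume "f \<in> Arr dcat" "g \<in> Arr dcat" "Cod dcat f = Dom dcat g"
  then obtain X Y Z where f: "f \<in> hom dcat X Y" and g: "g \<in> hom dcat Y Z" by (auto simp: hom_def)
  obtain b y z where b: "b \<in> hom C y z" "g = cls b" "blk y = Y" "blk z = Z" using dcat_arr[OF g] by metis
  obtain a x where a: "a \<in> hom C x y" "f = cls a" "blk x = X" using dcat_comp_lift[OF f b(1,3)] by metis
  show "Comp dcat g f \<in> Arr dcat \<and> Dom dcat (Comp dcat g f) = Dom dcat f \<and> Cod dcat (Comp dcat g f) = Cod dcat g"
    using dcat_hom[OF comp_hom[OF a(1) b(1)]] f g unfolding a(2) b(2) dcat_comp[OF a(1) b(1)]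
    by (simp add: hom_def a b)
next
  fix f g h assume "f \<in> Arr dcat" "g \<in> Arr dcat" "h \<in> Arr dcat" "Cod dcat f = Dom dcat g" "Cod dcat g = Dom dcat h"
  then obtain X Y Z W where f: "f \<in> hom dcat X Y" and g: "g \<in> hom dcat Y Z" and h: "h \<in> hom dcat Z W"
    by (auto simp: hom_def)
  obtain c z w where c: "c \<in> hom C z w" "h = cls c" "blk z = Z" using dcat_arr[OF h] by metis
  obtain b y where b: "b \<in> hom C y z" "g = cls b" "blk y = Y" using dcat_comp_lift[OF g c(1,3)] by metis
  obtain a x where a: "a \<in> hom C x y" "f = cls a" using dcat_comp_lift[OF f b(1,3)] by metis
  show "Comp dcat h (Comp dcat g f) = Comp dcat (Comp dcat h g) f"
    by (simp only: a(2) b(2) c(2) dcat_comp[OF a(1) b(1)] dcat_comp[OF b(1) c(1)]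
      dcat_comp[OF comp_hom[OF a(1) b(1)] c(1)] dcat_comp[OF a(1) comp_hom[OF b(1) c(1)]]
      assoc_hom[OF a(1) b(1) c(1)])
qed

text \<open>In \<open>dcat\<close> the elements of \<open>S\<close> are identities, so identities
  serve as their inverses \<open>?J\<close> and \<open>localization_functor_inj\<close>
  applies.\<close>

lemma loc_functor_faithful:
  assumes "f \<in> hom C x y" "g \<in> hom C x y" "FArr (loc_functor C S) f = FArr (loc_functor C S) g"
  shows "f = g"
proof -
  let ?Q = "\<lparr>FObj = blk, FArr = cls\<rparr>" and ?J = "\<lambda>s. Ident dcat (blk (Dom C s))"
  interpret D: is_category dcat by (rule dcat_category)
  have Q: "is_functor C dcat ?Q"
  proof (rule is_functorI[OF is_category_axioms dcat_category])
    fix x assume x: "x \<in> Obj C"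
    show "FObj ?Q x \<in> Obj dcat" "FArr ?Q (Ident C x) = Ident dcat (FObj ?Q x)"
      using blk_mem[OF x] dcat_ident[of "blk x" x] by (auto simp: dcat_def)
  qed (use dcat_hom dcat_comp in auto)
  have J: "cls s = ?J s" "blk (Dom C s) = blk (Cod C s)" "?J s \<in> hom dcat (blk (Dom C s)) (blk (Dom C s))"
    if "s \<in> S" for s
  proof -
    have s: "s \<in> hom C (Dom C s) (Cod C s)" using that S_arr by (auto simp: hom_def)
    show "cls s = ?J s" "blk (Dom C s) = blk (Cod C s)" "?J s \<in> hom dcat (blk (Dom C s)) (blk (Dom C s))"
      using cls_S[OF that s] dcat_ident[of "blk (Dom C s)" "Dom C s"] blk_mem hom_obj[OF s]
        S_blk[OF that s] D.ident_hom by (auto simp: dcat_def)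
  qed
  have "FArr ?Q f = FArr ?Q g"
  proof (rule localization_functor_inj[OF Q _ _ _ assms, of ?J])
    fix s assume "s \<in> S"
    note J = J[OF this]
    show "?J s \<in> hom dcat (FObj ?Q (Cod C s)) (FObj ?Q (Dom C s))"
      using J(3) by (simp add: J(2))
    show "Comp dcat (?J s) (FArr ?Q s) = Ident dcat (FObj ?Q (Dom C s))"
      using D.comp_ident_hom(1)[OF J(3)] by (simp only: J(1) cfunctor.simps)
    show "Comp dcat (FArr ?Q s) (?J s) = Ident dcat (FObj ?Q (Cod C s))"
      using D.comp_ident_hom(1)[OF J(3)] by (simp only: J(1) J(2)[symmetric] cfunctor.simps)
  qed
  then show ?thesis using apx_parallel assms cls_eq_iff by (auto simp: hom_def)
qed

end

section \<open>Functors to categories of pixels\<close>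

text \<open>Separated from \<open>pixel_functor\<close> because moving endpoints, as in
  \<open>F_end\<close>, is already possible for any functor that collapses \<open>S\<close>, and is
  itself used to prove the surjectivity demanded there.\<close>

locale pixel_quotient = pixel_category C S P
  for C :: "('o, 'm) category" and S :: "'m set" and P :: "'o set set" +
  fixes D :: "('o set, 'n) category" and F :: "('o, 'm, 'o set, 'n) cfunctor"
  assumes F_functor: "is_functor C D F"
    and obj_D: "Obj D = P"
    and F_obj: "\<lbrakk>A \<in> P; x \<in> A\<rbrakk> \<Longrightarrow> FObj F x = A"
    and F_S: "\<lbrakk>A \<in> P; x \<in> A; s \<in> S; s \<in> hom C x y\<rbrakk> \<Longrightarrow> FArr F s = Ident D A"
begin

sublocale D: is_category D using F_functor by (simp add: is_functor_def)

lemma F_hom: "\<lbrakk>f \<in> hom C x y; X \<in> P; x \<in> X; Y \<in> P; y \<in> Y\<rbrakk> \<Longrightarrow> FArr F f \<in> hom D X Y"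
  using functor_hom[OF F_functor, of f x y] F_obj by simp

lemma F_hom_blk: "f \<in> hom C x y \<Longrightarrow> FArr F f \<in> hom D (blk x) (blk y)"
  using F_hom blk_mem hom_obj by blast

lemma F_pre:
  assumes "f \<in> hom C x y" "s \<in> S" "s \<in> hom C w x"
  shows "FArr F (Comp C f s) = FArr F f"
proof -
  have "FArr F s = Ident D (blk x)"
    using F_S[OF _ _ assms(2,3), of "blk w"] S_blk[OF assms(2,3)] blk_mem[of w] hom_obj[OF assms(3)] by simp
  then show ?thesis
    using functor_comp[OF F_functor assms(3,1)] D.comp_ident_hom(1)[OF F_hom_blk[OF assms(1)]] by simp
qed

lemma F_post:
  assumes "f \<in> hom C x y" "s \<in> S" "s \<in> hom C y w"
  shows "FArr F (Comp C s f) = FArr F f"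
proof -
  have "FArr F s = Ident D (blk y)"
    using F_S[OF _ _ assms(2,3), of "blk y"] blk_mem[of y] hom_obj[OF assms(3)] by simp
  then show ?thesis
    using functor_comp[OF F_functor assms(1,3)] D.comp_ident_hom(2)[OF F_hom_blk[OF assms(1)]] by simp
qed

lemma F_apx:
  assumes "apx a b"
  shows "FArr F a = FArr F b"
proof -
  obtain x y x' y' u v s s' t t' where 1: "a \<in> hom C x y" "b \<in> hom C x' y'"
     "s \<in> S" "s' \<in> S" "t \<in> S" "t' \<in> S"
     "s \<in> hom C u x" "s' \<in> hom C y v" "t \<in> hom C u x'" "t' \<in> hom C y' v"
     "Comp C s' (Comp C a s) = Comp C t' (Comp C b t)"
    using assms unfolding apx_def by blast
  have "FArr F a = FArr F (Comp C s' (Comp C a s))"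
    using F_pre[OF 1(1,3,7)] F_post[OF comp_hom[OF 1(7,1)] 1(4,8)] by simp
  also have "\<dots> = FArr F b"
    unfolding 1(11) using F_pre[OF 1(2,5,9)] F_post[OF comp_hom[OF 1(9,2)] 1(6,10)] by simp
  finally show ?thesis .
qed

lemma F_end:
  assumes "f \<in> hom C x y" "X \<in> P" "x \<in> X" "Y \<in> P" "y \<in> Y" "z \<in> Y"
  obtains x' f' where "x' \<in> X" "f' \<in> hom C x' z" "FArr F f' = FArr F f"
proof -
  obtain x' a' where a: "a' \<in> hom C x' z" "apx f a'" "blk x' = blk x"
    using apx_end[OF assms(1,4,5,6)] by blast
  then have "x' \<in> X" using blk_mem[of x'] blk_eq[OF assms(2,3)] hom_obj by auto
  then show ?thesis using that a F_apx by metis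
qed

lemma F_start:
  assumes "f \<in> hom C x y" "X \<in> P" "x \<in> X" "Y \<in> P" "y \<in> Y" "z \<in> X"
  obtains y' f' where "y' \<in> Y" "f' \<in> hom C z y'" "FArr F f' = FArr F f"
proof -
  obtain w s t where st: "s \<in> S" "t \<in> S" "s \<in> hom C x w" "t \<in> hom C z w"
    using cospan[OF assms(2,3,6)] by blast
  obtain v s' f' where f: "s' \<in> S" "s' \<in> hom C y v" "f' \<in> hom C w v" "Comp C s' f = Comp C f' s"
    using ore[OF assms(1) st(1,3)] by blast
  have "FArr F (Comp C f' t) = FArr F f"
    using F_pre[OF f(3) st(2,4)] F_pre[OF f(3) st(1,3)] F_post[OF assms(1) f(1,2)] f(4) by simp
  moreover have "v \<in> Y" using S_hom_block[OF f(1,2) assms(4)] assms(5) by simp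
  ultimately show ?thesis using that comp_hom[OF st(4) f(3)] by blast
qed

end

locale pixel_functor = pixel_quotient C S P D F
  for C :: "('o, 'm) category" and S :: "'m set" and P :: "'o set set"
    and D :: "('o set, 'n) category" and F :: "('o, 'm, 'o set, 'n) cfunctor" +
  assumes F_faithful: "\<lbrakk>f \<in> hom C x y; g \<in> hom C x y; FArr F f = FArr F g\<rbrakk> \<Longrightarrow> f = g"
    and F_surj: "d \<in> Arr D \<Longrightarrow> \<exists>f\<in>Arr C. FArr F f = d"
begin

lemma lift:
  assumes "d \<in> hom D X Y"
  obtains f x y where "f \<in> hom C x y" "X \<in> P" "x \<in> X" "Y \<in> P" "y \<in> Y" "FArr F f = d"
proof -
  obtain f where f: "f \<in> Arr C" "FArr F f = d" using F_surj assms by (auto simp: hom_def)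
  have "blk (Dom C f) = X" "blk (Cod C f) = Y"
    using F_hom_blk[OF arr_hom[OF f(1)]] f(2) assms by (auto simp: hom_def)
  then show ?thesis using that[OF arr_hom[OF f(1)]] f blk_mem dom_obj cod_obj by metis
qed

lemma lift_end:
  assumes "d \<in> hom D X Y" "y \<in> Y"
  obtains f x where "f \<in> hom C x y" "X \<in> P" "x \<in> X" "Y \<in> P" "FArr F f = d"
  using assms lift F_end by metis

lemma lift_start:
  assumes "d \<in> hom D X Y" "x \<in> X"
  obtains f y where "f \<in> hom C x y" "X \<in> P" "y \<in> Y" "Y \<in> P" "FArr F f = d"
  using assms lift F_start by metis

text \<open>Choose a span in \<open>S\<close> over the ends of \<open>f\<close>. Composing
  \<open>f\<close> with one leg gives an arrow parallel to the other leg, and both have identity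
  images; by faithfulness they are equal, so \<open>f\<close> is a factor of an element of
  \<open>S\<close>.\<close>

lemma S_reflect:
  assumes f: "f \<in> hom C x y" and id: "FArr F f = Ident D A" and A: "A \<in> P"
  shows "f \<in> S"
proof -
  have "FArr F f \<in> hom D A A" using D.ident_hom A obj_D id by simp
  then have "blk x = A" "blk y = A" using F_hom_blk[OF f] by (auto simp: hom_def)
  then have xy: "x \<in> A" "y \<in> A" using blk_mem hom_obj[OF f] by blast+
  then obtain w s t where st: "s \<in> S" "t \<in> S" "s \<in> hom C w x" "t \<in> hom C w y"
    using span[OF A] by blast
  have "w \<in> A" using S_hom_block[OF st(1,3) A] xy by simp
  then have "FArr F (Comp C f s) = FArr F t"
    using F_pre[OF f st(1,3)] id F_S[OF A _ st(2,4)] by simp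
  then have "Comp C f s \<in> S"
    using F_faithful[OF comp_hom[OF st(3) f] st(4)] st(2) by simp
  then show ?thesis using S_factor[OF st(3) f] by simp
qed

text \<open>The lifts can be made to meet at one point, and a span in \<open>S\<close> gives the two
  competing lifts a common source. Faithfulness then transports the equation to \<open>C\<close>,
  where it cancels. This is needed for axiom (f) of the triple of pixels.\<close>

lemma D_cancel_left:
  assumes "a \<in> hom D X Y" "a' \<in> hom D X Y" "b \<in> hom D Y Z" "Comp D b a = Comp D b a'"
  shows "a = a'"
proof -
  obtain g y z where g: "g \<in> hom C y z" "Y \<in> P" "y \<in> Y" "FArr F g = b"
    using lift[OF assms(3)] by metis
  obtain f x where f: "f \<in> hom C x y" "X \<in> P" "x \<in> X" "FArr F f = a"
    using lift_end[OF assms(1) g(3)] by metis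
  obtain f' x' where f': "f' \<in> hom C x' y" "x' \<in> X" "FArr F f' = a'"
    using lift_end[OF assms(2) g(3)] by metis
  obtain w s t where st: "s \<in> S" "t \<in> S" "s \<in> hom C w x" "t \<in> hom C w x'"
    using span[OF f(2,3) f'(2)] by blast
  have fs: "FArr F (Comp C f s) = a" "FArr F (Comp C f' t) = a'"
    using F_pre[OF f(1) st(1,3)] F_pre[OF f'(1) st(2,4)] f f' by auto
  have h: "Comp C f s \<in> hom C w y" "Comp C f' t \<in> hom C w y" using comp_hom st f f' by blast+
  have "FArr F (Comp C g (Comp C f s)) = FArr F (Comp C g (Comp C f' t))"
    using functor_comp[OF F_functor h(1) g(1)] functor_comp[OF F_functor h(2) g(1)] fs g assms(4) by simp
  then have "Comp C f s = Comp C f' t"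
    using F_faithful comp_hom[OF h(1) g(1)] comp_hom[OF h(2) g(1)] cancel_left[OF h g(1)] by blast
  then show ?thesis using fs by simp
qed

lemma D_cancel_right:
  assumes "a \<in> hom D X Y" "b \<in> hom D Y Z" "b' \<in> hom D Y Z" "Comp D b a = Comp D b' a"
  shows "b = b'"
proof -
  obtain g x y where g: "g \<in> hom C x y" "Y \<in> P" "y \<in> Y" "FArr F g = a"
    using lift[OF assms(1)] by metis
  obtain f z where f: "f \<in> hom C y z" "Z \<in> P" "z \<in> Z" "FArr F f = b"
    using lift_start[OF assms(2) g(3)] by metis
  obtain f' z' where f': "f' \<in> hom C y z'" "z' \<in> Z" "FArr F f' = b'"
    using lift_start[OF assms(3) g(3)] by metis
  obtain w s t where st: "s \<in> S" "t \<in> S" "s \<in> hom C z w" "t \<in> hom C z' w"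
    using cospan[OF f(2,3) f'(2)] by blast
  have fs: "FArr F (Comp C s f) = b" "FArr F (Comp C t f') = b'"
    using F_post[OF f(1) st(1,3)] F_post[OF f'(1) st(2,4)] f f' by auto
  have h: "Comp C s f \<in> hom C y w" "Comp C t f' \<in> hom C y w" using comp_hom st f f' by blast+
  have "FArr F (Comp C (Comp C s f) g) = FArr F (Comp C (Comp C t f') g)"
    using functor_comp[OF F_functor g(1) h(1)] functor_comp[OF F_functor g(1) h(2)] fs g assms(4) by simp
  then have "Comp C s f = Comp C t f'"
    using F_faithful comp_hom[OF g(1) h(1)] comp_hom[OF g(1) h(2)] cancel_right[OF g(1) h] by blast
  then show ?thesis using fs by simp
qed

text \<open>A composite with identity image lies in \<open>S\<close> by \<open>S_reflect\<close>,
  and \<open>S\<close> is closed under factors. This is what forces a path of pixels equivalent to a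
  constant one to be constant.\<close>

lemma D_factor_ident:
  assumes "a \<in> hom D X Y" "b \<in> hom D Y Z" "Comp D b a = Ident D X"
  shows "Y = X" "a = Ident D X" "b = Ident D X"
proof -
  obtain g y z where g: "g \<in> hom C y z" "Y \<in> P" "y \<in> Y" "FArr F g = b"
    using lift[OF assms(2)] by metis
  obtain f x where f: "f \<in> hom C x y" "X \<in> P" "x \<in> X" "FArr F f = a"
    using lift_end[OF assms(1) g(3)] by metis
  have "FArr F (Comp C g f) = Ident D X"
    using functor_comp[OF F_functor f(1) g(1)] f g assms by simp
  then have "Comp C g f \<in> S" using S_reflect comp_hom[OF f(1) g(1)] f(2) by blast
  then have S: "f \<in> S" "g \<in> S" using S_factor[OF f(1) g(1)] by auto
  have y: "y \<in> X" using S_hom_block[OF S(1) f(1,2)] f(3) by simp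
  then show "Y = X" "a = Ident D X" "b = Ident D X"
    using blk_eq[OF f(2)] blk_eq[OF g(2,3)] F_S[OF f(2,3) S(1) f(1)] F_S[OF f(2) _ S(2) g(1)] f(4) g(4)
    by auto
qed

end

section \<open>The localization followed by an equivalence\<close>

context pixel_category begin

text \<open>Faithfulness combines \<open>loc_functor_faithful\<close> with injectivity of
  \<open>H\<close> on hom-sets. For surjectivity, an arrow of \<open>D\<close> comes from a zigzag,
  which is replaced by a single arrow of \<open>C\<close> with the same image.\<close>

lemma pixel_functor_localization:
  fixes D :: "('o set, 'n) category"
  assumes H: "is_equivalence (localization C S) D H"
    and D: "Obj D = P"
    and H_obj: "\<And>A x. A \<in> P \<Longrightarrow> x \<in> A \<Longrightarrow> FObj H x = A"
    and H_S: "\<And>A s x y. \<lbrakk>A \<in> P; x \<in> A; s \<in> S; s \<in> hom C x y\<rbrakk> \<Longrightarrow>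
      FArr H (FArr (loc_functor C S) s) = Ident D A"
  shows "pixel_functor C S P D (comp_functor H (loc_functor C S))"
proof -
  let ?L = "localization C S" and ?p = "loc_functor C S"
  let ?F = "comp_functor H ?p"
  have Hf: "is_functor ?L D H" and Hbij: "\<And>x y. x \<in> Obj C \<Longrightarrow> y \<in> Obj C \<Longrightarrow>
      bij_betw (FArr H) (hom ?L x y) (hom D (FObj H x) (FObj H y))"
    using H by (auto simp: is_equivalence_def localization_def quot_cat_def)
  interpret L: is_category ?L using Hf by (simp add: is_functor_def)
  have p: "is_functor C ?L ?p" by (rule loc_functor_functor) unfold_locales
  have F_simps: "FObj ?F x = FObj H x" "FArr ?F f = FArr H (FArr ?p f)" for x f
    by (auto simp: comp_functor_def loc_functor_def)
  interpret pixel_quotient C S P D ?F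
    by unfold_locales (use functor_comp_functor[OF p Hf] D H_obj H_S in \<open>auto simp: F_simps\<close>)
  have p_hom: "FArr ?p f \<in> hom ?L x y" if "f \<in> hom C x y" for f x y
    using functor_hom[OF p that] by (simp add: loc_functor_def)
  show ?thesis
  proof
    fix f g x y assume fg: "f \<in> hom C x y" "g \<in> hom C x y" "FArr ?F f = FArr ?F g"
    then have "FArr ?p f = FArr ?p g"
      using bij_betw_imp_inj_on[OF Hbij] hom_obj[OF fg(1)] p_hom[OF fg(1)] p_hom[OF fg(2)]
      by (auto simp: F_simps dest: inj_onD)
    then show "f = g" using loc_functor_faithful fg by blast
  next
    fix d assume d: "d \<in> Arr D"
    let ?X = "Dom D d" and ?Y = "Cod D d"
    have XY: "?X \<in> P" "?Y \<in> P" using d D.dom_obj D.cod_obj D by auto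
    obtain x y where xy: "x \<in> ?X" "y \<in> ?Y" using XY block_nonempty by blast
    have obj: "x \<in> Obj C" "y \<in> Obj C" using block_obj xy XY by auto
    have "d \<in> hom D (FObj H x) (FObj H y)" using d H_obj xy XY by (auto simp: hom_def)
    then obtain m where m: "m \<in> hom ?L x y" "d = FArr H m"
      using bij_betw_imp_surj_on[OF Hbij[OF obj]] by blast
    obtain p where p: "walk x p y" "m = rel `` {(x, p, y)}"
      using arr_word[OF m(1)] by blast
    \<comment> \<open>The start is controlled only up to its pixel, because prepending a letter
      moves it.\<close>
    have "\<exists>x' f. x' \<in> blk x \<and> f \<in> hom C x' y \<and> FArr ?F f = FArr H (rel `` {(x, p, y)})"
      if "walk x p y" for x p
      using that
    proof (induction p arbitrary: x)
      case Nil
      then have "x = y" "y \<in> Obj C" by auto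
      moreover have "FObj ?p y = y" by (simp add: loc_functor_def)
      ultimately have "Ident C y \<in> hom C y y" "FArr ?F (Ident C y) = FArr H (Ident ?L y)"
        using ident_hom functor_ident[OF \<open>is_functor C ?L ?p\<close>, of y] by (auto simp: F_simps)
      then show ?case using blk_mem \<open>x = y\<close> \<open>y \<in> Obj C\<close> ident_word by metis
    next
      case (Cons e p)
      let ?z = "head zigzags e"
      have w: "walk ?z p y"
        "walk x [e] ?z"
        using Cons.prems walk_end by auto
      obtain z' f where f: "z' \<in> blk ?z" "f \<in> hom C z' y" "FArr ?F f = FArr H (rel `` {(?z, p, y)})"
        using Cons.IH[OF w(1)] by blast
      have zo: "?z \<in> Obj C" "x \<in> Obj C" using walk_end[OF w(1)] walk_end[OF w(2)] by auto
      have eq: "FArr H (rel `` {(x, e # p, y)}) = Comp D (FArr ?F f) (FArr H (rel `` {(x, [e], ?z)}))"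
        using word_comp[OF w(2,1)] functor_comp[OF Hf word_hom[OF w(2)] word_hom[OF w(1)]] f(3) by simp
      show ?case
      proof (cases e)
        case (Inl g)
        then have g: "g \<in> hom C x ?z" using Cons.prems by (auto simp: hom_def)
        obtain x' g' where g': "x' \<in> blk x" "g' \<in> hom C x' z'" "FArr ?F g' = FArr ?F g"
          using F_end[OF g _ _ _ _ f(1)] blk_mem zo by metis
        have "FArr ?F g = FArr H (rel `` {(x, [e], ?z)})"
          using g Inl by (simp add: F_simps) (simp add: loc_functor_def hom_def)
        then have "FArr ?F (Comp C f g') = FArr H (rel `` {(x, e # p, y)})"
          using functor_comp[OF F_functor g'(2) f(2)] g'(3) eq by simp
        then show ?thesis using g' comp_hom[OF g'(2) f(2)] by blast
      next
        case (Inr s)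
        then have s: "s \<in> S" "s \<in> hom C ?z x" using Cons.prems S_arr by (auto simp: hom_def)
        have blk: "blk ?z = blk x" using S_blk[OF s] .
        have l: "FArr ?p s = rel `` {(?z, [Inl s], x)}"
          using s by (simp add: loc_functor_def hom_def)
        have wl: "walk ?z [Inl s] x" using s zo by (auto simp: hom_def)
        have "((?z, [Inl s, Inr s], ?z), (?z, [], ?z)) \<in> rel"
          unfolding localization_cong_def
          by (rule congruence_closure.base) (use s Inr in \<open>auto simp: localization_relations_def\<close>)
        then have "Comp ?L (rel `` {(x, [e], ?z)}) (FArr ?p s) = Ident ?L ?z"
          unfolding l ident_word using word_comp[OF wl w(2)] word_eq Inr by simp
        then have "Comp D (FArr H (rel `` {(x, [e], ?z)})) (FArr ?F s) = Ident D (blk x)"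
          using functor_comp[OF Hf p_hom[OF s(2)] word_hom[OF w(2)]] functor_ident[OF Hf, of ?z]
            H_obj[of "blk x" ?z] blk_mem[of ?z] zo blk by (simp add: F_simps localization_def quot_cat_def)
        moreover have "FArr ?F s = Ident D (blk x)"
          using F_S[of "blk x" ?z s x] s blk_mem[of ?z] blk zo by auto
        moreover have "FArr H (rel `` {(x, [e], ?z)}) \<in> hom D (blk x) (blk x)"
          using functor_hom[OF Hf word_hom[OF w(2)]] H_obj[of "blk x" x] H_obj[of "blk x" ?z]
            blk_mem[of x] blk_mem[of ?z] zo blk by simp
        ultimately have "FArr H (rel `` {(x, [e], ?z)}) = Ident D (blk x)"
          using D.comp_ident_hom(1) by metis
        moreover have "FArr ?F f \<in> hom D (blk x) (blk y)"
          using F_hom[OF f(2) _ f(1)] blk_mem[OF obj(2)] blk_mem[OF zo(1)] blk by auto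
        ultimately have "FArr H (rel `` {(x, e # p, y)}) = FArr ?F f"
          using eq D.comp_ident_hom(1) by metis
        then show ?thesis using f blk by auto
      qed
    qed
    then obtain f x' where "f \<in> hom C x' y" "FArr ?F f = d" using p m by metis
    then show "\<exists>f\<in>Arr C. FArr ?F f = d" by (auto simp: hom_def)
  qed
qed

end

section \<open>The path category of a triple\<close>

lemma reparametrizationI:
  assumes "continuous_on {0..1} \<phi>" "mono_on {0..1} \<phi>" "0 \<le> \<phi> 0" "\<phi> 1 \<le> 1"
  shows "reparametrization \<phi>"
proof -
  have "\<phi> t \<in> {0..1}" if "t \<in> {0..1}" for t
    using mono_onD[OF assms(2), of 0 t] mono_onD[OF assms(2), of t 1] assms(3,4) that by auto
  moreover have "is_interval (\<phi> ` I)" if "I \<subseteq> {0..1}" "is_interval I" for I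
    using connected_continuous_image continuous_on_subset[OF assms(1) that(1)] that(2)
    by (auto simp: is_interval_connected_1)
  ultimately show ?thesis using assms(2) by (auto simp: reparametrization_def)
qed

lemma concat_ends [simp]: "(\<gamma> \<cdot> \<gamma>') 0 = \<gamma> 0" "(\<gamma> \<cdot> \<gamma>') 1 = \<gamma>' 1"
  by (auto simp: concat_path_def)

lemma const_ends [simp]: "const_path x 0 = x" "const_path x 1 = x"
  by (auto simp: const_path_def)

lemma ends_in_im: "\<gamma> 0 \<in> im \<gamma>" "\<gamma> 1 \<in> im \<gamma>"
  by (auto simp: im_def)

lemma im_const [simp]: "im (const_path x) = {x}"
  by (auto simp: im_def const_path_def image_constant_conv)

lemma im_concat: 
  assumes "\<gamma> 1 = \<gamma>' 0" shows "im (\<gamma> \<cdot> \<gamma>') = im \<gamma> \<union> im \<gamma>'"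
proof (intro equalityI subsetI)
  fix x assume "x \<in> im (\<gamma> \<cdot> \<gamma>')"
  then obtain t where "t \<in> {0..1}" "x = (\<gamma> \<cdot> \<gamma>') t" by (auto simp: im_def)
  then show "x \<in> im \<gamma> \<union> im \<gamma>'"
    by (cases "t \<le> 1/2") (auto simp: im_def concat_path_def)
next
  fix x assume "x \<in> im \<gamma> \<union> im \<gamma>'"
  then consider t where "t \<in> {0..1}" "x = \<gamma> t" | t where "t \<in> {0..1}" "x = \<gamma>' t" by (auto simp: im_def)
  then show "x \<in> im (\<gamma> \<cdot> \<gamma>')"
  proof cases
    case 1
    then have "x = (\<gamma> \<cdot> \<gamma>') (t/2)" "t/2 \<in> {0..1}" by (auto simp: concat_path_def)
    then show ?thesis by (auto simp: im_def)
  next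
    case 2
    moreover have "2 * ((t + 1) / 2) - 1 = t" by (simp add: field_simps)
    ultimately have "x = (\<gamma> \<cdot> \<gamma>') ((t+1)/2)" "(t+1)/2 \<in> {0..1}"
      using assms by (auto simp: concat_path_def simp del: distrib_left_numeral)
    then show ?thesis by (auto simp: im_def)
  qed
qed

context triple begin

lemma path_ext: "\<gamma> \<in> Paths T \<Longrightarrow> t \<notin> {0..1} \<Longrightarrow> \<gamma> t = undefined"
  using paths by (auto simp: all_paths_def PiE_def extensional_def)

lemma path_im: "\<gamma> \<in> Paths T \<Longrightarrow> im \<gamma> \<subseteq> Points T"
  using paths by (auto simp: all_paths_def im_def)

lemma path_ends: "\<gamma> \<in> Paths T \<Longrightarrow> \<gamma> 0 \<in> Points T \<and> \<gamma> 1 \<in> Points T"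
  using path_im ends_in_im by blast

lemma equiv_paths: "(\<gamma>, \<gamma>') \<in> Equiv T \<Longrightarrow> \<gamma> \<in> Paths T \<and> \<gamma>' \<in> Paths T"
  using equiv equiv_type by blast

lemma equiv_refl: "\<gamma> \<in> Paths T \<Longrightarrow> (\<gamma>, \<gamma>) \<in> Equiv T"
  using equiv by (auto simp: equiv_def refl_on_def)

lemma equiv_sym: "(\<gamma>, \<gamma>') \<in> Equiv T \<Longrightarrow> (\<gamma>', \<gamma>) \<in> Equiv T"
  using equiv by (auto simp: equiv_def sym_def)

lemma equiv_trans: "(\<gamma>, \<gamma>') \<in> Equiv T \<Longrightarrow> (\<gamma>', \<gamma>'') \<in> Equiv T \<Longrightarrow> (\<gamma>, \<gamma>'') \<in> Equiv T"
  using equiv by (auto simp: equiv_def dest: transD)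

lemma concat_const_right:
  assumes "\<gamma> \<in> Paths T" shows "(\<gamma>, \<gamma> \<cdot> const_path (\<gamma> 1)) \<in> Equiv T"
proof -
  let ?\<phi> = "\<lambda>t::real. min (2 * t) 1"
  have "reparametrization ?\<phi>"
    by (rule reparametrizationI) (auto intro!: continuous_intros mono_onI)
  moreover have "reparam \<gamma> ?\<phi> = \<gamma> \<cdot> const_path (\<gamma> 1)"
    by (auto simp: reparam_def concat_path_def const_path_def restrict_def min_def fun_eq_iff)
  ultimately show ?thesis using equiv_reparam[OF assms, of ?\<phi>] by simp
qed

lemma concat_const_left:
  assumes "\<gamma> \<in> Paths T" shows "(\<gamma>, const_path (\<gamma> 0) \<cdot> \<gamma>) \<in> Equiv T"
proof -
  let ?\<phi> = "\<lambda>t::real. max (2 * t - 1) 0"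
  have "reparametrization ?\<phi>"
    by (rule reparametrizationI) (auto intro!: continuous_intros mono_onI)
  moreover have "reparam \<gamma> ?\<phi> = const_path (\<gamma> 0) \<cdot> \<gamma>"
    by (auto simp: reparam_def concat_path_def const_path_def restrict_def max_def fun_eq_iff)
  ultimately show ?thesis using equiv_reparam[OF assms, of ?\<phi>] by simp
qed

lemma concat_assoc:
  assumes "\<alpha> \<in> Paths T" "\<beta> \<in> Paths T" "\<gamma> \<in> Paths T" "\<alpha> 1 = \<beta> 0" "\<beta> 1 = \<gamma> 0"
  shows "(\<alpha> \<cdot> (\<beta> \<cdot> \<gamma>), \<alpha> \<cdot> \<beta> \<cdot> \<gamma>) \<in> Equiv T"
proof -
  \<comment> \<open>Piecewise linear with slopes 2, 1, 1/2. It sends the break points 1/4 and 1/2 of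
    the left-bracketed path to the break points 1/2 and 3/4 of the right-bracketed one; it is
    concave, hence a minimum of its pieces.\<close>
  let ?\<phi> = "\<lambda>t::real. min (2 * t) (min (t + 1/4) ((t + 1) / 2))"
  have "reparametrization ?\<phi>"
    by (rule reparametrizationI) (auto intro!: continuous_intros mono_onI min.mono)
  moreover have "reparam (\<alpha> \<cdot> (\<beta> \<cdot> \<gamma>)) ?\<phi> = \<alpha> \<cdot> \<beta> \<cdot> \<gamma>"
  proof
    fix t :: real
    consider "t \<notin> {0..1}" | "0 \<le> t" "t \<le> 1/4" | "1/4 < t" "t \<le> 1/2" | "1/2 < t" "t \<le> 1" by force
    then show "reparam (\<alpha> \<cdot> (\<beta> \<cdot> \<gamma>)) ?\<phi> t = (\<alpha> \<cdot> \<beta> \<cdot> \<gamma>) t"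
    proof cases
      case 1 then show ?thesis by (auto simp: reparam_def concat_path_def)
    next
      case 2
      then have "?\<phi> t = 2 * t" by auto
      then show ?thesis using 2 by (simp add: reparam_def concat_path_def)
    next
      case 3
      then have "?\<phi> t = t + 1/4" by auto
      moreover have "2 * (2 * (t + 1/4) - 1) = 2 * (2 * t) - 1" by (simp add: field_simps)
      ultimately show ?thesis using 3 by (simp add: reparam_def concat_path_def del: distrib_left_numeral)
    next
      case 4
      then have "?\<phi> t = (t + 1) / 2" by auto
      then show ?thesis using 4 by (simp add: reparam_def concat_path_def field_simps)
    qed
  qed
  ultimately show ?thesis
    using equiv_reparam[of "\<alpha> \<cdot> (\<beta> \<cdot> \<gamma>)" ?\<phi>] concat assms by simp
qed

text \<open>Axiom (f) of a triple cancels on both sides at once. The missing left factor is filled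
  by a constant path, which changes nothing up to equivalence.\<close>

lemma concat_right_iff:
  assumes "\<gamma> \<in> Paths T" "\<gamma>' \<in> Paths T" "\<rho> \<in> Paths T" "\<gamma> 0 = \<gamma>' 0" "\<gamma> 1 = \<rho> 0" "\<gamma>' 1 = \<rho> 0"
  shows "(\<gamma> \<cdot> \<rho>, \<gamma>' \<cdot> \<rho>) \<in> Equiv T \<longleftrightarrow> (\<gamma>, \<gamma>') \<in> Equiv T"
proof -
  let ?c = "const_path (\<gamma> 0)"
  have c: "?c \<in> Paths T" using const path_ends assms by blast
  have "(\<delta> \<cdot> \<rho>, ?c \<cdot> \<delta> \<cdot> \<rho>) \<in> Equiv T" if "\<delta> \<in> Paths T" "\<delta> 0 = \<gamma> 0" "\<delta> 1 = \<rho> 0" for \<delta>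
  proof -
    have "(\<delta> \<cdot> \<rho>, ?c \<cdot> (\<delta> \<cdot> \<rho>)) \<in> Equiv T"
      using concat_const_left[OF concat[OF that(1) assms(3) that(3)]] that(2) by simp
    moreover have "(?c \<cdot> (\<delta> \<cdot> \<rho>), ?c \<cdot> \<delta> \<cdot> \<rho>) \<in> Equiv T"
      using concat_assoc[OF c that(1) assms(3) _ that(3)] that(2) by simp
    ultimately show ?thesis by (rule equiv_trans)
  qed
  from this[OF assms(1) HOL.refl assms(5)] this[OF assms(2) assms(4)[symmetric] assms(6)]
  have "(\<gamma> \<cdot> \<rho>, \<gamma>' \<cdot> \<rho>) \<in> Equiv T \<longleftrightarrow> (?c \<cdot> \<gamma> \<cdot> \<rho>, ?c \<cdot> \<gamma>' \<cdot> \<rho>) \<in> Equiv T"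
    by (blast intro: equiv_trans equiv_sym)
  also have "\<dots> \<longleftrightarrow> (\<gamma>, \<gamma>') \<in> Equiv T"
    using equiv_cancel[of \<gamma> \<gamma>' ?c \<rho>] assms c concat by simp
  finally show ?thesis .
qed

lemma concat_left_iff:
  assumes "\<gamma> \<in> Paths T" "\<gamma>' \<in> Paths T" "\<rho> \<in> Paths T" "\<gamma> 1 = \<gamma>' 1" "\<gamma> 0 = \<rho> 1" "\<gamma>' 0 = \<rho> 1"
  shows "(\<rho> \<cdot> \<gamma>, \<rho> \<cdot> \<gamma>') \<in> Equiv T \<longleftrightarrow> (\<gamma>, \<gamma>') \<in> Equiv T"
proof -
  let ?c = "const_path (\<gamma> 1)"
  have c: "?c \<in> Paths T" using const path_ends assms by blast
  have "(\<rho> \<cdot> \<delta>, \<rho> \<cdot> \<delta> \<cdot> ?c) \<in> Equiv T" if "\<delta> \<in> Paths T" "\<delta> 0 = \<rho> 1" "\<delta> 1 = \<gamma> 1" for \<delta>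
    using concat_const_right[OF concat[OF assms(3) that(1) that(2)[symmetric]]] that(3) by simp
  from this[OF assms(1,5) HOL.refl] this[OF assms(2,6) assms(4)[symmetric]]
  have "(\<rho> \<cdot> \<gamma>, \<rho> \<cdot> \<gamma>') \<in> Equiv T \<longleftrightarrow> (\<rho> \<cdot> \<gamma> \<cdot> ?c, \<rho> \<cdot> \<gamma>' \<cdot> ?c) \<in> Equiv T"
    by (blast intro: equiv_trans equiv_sym)
  also have "\<dots> \<longleftrightarrow> (\<gamma>, \<gamma>') \<in> Equiv T"
  proof -
    have 1: "\<gamma> 1 = ?c 0" "\<gamma>' 1 = ?c 0" using assms(4) by (simp_all only: const_ends)
    have 2: "\<rho> \<cdot> \<gamma> \<cdot> ?c \<in> Paths T" "\<rho> \<cdot> \<gamma>' \<cdot> ?c \<in> Paths T"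
      using concat[OF concat[OF assms(3,1) assms(5)[symmetric]] c]
        concat[OF concat[OF assms(3,2) assms(6)[symmetric]] c] 1
      by (simp_all only: concat_ends)
    show ?thesis
      using equiv_cancel[OF assms(1,2,3) c assms(5)[symmetric] 1(1) assms(6)[symmetric] 1(2) 2] by (rule HOL.sym)
  qed
  finally show ?thesis .
qed

lemma concat_cong:
  assumes "(\<gamma>, \<delta>) \<in> Equiv T" "(\<gamma>', \<delta>') \<in> Equiv T" "\<gamma> 1 = \<gamma>' 0"
  shows "(\<gamma> \<cdot> \<gamma>', \<delta> \<cdot> \<delta>') \<in> Equiv T"
proof -
  have "(\<gamma> \<cdot> \<gamma>', \<delta> \<cdot> \<gamma>') \<in> Equiv T"
    using concat_right_iff[of \<gamma> \<delta> \<gamma>'] assms equiv_paths equiv_endpoints by metis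
  moreover have "(\<delta> \<cdot> \<gamma>', \<delta> \<cdot> \<delta>') \<in> Equiv T"
    using concat_left_iff[of \<gamma>' \<delta>' \<delta>] assms equiv_paths equiv_endpoints by metis
  ultimately show ?thesis using equiv_trans by blast
qed

abbreviation "C \<equiv> path_cat T"

lemma path_class_eq_iff:
  "\<gamma> \<in> Paths T \<Longrightarrow> \<gamma>' \<in> Paths T \<Longrightarrow> path_class T \<gamma> = path_class T \<gamma>' \<longleftrightarrow> (\<gamma>, \<gamma>') \<in> Equiv T"
  unfolding path_class_def using equiv eq_equiv_class_iff by metis

lemma path_class_hom:
  assumes "\<gamma> \<in> Paths T" shows "path_class T \<gamma> \<in> hom C (\<gamma> 0) (\<gamma> 1)"
proof -
  have "\<gamma> \<in> path_class T \<gamma>" using equiv_refl[OF assms] by (simp add: path_class_def)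
  moreover have "\<gamma>' 0 = \<gamma> 0" "\<gamma>' 1 = \<gamma> 1" if "\<gamma>' \<in> path_class T \<gamma>" for \<gamma>'
    using that equiv_endpoints[of \<gamma> \<gamma>'] by (auto simp: path_class_def)
  ultimately have "(\<lambda>\<gamma>. \<gamma> 0) ` path_class T \<gamma> = {\<gamma> 0}" "(\<lambda>\<gamma>. \<gamma> 1) ` path_class T \<gamma> = {\<gamma> 1}"
    by blast+
  then show ?thesis using assms by (simp add: hom_def path_cat_def)
qed

lemma path_arr:
  assumes "c \<in> hom C x y"
  obtains \<gamma> where "\<gamma> \<in> Paths T" "\<gamma> 0 = x" "\<gamma> 1 = y" "c = path_class T \<gamma>"
proof -
  obtain \<gamma> where "\<gamma> \<in> Paths T" "c = path_class T \<gamma>" using assms by (auto simp: hom_def path_cat_def)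
  then show ?thesis using that path_class_hom[of \<gamma>] assms by (auto simp: hom_def)
qed

lemma path_comp:
  assumes "\<gamma> \<in> Paths T" "\<gamma>' \<in> Paths T" "\<gamma> 1 = \<gamma>' 0"
  shows "Comp C (path_class T \<gamma>') (path_class T \<gamma>) = path_class T (\<gamma> \<cdot> \<gamma>')"
proof -
  have "Equiv T `` {\<delta> \<cdot> \<delta>' | \<delta> \<delta>'. \<delta> \<in> path_class T \<gamma> \<and> \<delta>' \<in> path_class T \<gamma>'} = path_class T (\<gamma> \<cdot> \<gamma>')"
    (is "Equiv T `` ?M = _")
  proof (intro equalityI subsetI)
    fix \<epsilon> assume "\<epsilon> \<in> Equiv T `` ?M"
    then obtain \<delta> \<delta>' where "(\<gamma>, \<delta>) \<in> Equiv T" "(\<gamma>', \<delta>') \<in> Equiv T" "(\<delta> \<cdot> \<delta>', \<epsilon>) \<in> Equiv T"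
      by (auto simp: path_class_def)
    then show "\<epsilon> \<in> path_class T (\<gamma> \<cdot> \<gamma>')"
      using concat_cong[of \<gamma> \<delta> \<gamma>' \<delta>'] assms(3) equiv_trans[of _ "\<delta> \<cdot> \<delta>'"] by (auto simp: path_class_def)
  next
    fix \<epsilon> assume "\<epsilon> \<in> path_class T (\<gamma> \<cdot> \<gamma>')"
    moreover have "\<gamma> \<cdot> \<gamma>' \<in> ?M" using assms equiv_refl by (auto simp: path_class_def)
    ultimately show "\<epsilon> \<in> Equiv T `` ?M" unfolding path_class_def by blast
  qed
  then show ?thesis by (simp add: path_cat_def)
qed

lemma path_cat_simps [simp]: "Obj C = Points T" "Ident C x = path_class T (const_path x)"
  by (auto simp: path_cat_def)

lemma path_category: "is_category C"
proof
  fix f assume "f \<in> Arr C"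
  then obtain \<gamma> where g: "\<gamma> \<in> Paths T" "f = path_class T \<gamma>" by (auto simp: path_cat_def)
  have e: "Dom C f = \<gamma> 0" "Cod C f = \<gamma> 1" using path_class_hom g by (auto simp: hom_def)
  show "Dom C f \<in> Obj C" "Cod C f \<in> Obj C" using e path_ends g by auto
  show "Comp C f (Ident C (Dom C f)) = f"
    using path_comp[OF const g(1), of "\<gamma> 0"] concat_const_left[OF g(1)] path_ends[OF g(1)] e g(2)
      path_class_eq_iff[OF g(1)] equiv_paths by auto
  show "Comp C (Ident C (Cod C f)) f = f"
    using path_comp[OF g(1) const, of "\<gamma> 1"] concat_const_right[OF g(1)] path_ends[OF g(1)] e g(2)
      path_class_eq_iff[OF g(1)] equiv_paths by auto
next
  fix x assume "x \<in> Obj C"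
  then show "Ident C x \<in> Arr C \<and> Dom C (Ident C x) = x \<and> Cod C (Ident C x) = x"
    using path_class_hom[OF const, of x] by (auto simp: hom_def)
next
  fix f g assume "f \<in> Arr C" "g \<in> Arr C" "Cod C f = Dom C g"
  then have f: "f \<in> hom C (Dom C f) (Dom C g)" and g: "g \<in> hom C (Dom C g) (Cod C g)" by (auto simp: hom_def)
  obtain \<gamma> where \<gamma>: "\<gamma> \<in> Paths T" "\<gamma> 0 = Dom C f" "\<gamma> 1 = Dom C g" "f = path_class T \<gamma>" using path_arr[OF f] .
  obtain \<delta> where \<delta>: "\<delta> \<in> Paths T" "\<delta> 0 = Dom C g" "\<delta> 1 = Cod C g" "g = path_class T \<delta>" using path_arr[OF g] .
  show "Comp C g f \<in> Arr C \<and> Dom C (Comp C g f) = Dom C f \<and> Cod C (Comp C g f) = Cod C g"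
    using path_class_hom[OF concat[OF \<gamma>(1) \<delta>(1)]] path_comp[OF \<gamma>(1) \<delta>(1)] \<gamma> \<delta> by (simp add: hom_def)
next
  fix f g h assume "f \<in> Arr C" "g \<in> Arr C" "h \<in> Arr C" "Cod C f = Dom C g" "Cod C g = Dom C h"
  then have f: "f \<in> hom C (Dom C f) (Dom C g)" and g: "g \<in> hom C (Dom C g) (Dom C h)"
    and h: "h \<in> hom C (Dom C h) (Cod C h)" by (auto simp: hom_def)
  obtain \<alpha> where \<alpha>: "\<alpha> \<in> Paths T" "\<alpha> 0 = Dom C f" "\<alpha> 1 = Dom C g" "f = path_class T \<alpha>" using path_arr[OF f] .
  obtain \<beta> where \<beta>: "\<beta> \<in> Paths T" "\<beta> 0 = Dom C g" "\<beta> 1 = Dom C h" "g = path_class T \<beta>" using path_arr[OF g] .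
  obtain \<gamma> where \<gamma>: "\<gamma> \<in> Paths T" "\<gamma> 0 = Dom C h" "\<gamma> 1 = Cod C h" "h = path_class T \<gamma>" using path_arr[OF h] .
  have "(\<alpha> \<cdot> (\<beta> \<cdot> \<gamma>), \<alpha> \<cdot> \<beta> \<cdot> \<gamma>) \<in> Equiv T" using concat_assoc \<alpha> \<beta> \<gamma> by simp
  then have "path_class T (\<alpha> \<cdot> (\<beta> \<cdot> \<gamma>)) = path_class T (\<alpha> \<cdot> \<beta> \<cdot> \<gamma>)"
    using path_class_eq_iff equiv_paths by metis
  then show "Comp C h (Comp C g f) = Comp C (Comp C h g) f"
    using \<alpha> \<beta> \<gamma> path_comp concat by simp
qed

sublocale path_cat: is_category C by (rule path_category)

end

section \<open>The calculus of fractions of a screen\<close>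

locale triple_screen = triple T + screen T P for T :: "'x path_structure" and P
begin

abbreviation "S \<equiv> Sigma_P T P"

lemma pixel_unique: "A \<in> P \<Longrightarrow> B \<in> P \<Longrightarrow> x \<in> A \<Longrightarrow> x \<in> B \<Longrightarrow> A = B"
  using partition by (auto simp: partition_on_def disjoint_def)

lemma in_pixel_im: "in_pixel P \<rho> \<Longrightarrow> A \<in> P \<Longrightarrow> \<rho> 0 \<in> A \<or> \<rho> 1 \<in> A \<Longrightarrow> im \<rho> \<subseteq> A"
  unfolding in_pixel_def using pixel_unique ends_in_im by (metis subsetD)

text \<open>By (S1), lying in a pixel is a property of the class and not of the chosen
  representative.\<close>

lemma class_in_Sigma:
  assumes "\<gamma> \<in> Paths T" shows "path_class T \<gamma> \<in> S \<longleftrightarrow> in_pixel P \<gamma>"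
proof
  assume "path_class T \<gamma> \<in> S"
  then obtain \<rho> A where r: "\<rho> \<in> Paths T" "A \<in> P" "im \<rho> \<subseteq> A" "path_class T \<gamma> = path_class T \<rho>"
    unfolding Sigma_P_def in_pixel_def by blast
  then have "(\<rho>, \<gamma>) \<in> Equiv T" using path_class_eq_iff assms equiv_sym by metis
  then have "im \<gamma> \<subseteq> A" using S1[OF r(1) assms _ _ r(2,3)] equiv_endpoints by metis
  then show "in_pixel P \<gamma>" using r by (auto simp: in_pixel_def)
next
  assume "in_pixel P \<gamma>"
  then show "path_class T \<gamma> \<in> S" using assms by (auto simp: Sigma_P_def)
qed

lemma Sigma_hom:
  assumes "s \<in> S" "s \<in> hom C x y"
  obtains \<rho> where "\<rho> \<in> Paths T" "\<rho> 0 = x" "\<rho> 1 = y" "s = path_class T \<rho>" "in_pixel P \<rho>"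
  using assms path_arr class_in_Sigma by metis

text \<open>Condenses the walk of (S2) into a span, by induction along its steps: a forward step is
  appended to the right leg, and a backward step is turned around by a dual Ore square.\<close>

lemma S2_span:
  assumes A: "A \<in> P" "x \<in> A" "y \<in> A"
  obtains \<rho> \<rho>' where "\<rho> \<in> Paths T" "\<rho>' \<in> Paths T" "im \<rho> \<subseteq> A" "im \<rho>' \<subseteq> A" "\<rho> 0 = \<rho>' 0" "\<rho> 1 = x" "\<rho>' 1 = y"
proof -
  obtain n g where g: "\<And>i. i \<le> 2 * n \<Longrightarrow> g i \<in> Paths T \<and> im (g i) \<subseteq> A"
    "step_start g 0 = x" "step_end g (2 * n) = y" "\<And>i. i < 2 * n \<Longrightarrow> step_end g i = step_start g (Suc i)"
    using S2[OF A] by blast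
  have x: "x \<in> Points T" using A partition by (auto simp: partition_on_def)
  let ?Q = "\<lambda>z. \<exists>\<rho>\<in>Paths T. \<exists>\<rho>'\<in>Paths T. im \<rho> \<subseteq> A \<and> im \<rho>' \<subseteq> A \<and> \<rho> 0 = \<rho>' 0 \<and> \<rho> 1 = x \<and> \<rho>' 1 = z"
  have step: "?Q (step_end g i)" if i: "i \<le> 2 * n" and Q: "?Q (step_start g i)" for i
  proof -
    obtain \<rho> \<rho>' where r: "\<rho> \<in> Paths T" "\<rho>' \<in> Paths T" "im \<rho> \<subseteq> A" "im \<rho>' \<subseteq> A" "\<rho> 0 = \<rho>' 0" "\<rho> 1 = x"
      "\<rho>' 1 = step_start g i" using Q by blast
    have gi: "g i \<in> Paths T" "im (g i) \<subseteq> A" using g(1)[OF i] by auto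
    show ?thesis
    proof (cases "even i")
      case True
      then have "\<rho>' 1 = g i 0" "(\<rho>' \<cdot> g i) 1 = step_end g i" using r by (auto simp: step_start_def step_end_def)
      then show ?thesis
        using r(1-6) gi concat[of \<rho>' "g i"] im_concat[of \<rho>' "g i"]
        by (intro bexI[where x = \<rho>] bexI[where x = "\<rho>' \<cdot> g i"]) auto
    next
      case False
      then have e: "g i 1 = \<rho>' 1" "g i 0 = step_end g i" using r by (auto simp: step_start_def step_end_def)
      \<comment> \<open>The backward step \<open>g i\<close> and the right leg end at the same
        point; \<open>\<tau>\<close> becomes the new right leg, and \<open>\<sigma>\<close> extends
        the old left leg.\<close>
      obtain \<sigma> \<tau> where st: "\<sigma> \<in> Paths T" "\<tau> \<in> Paths T" "in_pixel P \<sigma>" "\<tau> 1 = g i 0" "\<sigma> 1 = \<rho>' 0"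
        "(\<tau> \<cdot> g i, \<sigma> \<cdot> \<rho>') \<in> Equiv T"
        using S3_dual[OF gi(1) r(2) e(1)] gi(2) A(1) unfolding in_pixel_def by blast
      have sA: "im \<sigma> \<subseteq> A" using in_pixel_im[OF st(3) A(1)] st(5) r(4) ends_in_im(1)[of \<rho>'] by auto
      have "im (\<sigma> \<cdot> \<rho>') \<subseteq> A" using sA r(4) im_concat[of \<sigma> \<rho>'] st(5) by simp
      \<comment> \<open>(S3) places only \<open>\<sigma>\<close> in a pixel. That
        \<open>\<tau>\<close> stays in \<open>A\<close> follows from (S1), applied to the two sides
        of the square.\<close>
      then have "im (\<tau> \<cdot> g i) \<subseteq> A"
        using S1[of "\<sigma> \<cdot> \<rho>'" "\<tau> \<cdot> g i" A] equiv_sym[OF st(6)] equiv_paths[OF st(6)] equiv_endpoints[OF st(6)] A(1)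
        by auto
      then have "im \<tau> \<subseteq> A" using im_concat[of \<tau> "g i"] st(4) by simp
      moreover have "im (\<sigma> \<cdot> \<rho>) \<subseteq> A" "\<sigma> \<cdot> \<rho> \<in> Paths T"
        using im_concat[of \<sigma> \<rho>] sA r st concat by auto
      moreover have "\<sigma> 0 = \<tau> 0" using equiv_endpoints[OF st(6)] by simp
      ultimately show ?thesis
        using st(2,4) e(2) r(6) by (intro bexI[where x = "\<sigma> \<cdot> \<rho>"] bexI[where x = \<tau>]) auto
    qed
  qed
  have "?Q (step_start g 0)"
    using const[OF x] A(2) g(2) by (intro bexI[of _ "const_path x"]) auto
  moreover have "?Q (step_end g i)" if "i \<le> 2 * n" "?Q (step_start g 0)" for i
    using that(1)
  proof (induction i)
    case 0
    then show ?case using step that(2) by blast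
  next
    case (Suc i)
    then show ?case using step[of "Suc i"] g(4)[of i] by simp
  qed
  ultimately have "?Q y" using g(3) by (metis order_refl)
  then show ?thesis using that by blast
qed

lemma screen_pixel_category: "pixel_category C S P"
proof
  show "S \<subseteq> Arr C" by (auto simp: Sigma_P_def path_cat_def)
  show "partition_on (Obj C) P" using partition by simp
next
  fix f f' g x y z
  assume "f \<in> hom C x y" "f' \<in> hom C x y" "g \<in> hom C y z" "Comp C g f = Comp C g f'"
  then show "f = f'"
    using path_comp concat path_class_eq_iff concat_right_iff by (elim path_arr) auto
next
  fix f g g' x y z
  assume "f \<in> hom C x y" "g \<in> hom C y z" "g' \<in> hom C y z" "Comp C g f = Comp C g' f"
  then show "g = g'"
    using path_comp concat path_class_eq_iff concat_left_iff by (elim path_arr) auto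
next
  fix s assume s: "s \<in> S"
  then obtain \<rho> A where r: "\<rho> \<in> Paths T" "s = path_class T \<rho>" "A \<in> P" "im \<rho> \<subseteq> A"
    by (auto simp: Sigma_P_def in_pixel_def)
  then show "\<exists>A\<in>P. Dom C s \<in> A \<and> Cod C s \<in> A"
    using path_class_hom[OF r(1)] ends_in_im[of \<rho>] by (auto simp: hom_def)
next
  fix x assume "x \<in> Obj C"
  then show "Ident C x \<in> S"
    using const[of x] partition by (auto simp: class_in_Sigma in_pixel_def partition_on_def)
next
  fix s t assume st: "s \<in> S" "t \<in> S" "Cod C s = Dom C t"
  then have sh: "s \<in> hom C (Dom C s) (Dom C t)" and th: "t \<in> hom C (Dom C t) (Cod C t)"
    by (auto simp: hom_def Sigma_P_def path_cat_def)
  obtain \<rho> where r: "\<rho> \<in> Paths T" "\<rho> 1 = Dom C t" "s = path_class T \<rho>" "in_pixel P \<rho>"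
    using Sigma_hom[OF st(1) sh] by metis
  obtain \<sigma> where r': "\<sigma> \<in> Paths T" "\<sigma> 0 = Dom C t" "t = path_class T \<sigma>" "in_pixel P \<sigma>"
    using Sigma_hom[OF st(2) th] by metis
  obtain A where A: "A \<in> P" "im \<rho> \<subseteq> A" using r by (auto simp: in_pixel_def)
  have "im \<sigma> \<subseteq> A" using in_pixel_im[OF r'(4) A(1)] r' r(2) ends_in_im(2)[of \<rho>] A(2) by auto
  then have "in_pixel P (\<rho> \<cdot> \<sigma>)" using im_concat[of \<rho> \<sigma>] r r' A by (auto simp: in_pixel_def)
  then show "Comp C t s \<in> S" using path_comp[of \<rho> \<sigma>] r r' concat class_in_Sigma by auto
next
  fix f g x y z assume f: "f \<in> hom C x y" and g: "g \<in> hom C y z" and gf: "Comp C g f \<in> S"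
  obtain \<gamma> where \<gamma>: "\<gamma> \<in> Paths T" "\<gamma> 1 = y" "f = path_class T \<gamma>" using path_arr[OF f] by metis
  obtain \<delta> where \<delta>: "\<delta> \<in> Paths T" "\<delta> 0 = y" "g = path_class T \<delta>" using path_arr[OF g] by metis
  have "in_pixel P (\<gamma> \<cdot> \<delta>)"
    using gf path_comp[of \<gamma> \<delta>] class_in_Sigma[of "\<gamma> \<cdot> \<delta>"] concat[of \<gamma> \<delta>] \<gamma> \<delta> by simp
  then show "f \<in> S \<and> g \<in> S"
    using im_concat[of \<gamma> \<delta>] class_in_Sigma[of \<gamma>] class_in_Sigma[of \<delta>] \<gamma> \<delta> by (auto simp: in_pixel_def)
next
  fix s t x y assume "s \<in> S" "t \<in> S" and h: "s \<in> hom C x y" "t \<in> hom C x y"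
  obtain \<rho> where r: "\<rho> \<in> Paths T" "\<rho> 0 = x" "\<rho> 1 = y" "s = path_class T \<rho>" "in_pixel P \<rho>"
    using Sigma_hom[OF \<open>s \<in> S\<close> h(1)] .
  obtain \<sigma> where r': "\<sigma> \<in> Paths T" "\<sigma> 0 = x" "\<sigma> 1 = y" "t = path_class T \<sigma>" "in_pixel P \<sigma>"
    using Sigma_hom[OF \<open>t \<in> S\<close> h(2)] .
  obtain A where A: "A \<in> P" "im \<rho> \<subseteq> A" using r by (auto simp: in_pixel_def)
  have "im \<sigma> \<subseteq> A" using in_pixel_im[OF r'(5) A(1)] r' r(2) ends_in_im(1)[of \<rho>] A(2) by auto
  then have "(\<rho>, \<sigma>) \<in> Equiv T" using S1[OF r(1) r'(1) _ _ A] r r' by simp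
  then show "s = t" using path_class_eq_iff r r' by simp
next
  fix f s x y z assume f: "f \<in> hom C x y" and s: "s \<in> S" "s \<in> hom C x z"
  obtain \<gamma> where \<gamma>: "\<gamma> \<in> Paths T" "\<gamma> 0 = x" "\<gamma> 1 = y" "f = path_class T \<gamma>" using path_arr[OF f] .
  obtain \<rho> where \<rho>: "\<rho> \<in> Paths T" "\<rho> 0 = x" "\<rho> 1 = z" "s = path_class T \<rho>" "in_pixel P \<rho>"
    using Sigma_hom[OF s] .
  obtain \<rho>' \<gamma>' where *: "\<rho>' \<in> Paths T" "\<gamma>' \<in> Paths T" "in_pixel P \<rho>'" "\<gamma> 1 = \<rho>' 0" "\<rho> 1 = \<gamma>' 0"
    "(\<gamma> \<cdot> \<rho>', \<rho> \<cdot> \<gamma>') \<in> Equiv T" using S3[OF \<rho>(1) \<gamma>(1) _ \<rho>(5)] \<rho> \<gamma> by auto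
  have "Comp C (path_class T \<rho>') f = Comp C (path_class T \<gamma>') s"
    using path_comp[OF \<gamma>(1) *(1,4)] path_comp[OF \<rho>(1) *(2,5)] path_class_eq_iff equiv_paths[OF *(6)] *(6) \<gamma> \<rho>
    by auto
  moreover have "\<rho>' 1 = \<gamma>' 1" using equiv_endpoints[OF *(6)] by simp
  ultimately show "\<exists>w s' f'. s' \<in> S \<and> s' \<in> hom C y w \<and> f' \<in> hom C z w \<and> Comp C s' f = Comp C f' s"
    using path_class_hom[OF *(1)] path_class_hom[OF *(2)] class_in_Sigma[OF *(1)] * \<rho> \<gamma> by metis
next
  fix f s x y z assume f: "f \<in> hom C y x" and s: "s \<in> S" "s \<in> hom C z x"
  obtain \<gamma> where \<gamma>: "\<gamma> \<in> Paths T" "\<gamma> 0 = y" "\<gamma> 1 = x" "f = path_class T \<gamma>" using path_arr[OF f] .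
  obtain \<rho> where \<rho>: "\<rho> \<in> Paths T" "\<rho> 0 = z" "\<rho> 1 = x" "s = path_class T \<rho>" "in_pixel P \<rho>"
    using Sigma_hom[OF s] .
  obtain \<rho>' \<gamma>' where *: "\<rho>' \<in> Paths T" "\<gamma>' \<in> Paths T" "in_pixel P \<rho>'" "\<gamma>' 1 = \<rho> 0" "\<rho>' 1 = \<gamma> 0"
    "(\<gamma>' \<cdot> \<rho>, \<rho>' \<cdot> \<gamma>) \<in> Equiv T" using S3_dual[OF \<rho>(1) \<gamma>(1) _ \<rho>(5)] \<rho> \<gamma> by auto
  have "Comp C f (path_class T \<rho>') = Comp C s (path_class T \<gamma>')"
    using path_comp[OF *(1) \<gamma>(1) *(5)] path_comp[OF *(2) \<rho>(1) *(4)] path_class_eq_iff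
      equiv_paths[OF *(6)] equiv_sym[OF *(6)] \<gamma> \<rho>
    by auto
  moreover have "\<rho>' 0 = \<gamma>' 0" using equiv_endpoints[OF *(6)] by simp
  ultimately show "\<exists>w s' f'. s' \<in> S \<and> s' \<in> hom C w y \<and> f' \<in> hom C w z \<and> Comp C f s' = Comp C s f'"
    using path_class_hom[OF *(1)] path_class_hom[OF *(2)] class_in_Sigma[OF *(1)] * \<rho> \<gamma> by metis
next
  fix A x y assume A: "A \<in> P" "x \<in> A" "y \<in> A"
  obtain \<rho> \<rho>' where r: "\<rho> \<in> Paths T" "\<rho>' \<in> Paths T" "im \<rho> \<subseteq> A" "im \<rho>' \<subseteq> A" "\<rho> 0 = \<rho>' 0" "\<rho> 1 = x" "\<rho>' 1 = y"
    using S2_span[OF A] .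
  have p: "in_pixel P \<rho>" "in_pixel P \<rho>'" using r A by (auto simp: in_pixel_def)
  then show "\<exists>w s t. s \<in> S \<and> t \<in> S \<and> s \<in> hom C w x \<and> t \<in> hom C w y"
    using path_class_hom[OF r(1)] path_class_hom[OF r(2)] r class_in_Sigma by metis
  \<comment> \<open>(S3) completes the span to a square. (S1) keeps it inside \<open>A\<close>, and
    its other two sides form the cospan.\<close>
  obtain \<sigma> \<tau> where *: "\<sigma> \<in> Paths T" "\<tau> \<in> Paths T" "in_pixel P \<sigma>" "\<rho>' 1 = \<sigma> 0" "\<rho> 1 = \<tau> 0"
    "(\<rho>' \<cdot> \<sigma>, \<rho> \<cdot> \<tau>) \<in> Equiv T" using S3[OF r(1,2,5) p(1)] by blast
  have "im \<sigma> \<subseteq> A" using in_pixel_im[OF *(3) A(1)] *(4) r(7) A(3) by auto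
  then have "im (\<rho>' \<cdot> \<sigma>) \<subseteq> A" using im_concat[of \<rho>' \<sigma>] *(4) r(4) by simp
  then have "im (\<rho> \<cdot> \<tau>) \<subseteq> A"
    using S1[of "\<rho>' \<cdot> \<sigma>" "\<rho> \<cdot> \<tau>" A] *(6) equiv_paths[OF *(6)] equiv_endpoints[OF *(6)] A(1) by auto
  then have "in_pixel P \<tau>" using im_concat[of \<rho> \<tau>] *(5) A(1) by (auto simp: in_pixel_def)
  moreover have "\<sigma> 1 = \<tau> 1" using equiv_endpoints[OF *(6)] by simp
  ultimately show "\<exists>w s t. s \<in> S \<and> t \<in> S \<and> s \<in> hom C x w \<and> t \<in> hom C y w"
    using path_class_hom[OF *(1)] path_class_hom[OF *(2)] r * class_in_Sigma by metis
qed

sublocale pixel_category C S P by (rule screen_pixel_category)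

end

section \<open>Products of categories and factorization of functors\<close>

lemma prod_cat_hom:
  "f \<in> hom (prod_cat I C) x y \<longleftrightarrow>
    f \<in> (\<Pi>\<^sub>E i\<in>I. hom (C i) (x i) (y i)) \<and> x \<in> extensional I \<and> y \<in> extensional I"
  by (auto simp: hom_def prod_cat_def PiE_def Pi_def extensional_def restrict_def fun_eq_iff)

lemma prod_category:
  assumes "\<And>i. i \<in> I \<Longrightarrow> is_category (C i)"
  shows "is_category (prod_cat I C)" (is "is_category ?P")
proof
  fix f assume "f \<in> Arr ?P"
  then have f: "f \<in> extensional I" "\<And>i. i \<in> I \<Longrightarrow> f i \<in> Arr (C i)" by (auto simp: prod_cat_def PiE_def)
  show "Dom ?P f \<in> Obj ?P" "Cod ?P f \<in> Obj ?P"
    using f is_category.dom_obj[OF assms] is_category.cod_obj[OF assms] by (auto simp: prod_cat_def)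
  show "Comp ?P f (Ident ?P (Dom ?P f)) = f"
    "Comp ?P (Ident ?P (Cod ?P f)) f = f"
    using f is_category.comp_ident_left[OF assms] is_category.comp_ident_right[OF assms]
    by (auto simp: prod_cat_def fun_eq_iff restrict_def extensional_def)
next
  fix x assume "x \<in> Obj ?P"
  then have "\<And>i. i \<in> I \<Longrightarrow> x i \<in> Obj (C i)" "x \<in> extensional I" by (auto simp: prod_cat_def PiE_def)
  then show "Ident ?P x \<in> Arr ?P \<and> Dom ?P (Ident ?P x) = x \<and>
      Cod ?P (Ident ?P x) = x"
    using is_category.ident[OF assms]
    by (auto simp: prod_cat_def fun_eq_iff restrict_def extensional_def)
next
  fix f g assume "f \<in> Arr ?P" "g \<in> Arr ?P" "Cod ?P f = Dom ?P g"
  then have "\<And>i. i \<in> I \<Longrightarrow> f i \<in> Arr (C i) \<and> g i \<in> Arr (C i) \<and> Cod (C i) (f i) = Dom (C i) (g i)"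
    by (auto simp: prod_cat_def fun_eq_iff restrict_def split: if_splits)
  then show "Comp ?P g f \<in> Arr ?P \<and>
      Dom ?P (Comp ?P g f) = Dom ?P f \<and>
      Cod ?P (Comp ?P g f) = Cod ?P g"
    using is_category.comp[OF assms] by (auto simp: prod_cat_def fun_eq_iff restrict_def)
next
  fix f g h assume "f \<in> Arr ?P" "g \<in> Arr ?P" "h \<in> Arr ?P"
    "Cod ?P f = Dom ?P g" "Cod ?P g = Dom ?P h"
  then have "\<And>i. i \<in> I \<Longrightarrow> f i \<in> Arr (C i) \<and> g i \<in> Arr (C i) \<and> h i \<in> Arr (C i) \<and>
      Cod (C i) (f i) = Dom (C i) (g i) \<and> Cod (C i) (g i) = Dom (C i) (h i)"
    by (auto simp: prod_cat_def fun_eq_iff restrict_def split: if_splits)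
  then show "Comp ?P h (Comp ?P g f) = Comp ?P (Comp ?P h g) f"
    using is_category.comp_assoc[OF assms] by (auto simp: prod_cat_def fun_eq_iff restrict_def)
qed

lemma prod_functor:
  assumes A: "is_category A" and F: "\<And>i. i \<in> I \<Longrightarrow> is_functor A (C i) (F i)"
  shows "is_functor A (prod_cat I C)
    \<lparr>FObj = (\<lambda>x. \<lambda>i\<in>I. FObj (F i) x), FArr = (\<lambda>f. \<lambda>i\<in>I. FArr (F i) f)\<rparr>"
    (is "is_functor A ?P ?F")
proof (rule is_functorI[OF A prod_category])
  show "is_category (C i)" if "i \<in> I" for i using F[OF that] by (simp add: is_functor_def)
next
  fix x assume "x \<in> Obj A"
  then show "FObj ?F x \<in> Obj ?P" "FArr ?F (Ident A x) = Ident ?P (FObj ?F x)"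
    using functor_obj[OF F] functor_ident[OF F] by (auto simp: prod_cat_def fun_eq_iff restrict_def)
next
  fix x y f assume "f \<in> hom A x y"
  then show "FArr ?F f \<in> hom ?P (FObj ?F x) (FObj ?F y)"
    using functor_hom[OF F] by (auto simp: prod_cat_hom)
next
  fix x y z f g assume f: "f \<in> hom A x y" and g: "g \<in> hom A y z"
  show "FArr ?F (Comp A g f) = Comp ?P (FArr ?F g) (FArr ?F f)"
    using functor_comp[OF F f g] by (auto simp: prod_cat_def fun_eq_iff restrict_def)
qed

lemma proj_functor:
  assumes "\<And>i. i \<in> I \<Longrightarrow> is_category (C i)" "j \<in> I"
  shows "is_functor (prod_cat I C) (C j) \<lparr>FObj = (\<lambda>x. x j), FArr = (\<lambda>f. f j)\<rparr>"
  by (rule is_functorI[OF prod_category assms(1)]) (use assms in \<open>auto simp: prod_cat_hom\<close>,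
    auto simp: prod_cat_def)

text \<open>\<open>E\<close> embeds \<open>A\<close> into \<open>B\<close> injectively on objects
  and on arrows, so a functor with values in the image can be pulled back pointwise; injectivity
  gives functoriality as well as uniqueness.\<close>

lemma functor_factorization:
  assumes E: "is_functor A B E" and K: "is_functor Z B K"
    and inj: "inj_on (FObj E) (Obj A)" "inj_on (FArr E) (Arr A)"
    and sub: "\<And>z. z \<in> Obj Z \<Longrightarrow> FObj K z \<in> FObj E ` Obj A" "\<And>f. f \<in> Arr Z \<Longrightarrow> FArr K f \<in> FArr E ` Arr A"
  shows "\<exists>L. is_functor Z A L \<and> functor_eq Z (comp_functor E L) K \<and>
    (\<forall>L'. is_functor Z A L' \<and> functor_eq Z (comp_functor E L') K \<longrightarrow> functor_eq Z L' L)"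
proof -
  define L where "L = \<lparr>FObj = inv_into (Obj A) (FObj E) \<circ> FObj K, FArr = inv_into (Arr A) (FArr E) \<circ> FArr K\<rparr>"
  have obj: "FObj L z \<in> Obj A \<and> FObj E (FObj L z) = FObj K z" if "z \<in> Obj Z" for z
    using sub(1)[OF that] by (auto simp: L_def inv_into_into f_inv_into_f)
  have arr: "FArr L f \<in> Arr A \<and> FArr E (FArr L f) = FArr K f" if "f \<in> Arr Z" for f
    using sub(2)[OF that] by (auto simp: L_def inv_into_into f_inv_into_f)
  interpret Z: is_category Z using K by (simp add: is_functor_def)
  interpret A: is_category A using E by (simp add: is_functor_def)
  \<comment> \<open>The endpoints of the preimage are not known in advance; they are recovered by
    applying \<open>E\<close>, which is injective on objects.\<close>
  have hom: "FArr L f \<in> hom A (FObj L x) (FObj L y)" if "f \<in> hom Z x y" for f x y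
  proof -
    let ?u = "Dom A (FArr L f)" and ?v = "Cod A (FArr L f)"
    have f: "f \<in> Arr Z" "x \<in> Obj Z" "y \<in> Obj Z" using that Z.hom_obj by (auto simp: hom_def)
    have uv: "?u \<in> Obj A" "?v \<in> Obj A" using arr[OF f(1)] A.dom_obj A.cod_obj by auto
    have "FArr E (FArr L f) \<in> hom B (FObj E ?u) (FObj E ?v)"
      using functor_hom[OF E arr_hom] arr[OF f(1)] by blast
    moreover have "FArr E (FArr L f) \<in> hom B (FObj K x) (FObj K y)"
      using functor_hom[OF K that] arr[OF f(1)] by simp
    ultimately have "FObj E ?u = FObj E (FObj L x)" "FObj E ?v = FObj E (FObj L y)"
      using obj f by (auto simp: hom_def)
    then have "?u = FObj L x" "?v = FObj L y" using inj_onD[OF inj(1)] uv obj f by blast+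
    then show ?thesis using arr[OF f(1)] by (simp add: hom_def)
  qed
  have "is_functor Z A L"
  proof (rule is_functorI)
    fix x assume x: "x \<in> Obj Z"
    have "FArr E (FArr L (Ident Z x)) = FArr E (Ident A (FObj L x))"
      using arr[of "Ident Z x"] Z.ident[OF x] functor_ident[OF K x] functor_ident[OF E, of "FObj L x"] obj[OF x]
      by simp
    then show "FArr L (Ident Z x) = Ident A (FObj L x)"
      using inj_onD[OF inj(2)] arr Z.ident[OF x] A.ident obj[OF x] by blast
  next
    fix x y z f g assume f: "f \<in> hom Z x y" and g: "g \<in> hom Z y z"
    have "FArr E (FArr L (Comp Z g f)) = FArr E (Comp A (FArr L g) (FArr L f))"
      using arr homD[OF f] homD[OF g] homD[OF Z.comp_hom[OF f g]] functor_comp[OF K f g]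
        functor_comp[OF E hom[OF f] hom[OF g]] by simp
    then show "FArr L (Comp Z g f) = Comp A (FArr L g) (FArr L f)"
      using inj_onD[OF inj(2)] arr homD[OF Z.comp_hom[OF f g]] homD[OF A.comp_hom[OF hom[OF f] hom[OF g]]]
      by blast
  qed (use obj hom Z.is_category_axioms A.is_category_axioms in auto)
  moreover have "functor_eq Z (comp_functor E L) K"
    using obj arr by (auto simp: functor_eq_def comp_functor_def)
  moreover have "functor_eq Z L' L" if "is_functor Z A L'" "functor_eq Z (comp_functor E L') K" for L'
  proof -
    have "FObj L' x = FObj L x" if "x \<in> Obj Z" for x
      using inj_onD[OF inj(1)] functor_obj[OF \<open>is_functor Z A L'\<close> that] obj[OF that]
        \<open>functor_eq Z (comp_functor E L') K\<close> that by (auto simp: functor_eq_def comp_functor_def)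
    moreover have "FArr L' f = FArr L f" if "f \<in> Arr Z" for f
      using inj_onD[OF inj(2)] homD[OF functor_hom[OF \<open>is_functor Z A L'\<close> arr_hom[OF that]]] arr[OF that]
        \<open>functor_eq Z (comp_functor E L') K\<close> that by (auto simp: functor_eq_def comp_functor_def)
    ultimately show ?thesis by (simp add: functor_eq_def)
  qed
  ultimately show ?thesis by blast
qed

section \<open>Initial pixels\<close>

locale pixel_refinement = fine: pixel_functor C S P D F + coarse: pixel_functor C S' P' D' F'
  for C :: "('o, 'm) category" and S :: "'m set" and P :: "'o set set"
    and D :: "('o set, 'n) category" and F :: "('o, 'm, 'o set, 'n) cfunctor"
    and S' :: "'m set" and P' :: "'o set set"
    and D' :: "('o set, 'n) category" and F' :: "('o, 'm, 'o set, 'n) cfunctor" +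
  assumes S_sub: "S \<subseteq> S'"
    and refine: "A \<in> P \<Longrightarrow> \<exists>A'\<in>P'. A \<subseteq> A'"
    and finite_blocks: "A' \<in> P' \<Longrightarrow> finite {A \<in> P. A \<subseteq> A'}"
begin

text \<open>\<open>is_initial_pixel\<close> in terms of arrows: the paths inside a coarse pixel are
  the arrows of \<open>S'\<close> between its points.\<close>

definition initial :: "'o set \<Rightarrow> 'o set \<Rightarrow> bool" where
  "initial A' A \<longleftrightarrow> A \<in> P \<and> A \<subseteq> A' \<and> (\<forall>y\<in>A'. \<exists>x\<in>A. \<exists>s\<in>S'. s \<in> hom C x y)"

lemma block_sub:
  assumes "A' \<in> P'" "A \<in> P" "x \<in> A" "x \<in> A'"
  shows "A \<subseteq> A'"
proof -
  obtain B where B: "B \<in> P'" "A \<subseteq> B" using refine assms(2) by blast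
  then have "B = A'"
    using coarse.blk_eq[OF B(1), of x] coarse.blk_eq[OF assms(1,4)] assms(3) by blast
  then show ?thesis using B(2) by simp
qed

text \<open>One arrow of \<open>S'\<close> from \<open>A\<close> to \<open>B\<close> suffices to
  reach all of \<open>B\<close>. The Ore square is taken with respect to the fine \<open>S\<close>,
  so the start stays in the fine pixel \<open>A\<close>; the new side lies in \<open>S'\<close>
  because it is a factor of an element of \<open>S'\<close>.\<close>

lemma initial_spread:
  assumes "A \<in> P" "B \<in> P" "x \<in> A" "y \<in> B" "y' \<in> B" "s \<in> S'" "s \<in> hom C x y"
  shows "\<exists>x'\<in>A. \<exists>s'\<in>S'. s' \<in> hom C x' y'"
proof -
  obtain w \<sigma> \<tau> where st: "\<sigma> \<in> S" "\<tau> \<in> S" "\<sigma> \<in> hom C w y" "\<tau> \<in> hom C w y'"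
    using fine.span[OF assms(2,4,5)] by blast
  obtain v \<sigma>' f where f: "\<sigma>' \<in> S" "\<sigma>' \<in> hom C v x" "f \<in> hom C v w" "Comp C s \<sigma>' = Comp C \<sigma> f"
    using fine.ore_dual[OF assms(7) st(1,3)] by blast
  have "Comp C \<sigma> f \<in> S'"
    using coarse.S_comp_hom[OF _ assms(6) f(2) assms(7)] f(1,4) S_sub by auto
  then have "f \<in> S'" using coarse.S_factor[OF f(3) st(3)] by simp
  then have "Comp C \<tau> f \<in> S' \<and> Comp C \<tau> f \<in> hom C v y'"
    using coarse.S_comp_hom[OF _ _ f(3) st(4)] st(2) S_sub by auto
  moreover have "v \<in> A" using fine.S_hom_block[OF f(1,2) assms(1)] assms(3) by simp
  ultimately show ?thesis by blast
qed

text \<open>Fine pixels inside \<open>A'\<close> are directed under reachability: any two are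
  reached from a third. As there are finitely many of them, one reaches all.\<close>

lemma initial_exists:
  assumes A': "A' \<in> P'"
  obtains A where "initial A' A"
proof -
  let ?B = "{A \<in> P. A \<subseteq> A'}"
  have "\<exists>A\<in>?B. \<forall>B\<in>G. \<forall>y\<in>B. \<exists>x\<in>A. \<exists>s\<in>S'. s \<in> hom C x y" if "finite G" "G \<subseteq> ?B" for G
    using that
  proof (induction G)
    case empty
    obtain x where x: "x \<in> A'" using coarse.block_nonempty[OF A'] by blast
    then show ?case
      using fine.blk_mem[of x] block_sub[OF A'] coarse.block_obj[OF A'] by blast
  next
    case (insert B G)
    then obtain A where A: "A \<in> P" "A \<subseteq> A'" "\<forall>B\<in>G. \<forall>y\<in>B. \<exists>x\<in>A. \<exists>s\<in>S'. s \<in> hom C x y" by auto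
    have B: "B \<in> P" "B \<subseteq> A'" using insert by auto
    obtain a b where ab: "a \<in> A" "b \<in> B" using fine.block_nonempty[OF A(1)] fine.block_nonempty[OF B(1)] by blast
    \<comment> \<open>The apex of a coarse span over \<open>A\<close> and \<open>B\<close> supplies
      the next candidate, namely its fine pixel.\<close>
    obtain w s t where st: "s \<in> S'" "t \<in> S'" "s \<in> hom C w a" "t \<in> hom C w b"
      using coarse.span[OF A', of a b] ab A B by blast
    have w: "fine.blk w \<in> P" "w \<in> fine.blk w" using fine.blk_mem fine.hom_obj[OF st(3)] by auto
    have "w \<in> A'" using coarse.S_hom_block[OF st(1,3) A'] ab A by auto
    then have "fine.blk w \<subseteq> A'" using block_sub[OF A' w] by simp
    moreover have toA: "\<exists>x\<in>fine.blk w. \<exists>s\<in>S'. s \<in> hom C x y" if "y \<in> A" for y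
      using initial_spread[OF w(1) A(1) w(2) ab(1) that st(1,3)] .
    moreover have "\<exists>x\<in>fine.blk w. \<exists>s\<in>S'. s \<in> hom C x y" if "y \<in> B" for y
      using initial_spread[OF w(1) B(1) w(2) ab(2) that st(2,4)] .
    moreover have "\<exists>x\<in>fine.blk w. \<exists>s\<in>S'. s \<in> hom C x y" if C': "C' \<in> G" "y \<in> C'" for C' y
    proof -
      obtain x s where x: "x \<in> A" "s \<in> S'" "s \<in> hom C x y" using A(3) C' by meson
      obtain x' t where t: "x' \<in> fine.blk w" "t \<in> S'" "t \<in> hom C x' x" using toA[OF x(1)] by meson
      show ?thesis using coarse.S_comp_hom[OF t(2) x(2) t(3) x(3)] t(1) by blast
    qed
    ultimately have "fine.blk w \<subseteq> A'"
      "\<forall>B'\<in>insert B G. \<forall>y\<in>B'. \<exists>x\<in>fine.blk w. \<exists>s\<in>S'. s \<in> hom C x y"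
      by blast+
    then show ?case using w(1) by (intro bexI[where x = "fine.blk w"] CollectI conjI) assumption+
  qed
  from this[OF finite_blocks[OF A'] order_refl]
  obtain A where A: "A \<in> P" "A \<subseteq> A'" "\<And>B y. B \<in> P \<Longrightarrow> B \<subseteq> A' \<Longrightarrow> y \<in> B \<Longrightarrow> \<exists>x\<in>A. \<exists>s\<in>S'. s \<in> hom C x y"
    by blast
  have "\<exists>x\<in>A. \<exists>s\<in>S'. s \<in> hom C x y" if "y \<in> A'" for y
    using A(3) fine.blk_mem[of y] block_sub[OF A'] coarse.block_obj[OF A' that] that by blast
  then show ?thesis using that A unfolding initial_def by blast
qed

text \<open>Arrows \<open>x1 \<rightarrow> x2\<close> and \<open>x3 \<rightarrow> x1\<close> between two initial pixels compose to an arrow that is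
  parallel to one inside a single fine pixel, up to \<open>S\<close>; being equal to it by thinness of the coarse
  pixels, the composite lies in the fine pixel, and so do its factors.\<close>

lemma initial_unique:
  assumes A': "A' \<in> P'" and "initial A' A" "initial A' B"
  shows "A = B"
proof -
  have A: "A \<in> P" "A \<subseteq> A'" and B: "B \<in> P" "B \<subseteq> A'" using assms by (auto simp: initial_def)
  obtain x2 where x2: "x2 \<in> B" using fine.block_nonempty[OF B(1)] by blast
  obtain x1 \<gamma> where x1: "x1 \<in> A" "\<gamma> \<in> S'" "\<gamma> \<in> hom C x1 x2" using assms(2) x2 B(2) unfolding initial_def by (meson subsetD)
  obtain x3 \<delta> where x3: "x3 \<in> B" "\<delta> \<in> S'" "\<delta> \<in> hom C x3 x1" using assms(3) x1(1) A(2) unfolding initial_def by (meson subsetD)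
  obtain w s t where st: "s \<in> S" "t \<in> S" "s \<in> hom C x2 w" "t \<in> hom C x3 w"
    using fine.cospan[OF B(1) x2 x3(1)] by blast
  have g: "Comp C s \<gamma> \<in> S' \<and> Comp C s \<gamma> \<in> hom C x1 w"
    using coarse.S_comp_hom[OF x1(2) _ x1(3) st(3)] st(1) S_sub by auto
  then have "Comp C (Comp C s \<gamma>) \<delta> = t"
    using coarse.S_thin[of _ t x3 w] coarse.S_comp_hom[OF x3(2) _ x3(3)] st S_sub by auto
  then have "\<delta> \<in> S" using fine.S_factor[OF x3(3), of "Comp C s \<gamma>" w] g st(2) by auto
  then show ?thesis
    using fine.S_hom_block[OF _ x3(3) B(1)] fine.blk_eq A(1) B(1) x1(1) x3(1) by blast
qed

text \<open>Arrows of the fine \<open>S\<close> make \<open>h\<close> and \<open>h'\<close> parallel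
  without changing their images under either functor. Both functors are faithful, so each equation
  says that the same two arrows of \<open>C\<close> coincide. Independence of the lift in
  \<open>Init\<close> and faithfulness of \<open>Init\<close> both come from here.\<close>

lemma eq_iff:
  assumes "A \<in> P" "B \<in> P" "x \<in> A" "x' \<in> A" "y \<in> B" "y' \<in> B" "h \<in> hom C x y" "h' \<in> hom C x' y'"
  shows "FArr F h = FArr F h' \<longleftrightarrow> FArr F' h = FArr F' h'"
proof -
  obtain u s s' where s: "s \<in> S" "s' \<in> S" "s \<in> hom C u x" "s' \<in> hom C u x'"
    using fine.span[OF assms(1,3,4)] by blast
  obtain v t t' where t: "t \<in> S" "t' \<in> S" "t \<in> hom C y v" "t' \<in> hom C y' v"
    using fine.cospan[OF assms(2,5,6)] by blast
  let ?e = "Comp C t (Comp C h s)" and ?e' = "Comp C t' (Comp C h' s')"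
  note hs = fine.comp_hom[OF s(3) assms(7)] fine.comp_hom[OF s(4) assms(8)]
  note e = fine.comp_hom[OF hs(1) t(3)] fine.comp_hom[OF hs(2) t(4)]
  have "FArr F ?e = FArr F h" "FArr F ?e' = FArr F h'"
    using fine.F_pre[OF assms(7) s(1,3)] fine.F_pre[OF assms(8) s(2,4)]
      fine.F_post[OF hs(1) t(1,3)] fine.F_post[OF hs(2) t(2,4)] by simp_all
  moreover have "FArr F' ?e = FArr F' h" "FArr F' ?e' = FArr F' h'"
    using coarse.F_pre[OF assms(7) _ s(3)] coarse.F_pre[OF assms(8) _ s(4)]
      coarse.F_post[OF hs(1) _ t(3)] coarse.F_post[OF hs(2) _ t(4)]
      subsetD[OF S_sub s(1)] subsetD[OF S_sub s(2)] subsetD[OF S_sub t(1)] subsetD[OF S_sub t(2)]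
    by simp_all
  ultimately show ?thesis using fine.F_faithful[OF e] coarse.F_faithful[OF e] by metis
qed

end

text \<open>\<open>Init\<close> is handled through two properties, initial values on objects and
  compatibility with lifts on arrows, rather than through its definite descriptions.\<close>

locale pixel_init = pixel_refinement C S P D F S' P' D' F'
  for C :: "('o, 'm) category" and S :: "'m set" and P :: "'o set set"
    and D :: "('o set, 'n) category" and F :: "('o, 'm, 'o set, 'n) cfunctor"
    and S' :: "'m set" and P' :: "'o set set"
    and D' :: "('o set, 'n) category" and F' :: "('o, 'm, 'o set, 'n) cfunctor" +
  fixes G :: "('o set, 'n, 'o set, 'n) cfunctor"
  assumes G_initial: "A' \<in> P' \<Longrightarrow> initial A' (FObj G A')"
    and G_arr: "\<lbrakk>X \<in> P'; Y \<in> P'; x \<in> FObj G X; y \<in> FObj G Y; h \<in> hom C x y\<rbrakk> \<Longrightarrow>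
      FArr G (FArr F' h) = FArr F h"
begin

lemma G_block: "A' \<in> P' \<Longrightarrow> FObj G A' \<in> P \<and> FObj G A' \<subseteq> A'"
  using G_initial by (auto simp: initial_def)

text \<open>After lifting to the prescribed end, initiality provides an arrow of \<open>S'\<close>
  from the initial pixel to the start; precomposing with it leaves the image under \<open>F'\<close>
  unchanged.\<close>

lemma init_lift:
  assumes "d \<in> hom D' X Y" "y \<in> FObj G Y"
  obtains h x where "X \<in> P'" "Y \<in> P'" "x \<in> FObj G X" "h \<in> hom C x y" "FArr F' h = d"
proof -
  have "Y \<in> P'" using coarse.D.hom_obj[OF assms(1)] coarse.obj_D by simp
  then have "y \<in> Y" using G_block assms(2) by blast
  then obtain f x' where f: "f \<in> hom C x' y" "X \<in> P'" "x' \<in> X" "FArr F' f = d"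
    using coarse.lift_end[OF assms(1)] by metis
  obtain x s where "x \<in> FObj G X" "s \<in> S'" "s \<in> hom C x x'"
    using G_initial[OF f(2)] f(3) by (auto simp: initial_def)
  then show ?thesis
    using that[OF f(2) \<open>Y \<in> P'\<close>] coarse.F_pre[OF f(1)] f(4) fine.comp_hom[OF _ f(1)] by metis
qed

lemma G_nonempty: "A' \<in> P' \<Longrightarrow> \<exists>x. x \<in> FObj G A'"
  using G_block fine.block_nonempty by blast

lemma G_obj_inj: "X \<in> P' \<Longrightarrow> Y \<in> P' \<Longrightarrow> FObj G X = FObj G Y \<Longrightarrow> X = Y"
  using G_block G_nonempty coarse.blk_eq by (metis subsetD)

lemma G_hom: "d \<in> hom D' X Y \<Longrightarrow> FArr G d \<in> hom D (FObj G X) (FObj G Y)"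
proof -
  assume d: "d \<in> hom D' X Y"
  then have Y: "Y \<in> P'" using coarse.D.hom_obj coarse.obj_D by blast
  obtain y where y: "y \<in> FObj G Y" using G_nonempty[OF Y] by blast
  obtain h x where h: "X \<in> P'" "x \<in> FObj G X" "h \<in> hom C x y" "FArr F' h = d"
    using init_lift[OF d y] by metis
  show ?thesis
    using G_arr[OF h(1) Y h(2) y h(3)] fine.F_hom[OF h(3) _ h(2) _ y] G_block[OF Y] G_block[OF h(1)] h(4) by simp
qed

lemma G_functor: "is_functor D' D G"
proof (rule is_functorI)
  show "is_category D'" "is_category D" by unfold_locales
next
  fix X assume "X \<in> Obj D'"
  then have X: "X \<in> P'" using coarse.obj_D by simp
  show "FObj G X \<in> Obj D" using G_block[OF X] fine.obj_D by simp
  obtain x where x: "x \<in> FObj G X" using G_nonempty[OF X] by blast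
  have GX: "FObj G X \<in> P" "x \<in> X" "x \<in> Obj C" using G_block[OF X] x fine.block_obj by blast+
  have id: "Ident C x \<in> hom C x x" "Ident C x \<in> S" "Ident C x \<in> S'"
    using fine.ident_hom fine.S_ident coarse.S_ident GX(3) by auto
  show "FArr G (Ident D' X) = Ident D (FObj G X)"
    using G_arr[OF X X x x id(1)] fine.F_S[OF GX(1) x id(2,1)] coarse.F_S[OF X GX(2) id(3,1)] by simp
next
  fix X Y d assume "d \<in> hom D' X Y"
  then show "FArr G d \<in> hom D (FObj G X) (FObj G Y)" by (rule G_hom)
next
  fix X Y Z d e assume d: "d \<in> hom D' X Y" and e: "e \<in> hom D' Y Z"
  then have Z: "Z \<in> P'" using coarse.D.hom_obj coarse.obj_D by blast
  obtain z where z: "z \<in> FObj G Z" using G_nonempty[OF Z] by blast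
  obtain k y where k: "Y \<in> P'" "y \<in> FObj G Y" "k \<in> hom C y z" "FArr F' k = e"
    using init_lift[OF e z] by metis
  obtain h x where h: "X \<in> P'" "x \<in> FObj G X" "h \<in> hom C x y" "FArr F' h = d"
    using init_lift[OF d k(2)] by metis
  have "FArr G (Comp D' e d) = FArr F (Comp C k h)"
    using G_arr[OF h(1) Z h(2) z fine.comp_hom[OF h(3) k(3)]] functor_comp[OF coarse.F_functor h(3) k(3)] h k by simp
  also have "\<dots> = Comp D (FArr G e) (FArr G d)"
    using functor_comp[OF fine.F_functor h(3) k(3)] G_arr[OF h(1) k(1) h(2) k(2) h(3)]
      G_arr[OF k(1) Z k(2) z k(3)] h k by simp
  finally show "FArr G (Comp D' e d) = Comp D (FArr G e) (FArr G d)" .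
qed

lemma G_faithful:
  assumes "d \<in> hom D' X Y" "d' \<in> hom D' X Y" "FArr G d = FArr G d'"
  shows "d = d'"
proof -
  have Y: "Y \<in> P'" using coarse.D.hom_obj[OF assms(1)] coarse.obj_D by blast
  obtain y where y: "y \<in> FObj G Y" using G_nonempty[OF Y] by blast
  obtain h x where h: "X \<in> P'" "x \<in> FObj G X" "h \<in> hom C x y" "FArr F' h = d"
    using init_lift[OF assms(1) y] by metis
  obtain h' x' where h': "x' \<in> FObj G X" "h' \<in> hom C x' y" "FArr F' h' = d'"
    using init_lift[OF assms(2) y] by metis
  have "FArr F h = FArr F h'"
    using G_arr[OF h(1) Y h(2) y h(3)] G_arr[OF h(1) Y h'(1) y h'(2)] h h' assms(3) by simp
  then show ?thesis
    using eq_iff[of "FObj G X" "FObj G Y" x x' y y h h'] G_block[OF Y] G_block[OF h(1)] h h' y by simp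
qed

text \<open>Any arrow of \<open>C\<close> that lifts \<open>e\<close> runs between initial pixels,
  so it is also an admissible lift of its own coarse image.\<close>

lemma G_full:
  assumes "X \<in> P'" "Y \<in> P'" "e \<in> hom D (FObj G X) (FObj G Y)"
  obtains d where "d \<in> hom D' X Y" "FArr G d = e"
proof -
  obtain f x y where f: "f \<in> hom C x y" "x \<in> FObj G X" "y \<in> FObj G Y" "FArr F f = e"
    using fine.lift[OF assms(3)] by metis
  have "FArr F' f \<in> hom D' X Y"
    using coarse.F_hom[OF f(1) assms(1) _ assms(2)] f(2,3) G_block assms by blast
  then show ?thesis using that G_arr[OF assms(1,2) f(2,3,1)] f(4) by blast
qed

end

text \<open>Reduces functoriality of \<open>Init\<close> in the refinement to checking that the
  identity and composites have the two properties of \<open>pixel_init\<close>.\<close>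

lemma pixel_init_unique:
  assumes "pixel_init C S P D F S' P' D' F' G" "pixel_init C S P D F S' P' D' F' G2"
  shows "functor_eq D' G G2"
proof -
  interpret G: pixel_init C S P D F S' P' D' F' G by fact
  interpret G2: pixel_init C S P D F S' P' D' F' G2 by fact
  have obj: "FObj G X = FObj G2 X" if "X \<in> P'" for X
    using G.initial_unique G.G_initial G2.G_initial that by blast
  have "FArr G d = FArr G2 d" if "d \<in> Arr D'" for d
  proof -
    have d: "d \<in> hom D' (Dom D' d) (Cod D' d)" using that by (simp add: hom_def)
    have Y: "Cod D' d \<in> P'" using G.coarse.D.hom_obj[OF d] G.coarse.obj_D by blast
    obtain y where y: "y \<in> FObj G (Cod D' d)" using G.G_nonempty[OF Y] by blast
    obtain h x where h: "Dom D' d \<in> P'" "x \<in> FObj G (Dom D' d)" "h \<in> hom C x y" "FArr F' h = d"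
      using G.init_lift[OF d y] by metis
    show ?thesis
      using G.G_arr[OF h(1) Y h(2) y h(3)] G2.G_arr[OF h(1) Y _ _ h(3)] h y obj Y by simp
  qed
  then show ?thesis using obj G.coarse.obj_D by (simp add: functor_eq_def)
qed

lemma pixel_init_id:
  assumes "pixel_functor C S P D F"
  shows "pixel_init C S P D F S P D F id_functor"
proof -
  interpret pixel_functor C S P D F by fact
  have fin: "{B \<in> P. B \<subseteq> A} = {A}" if "A \<in> P" for A
    using that block_nonempty blk_eq by auto (metis all_not_in_conv subsetD)+
  interpret pixel_refinement C S P D F S P D F
    by unfold_locales (auto simp: fin)
  show ?thesis
  proof
    fix A assume A: "A \<in> P"
    have "\<exists>x\<in>A. \<exists>s\<in>S. s \<in> hom C x y" if "y \<in> A" for y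
      using that S_ident ident_hom block_obj[OF A] by blast
    then show "initial A (FObj id_functor A)" using A by (auto simp: initial_def id_functor_def)
  qed (auto simp: id_functor_def)
qed

text \<open>An initial pixel of an initial pixel is initial, by composing an arrow of the middle
  \<open>S'\<close> with one of the coarse \<open>S''\<close>.\<close>

lemma pixel_init_comp:
  assumes "pixel_init C S P D F S' P' D' F' G" "pixel_init C S' P' D' F' S'' P'' D'' F'' G'"
  shows "pixel_init C S P D F S'' P'' D'' F'' (comp_functor G G')"
proof -
  interpret G: pixel_init C S P D F S' P' D' F' G by fact
  interpret G': pixel_init C S' P' D' F' S'' P'' D'' F'' G' by fact
  interpret pixel_refinement C S P D F S'' P'' D'' F''
  proof
    show "S \<subseteq> S''" using G.S_sub G'.S_sub by blast
    show "\<exists>A'\<in>P''. A \<subseteq> A'" if "A \<in> P" for A using G.refine G'.refine that by (meson order_trans)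
    show "finite {A \<in> P. A \<subseteq> A''}" if A'': "A'' \<in> P''" for A''
    proof (rule finite_subset)
      \<comment> \<open>Every fine pixel of \<open>A''\<close> lies in one of the finitely many
        middle pixels of \<open>A''\<close>, each of which contains finitely many fine ones.\<close>
      show "{A \<in> P. A \<subseteq> A''} \<subseteq> (\<Union>B\<in>{B \<in> P'. B \<subseteq> A''}. {A \<in> P. A \<subseteq> B})"
      proof
        fix A assume A: "A \<in> {A \<in> P. A \<subseteq> A''}"
        then obtain x where x: "x \<in> A" using G.fine.block_nonempty by blast
        obtain B where "B \<in> P'" "A \<subseteq> B" using G.refine A by blast
        then show "A \<in> (\<Union>B\<in>{B \<in> P'. B \<subseteq> A''}. {A \<in> P. A \<subseteq> B})"
          using G'.block_sub[OF A'' _ _, of B x] A x by blast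
      qed
      show "finite (\<Union>B\<in>{B \<in> P'. B \<subseteq> A''}. {A \<in> P. A \<subseteq> B})"
        using G.finite_blocks G'.finite_blocks[OF A''] by auto
    qed
  qed
  show ?thesis
  proof
    fix A assume A: "A \<in> P''"
    have A': "FObj G' A \<in> P'" "FObj G' A \<subseteq> A" using G'.G_block[OF A] by auto
    have "\<exists>x\<in>FObj G (FObj G' A). \<exists>s\<in>S''. s \<in> hom C x y" if y: "y \<in> A" for y
    proof -
      obtain x s where x: "x \<in> FObj G' A" "s \<in> S''" "s \<in> hom C x y"
        using G'.G_initial[OF A] y unfolding G'.initial_def by meson
      obtain z t where z: "z \<in> FObj G (FObj G' A)" "t \<in> S'" "t \<in> hom C z x"
        using G.G_initial[OF A'(1)] x(1) unfolding G.initial_def by meson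
      show ?thesis
        using G'.coarse.S_comp_hom[OF subsetD[OF G'.S_sub z(2)] x(2) z(3) x(3)] z(1) by blast
    qed
    then show "initial A (FObj (comp_functor G G') A)"
      using G.G_block[OF A'(1)] A'(2) by (auto simp: initial_def comp_functor_def)
  next
    fix X Y x y h
    assume *: "X \<in> P''" "Y \<in> P''" "x \<in> FObj (comp_functor G G') X" "y \<in> FObj (comp_functor G G') Y" "h \<in> hom C x y"
    have X: "FObj G' X \<in> P'" "FObj G' Y \<in> P'" using G'.G_block * by auto
    have xy: "x \<in> FObj G (FObj G' X)" "y \<in> FObj G (FObj G' Y)" using * by (auto simp: comp_functor_def)
    then have "x \<in> FObj G' X" "y \<in> FObj G' Y" using G.G_block X by blast+
    then have "FArr G' (FArr F'' h) = FArr F' h" using G'.G_arr * by blast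
    then show "FArr (comp_functor G G') (FArr F'' h) = FArr F h"
      using G.G_arr[OF X xy *(5)] by (simp add: comp_functor_def)
  qed
qed

section \<open>The equalizer\<close>

text \<open>The screens \<open>Pm j k\<close> stand for the pairwise meets; here they need only be
  common finitary refinements. The pixel \<open>B\<close> is built around an arbitrary point of one
  of the \<open>A i\<close>.\<close>

lemma compatible_pixels_initial:
  fixes I :: "'i set"
  assumes I: "I \<noteq> {}"
    and G: "\<And>i. i \<in> I \<Longrightarrow> pixel_init C (Sf i) (Pf i) (Df i) (Ff i) S P D F (G i)"
    and GL: "\<And>j k. j \<in> I \<Longrightarrow> k \<in> I \<Longrightarrow>
      pixel_init C (Sm j k) (Pm j k) (Dm j k) (Fm j k) (Sf j) (Pf j) (Df j) (Ff j) (GL j k)"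
    and GR: "\<And>j k. j \<in> I \<Longrightarrow> k \<in> I \<Longrightarrow>
      pixel_init C (Sm j k) (Pm j k) (Dm j k) (Fm j k) (Sf k) (Pf k) (Df k) (Ff k) (GR j k)"
    and P: "P = join (Obj C) I Pf"
    and A: "\<And>i. i \<in> I \<Longrightarrow> A i \<in> Pf i"
    and eq: "\<And>j k. j \<in> I \<Longrightarrow> k \<in> I \<Longrightarrow> FObj (GL j k) (A j) = FObj (GR j k) (A k)"
  obtains B where "B \<in> P" "\<And>i. i \<in> I \<Longrightarrow> A i = FObj (G i) B"
proof -
  let ?R = "\<Union>i\<in>I. \<Union>A\<in>Pf i. A \<times> A"
  \<comment> \<open>By compatibility the pixel that is initial in \<open>A j\<close> also lies in
    \<open>A k\<close>, so \<open>A k\<close> contains starting points for all of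
    \<open>A j\<close>.\<close>
  have into: "\<exists>x\<in>A k. \<exists>s\<in>S. s \<in> hom C x y" if "j \<in> I" "k \<in> I" "y \<in> A j" for j k y
  proof -
    interpret G: pixel_init C "Sf j" "Pf j" "Df j" "Ff j" S P D F "G j" using G that by blast
    interpret L: pixel_init C "Sm j k" "Pm j k" "Dm j k" "Fm j k" "Sf j" "Pf j" "Df j" "Ff j" "GL j k"
      using GL that by blast
    interpret R: pixel_init C "Sm j k" "Pm j k" "Dm j k" "Fm j k" "Sf k" "Pf k" "Df k" "Ff k" "GR j k"
      using GR that by blast
    show ?thesis
      using L.G_initial[OF A[OF that(1)]] R.G_block[OF A[OF that(2)]] eq[OF that(1,2)] that(3) G.S_sub
      unfolding L.initial_def by (metis subsetD)
  qed
  obtain i0 where i0: "i0 \<in> I" using I by blast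
  interpret G0: pixel_init C "Sf i0" "Pf i0" "Df i0" "Ff i0" S P D F "G i0" using G i0 by blast
  obtain b where b: "b \<in> A i0" using G0.fine.block_nonempty[OF A[OF i0]] by blast
  let ?B = "?R\<^sup>* `` {b}"
  have bo: "b \<in> Obj C" using G0.fine.block_obj[OF A[OF i0] b] .
  have B: "?B \<in> P" unfolding P join_def by (rule quotientI) (rule bo)
  have bB: "b \<in> ?B" by blast
  \<comment> \<open>Induction along the chain that generates the join. A link inside a pixel of
    \<open>Pf j\<close> is followed with \<open>initial_spread\<close> from \<open>A j\<close>;
    \<open>into\<close> then transfers the result to every other index.\<close>
  have reach: "\<forall>i\<in>I. \<exists>x\<in>A i. \<exists>s\<in>S. s \<in> hom C x y" if "(b, y) \<in> ?R\<^sup>*" for y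
    using that
  proof induction
    case base
    then show ?case using into[OF i0 _ b] by blast
  next
    case (step y z)
    then obtain j A' where j: "j \<in> I" "A' \<in> Pf j" "y \<in> A'" "z \<in> A'" by blast
    interpret G: pixel_init C "Sf j" "Pf j" "Df j" "Ff j" S P D F "G j" using G j by blast
    obtain x s where x: "x \<in> A j" "s \<in> S" "s \<in> hom C x y" using step.IH j(1) by blast
    obtain x' s' where x': "x' \<in> A j" "s' \<in> S" "s' \<in> hom C x' z"
      using G.initial_spread[OF A[OF j(1)] j(2) x(1) j(3,4) x(2,3)] by blast
    show ?case
    proof
      fix i assume "i \<in> I"
      then obtain w t where "w \<in> A i" "t \<in> S" "t \<in> hom C w x'" using into[OF j(1) _ x'(1)] by blast
      then show "\<exists>x\<in>A i. \<exists>s\<in>S. s \<in> hom C x z" using G0.coarse.S_comp_hom x' by meson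
    qed
  qed
  have "A i = FObj (G i) ?B" if i: "i \<in> I" for i
  proof -
    interpret G: pixel_init C "Sf i" "Pf i" "Df i" "Ff i" S P D F "G i" using G i by blast
    obtain x s where x: "x \<in> A i" "s \<in> S" "s \<in> hom C x b" using into[OF i0 i b] by blast
    \<comment> \<open>An arrow of \<open>S\<close> does not leave its coarse pixel, so
      \<open>A i\<close> meets \<open>?B\<close> and is contained in it.\<close>
    have "x \<in> ?B" using G0.coarse.S_hom_block[OF x(2,3) B] bB by simp
    then have "A i \<subseteq> ?B" using G.block_sub[OF B A[OF i] x(1)] by simp
    moreover have "\<forall>y\<in>?B. \<exists>x\<in>A i. \<exists>s\<in>S. s \<in> hom C x y" using reach i by blast
    ultimately have "G.initial ?B (A i)" using A[OF i] unfolding G.initial_def by blast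
    then show ?thesis using G.initial_unique[OF B] G.G_initial[OF B] by blast
  qed
  then show ?thesis using that B by blast
qed

section \<open>Products of path categories\<close>

definition coord :: "'i \<Rightarrow> ('i \<Rightarrow> 'x) pth \<Rightarrow> 'x pth" where
  "coord i \<gamma> = (\<lambda>t\<in>{0..1}. \<gamma> t i)"

text \<open>All paths run over the same interval, so a family of paths is a path of families, and
  the product of path categories is again one with everything taken coordinatewise.\<close>

definition prod_triple :: "'i set \<Rightarrow> ('i \<Rightarrow> 'x path_structure) \<Rightarrow> ('i \<Rightarrow> 'x) path_structure" where
  "prod_triple I T = (let
     \<Gamma> = {\<gamma> \<in> all_paths (\<Pi>\<^sub>E i\<in>I. Points (T i)). \<forall>i\<in>I. coord i \<gamma> \<in> Paths (T i)} in
   \<lparr>Points = (\<Pi>\<^sub>E i\<in>I. Points (T i)), Paths = \<Gamma>,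
    Equiv = {(\<gamma>, \<gamma>'). \<gamma> \<in> \<Gamma> \<and> \<gamma>' \<in> \<Gamma> \<and> (\<forall>i\<in>I. (coord i \<gamma>, coord i \<gamma>') \<in> Equiv (T i))}\<rparr>)"

lemma coord_ends [simp]: "coord i \<gamma> 0 = \<gamma> 0 i" "coord i \<gamma> 1 = \<gamma> 1 i"
  by (auto simp: coord_def)

lemma coord_concat: "coord i (\<gamma> \<cdot> \<gamma>') = coord i \<gamma> \<cdot> coord i \<gamma>'"
  by (auto simp: coord_def concat_path_def fun_eq_iff restrict_def)

lemma coord_const: "coord i (const_path x) = const_path (x i)"
  by (auto simp: coord_def const_path_def fun_eq_iff restrict_def)

text \<open>The hypothesis keeps \<open>\<phi>\<close> inside the unit interval; outside of it
  \<open>coord\<close> is \<open>undefined\<close> rather than a coordinate of the path.\<close>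

lemma coord_reparam: "reparametrization \<phi> \<Longrightarrow> coord i (reparam \<gamma> \<phi>) = reparam (coord i \<gamma>) \<phi>"
  by (auto simp: coord_def reparam_def reparametrization_def fun_eq_iff restrict_def image_subset_iff)

lemma concat_all_paths:
  assumes "\<gamma> \<in> all_paths X" "\<gamma>' \<in> all_paths X" shows "\<gamma> \<cdot> \<gamma>' \<in> all_paths X"
proof -
  have *: "\<gamma> t \<in> X" "\<gamma>' t \<in> X" if "t \<in> {0..1}" for t using assms that by (auto simp: all_paths_def)
  show ?thesis
    unfolding all_paths_def
  proof (rule PiE_I)
    show "(\<gamma> \<cdot> \<gamma>') t \<in> X" if "t \<in> {0..1}" for t
      using that *(1)[of "2 * t"] *(2)[of "2 * t - 1"] by (auto simp: concat_path_def)
    show "(\<gamma> \<cdot> \<gamma>') t = undefined" if "t \<notin> {0..1}" for t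
      using that by (auto simp: concat_path_def)
  qed
qed

lemma reparam_all_paths:
  assumes "\<gamma> \<in> all_paths X" "reparametrization \<phi>" shows "reparam \<gamma> \<phi> \<in> all_paths X"
proof -
  have "\<gamma> (\<phi> t) \<in> X" if "t \<in> {0..1}" for t
  proof (rule PiE_mem[OF assms(1)[unfolded all_paths_def]])
    show "\<phi> t \<in> {0..1}" using assms(2) that by (simp add: reparametrization_def image_subset_iff)
  qed
  then show ?thesis unfolding all_paths_def by (intro PiE_I) (auto simp: reparam_def)
qed

lemma const_all_paths: "x \<in> X \<Longrightarrow> const_path x \<in> all_paths X"
  by (auto simp: all_paths_def const_path_def)

lemma prod_triple_triple:
  assumes T: "\<And>i. i \<in> I \<Longrightarrow> triple (T i)"
  shows "triple (prod_triple I T)"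
proof -
  let ?T = "prod_triple I T"
  have pts: "Points ?T = (\<Pi>\<^sub>E i\<in>I. Points (T i))" by (simp add: prod_triple_def Let_def)
  have pth: "\<gamma> \<in> Paths ?T \<longleftrightarrow> \<gamma> \<in> all_paths (Points ?T) \<and> (\<forall>i\<in>I. coord i \<gamma> \<in> Paths (T i))" for \<gamma>
    by (simp add: prod_triple_def Let_def)
  have eqv: "(\<gamma>, \<gamma>') \<in> Equiv ?T \<longleftrightarrow> \<gamma> \<in> Paths ?T \<and> \<gamma>' \<in> Paths ?T \<and>
      (\<forall>i\<in>I. (coord i \<gamma>, coord i \<gamma>') \<in> Equiv (T i))" for \<gamma> \<gamma>'
    by (simp add: prod_triple_def Let_def)
  have val: "\<gamma> t \<in> Points ?T" if "\<gamma> \<in> Paths ?T" "t \<in> {0..1}" for \<gamma> t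
    using that by (auto simp: pth all_paths_def)
  have pt_eq: "x = y" if "x \<in> Points ?T" "y \<in> Points ?T" "\<And>i. i \<in> I \<Longrightarrow> x i = y i" for x y
    using that unfolding pts by (metis PiE_ext)
  show ?thesis
  proof
    show "Points ?T \<noteq> {}"
      unfolding pts PiE_eq_empty_iff using triple.points_nonempty[OF T] by blast
    show "Paths ?T \<subseteq> all_paths (Points ?T)" using pth by blast
    show "equiv (Paths ?T) (Equiv ?T)"
    proof (rule equivI)
      show "Equiv ?T \<subseteq> Paths ?T \<times> Paths ?T" using eqv by auto
      show "refl_on (Paths ?T) (Equiv ?T)"
        using eqv pth triple.equiv_refl[OF T] by (auto simp: refl_on_def)
      show "sym (Equiv ?T)" using eqv triple.equiv_sym[OF T] by (auto simp: sym_def)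
      show "trans (Equiv ?T)"
        by (rule transI) (auto simp: eqv intro: triple.equiv_trans[OF T])
    qed
  next
    fix \<gamma> \<gamma>' assume e: "(\<gamma>, \<gamma>') \<in> Equiv ?T"
    then have "\<gamma> 0 i = \<gamma>' 0 i \<and> \<gamma> 1 i = \<gamma>' 1 i" if "i \<in> I" for i
      using triple.equiv_endpoints[OF T[OF that], of "coord i \<gamma>" "coord i \<gamma>'"] that by (auto simp: eqv)
    then show "\<gamma> 0 = \<gamma>' 0 \<and> \<gamma> 1 = \<gamma>' 1"
      using e val pt_eq[of "\<gamma> 0" "\<gamma>' 0"] pt_eq[of "\<gamma> 1" "\<gamma>' 1"] by (auto simp: eqv)
  next
    fix \<gamma> \<gamma>' assume "\<gamma> \<in> Paths ?T" "\<gamma>' \<in> Paths ?T" "\<gamma> 1 = \<gamma>' 0"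
    then show "\<gamma> \<cdot> \<gamma>' \<in> Paths ?T"
      using triple.concat[OF T] concat_all_paths by (auto simp: pth coord_concat)
  next
    fix \<gamma> \<phi> assume "\<gamma> \<in> Paths ?T" "reparametrization \<phi>"
    then show "reparam \<gamma> \<phi> \<in> Paths ?T"
      using triple.reparam[OF T] reparam_all_paths by (auto simp: pth coord_reparam)
  next
    fix x assume "x \<in> Points ?T"
    then show "const_path x \<in> Paths ?T"
      using triple.const[OF T] const_all_paths by (auto simp: pth coord_const pts)
  next
    fix x \<gamma> assume x: "x \<in> Points ?T" and e: "(\<gamma>, const_path x) \<in> Equiv ?T"
    have c: "\<gamma> t = \<gamma> 0" if t: "t \<in> {0..1}" for t
    proof (rule pt_eq)
      show "\<gamma> t \<in> Points ?T" "\<gamma> 0 \<in> Points ?T" using val e t by (auto simp: eqv)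
      fix i assume i: "i \<in> I"
      obtain y where "coord i \<gamma> = const_path y"
        using triple.equiv_const[OF T[OF i], of "x i" "coord i \<gamma>"] x e i by (auto simp: eqv coord_const pts)
      then have "coord i \<gamma> t = y" "coord i \<gamma> 0 = y" using t by (auto simp: const_path_def)
      then show "\<gamma> t i = \<gamma> 0 i" using t by (auto simp: coord_def)
    qed
    have extn: "\<gamma> \<in> extensional {0..1}" using e by (auto simp: eqv pth all_paths_def PiE_def)
    have "\<gamma> t = const_path (\<gamma> 0) t" for t
      using c[of t] extn by (cases "t \<in> {0..1}") (auto simp: const_path_def extensional_def)
    then show "\<exists>y. \<gamma> = const_path y" by (intro exI[of _ "\<gamma> 0"]) (rule ext)
  next
    fix \<gamma> \<phi> assume "\<gamma> \<in> Paths ?T" "reparametrization \<phi>" "\<phi> 0 = 0" "\<phi> 1 = 1"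
    then show "(\<gamma>, reparam \<gamma> \<phi>) \<in> Equiv ?T"
      using triple.equiv_reparam[OF T] triple.reparam[OF T] reparam_all_paths by (auto simp: eqv pth coord_reparam)
  next
    fix \<gamma> \<gamma>' \<rho> \<rho>' assume p: "\<gamma> \<in> Paths ?T" "\<gamma>' \<in> Paths ?T" "\<rho> \<in> Paths ?T" "\<rho>' \<in> Paths ?T"
      "\<rho> 1 = \<gamma> 0" "\<gamma> 1 = \<rho>' 0" "\<rho> 1 = \<gamma>' 0" "\<gamma>' 1 = \<rho>' 0"
      "\<rho> \<cdot> \<gamma> \<cdot> \<rho>' \<in> Paths ?T" "\<rho> \<cdot> \<gamma>' \<cdot> \<rho>' \<in> Paths ?T"
    have "(coord i \<gamma>, coord i \<gamma>') \<in> Equiv (T i) \<longleftrightarrow>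
        (coord i (\<rho> \<cdot> \<gamma> \<cdot> \<rho>'), coord i (\<rho> \<cdot> \<gamma>' \<cdot> \<rho>')) \<in> Equiv (T i)" if i: "i \<in> I" for i
      unfolding coord_concat
      by (rule triple.equiv_cancel[OF T[OF i]])
        (use p i in \<open>auto simp: pth coord_concat[symmetric] simp del: concat_ends\<close>)
    then show "(\<gamma>, \<gamma>') \<in> Equiv ?T \<longleftrightarrow> (\<rho> \<cdot> \<gamma> \<cdot> \<rho>', \<rho> \<cdot> \<gamma>' \<cdot> \<rho>') \<in> Equiv ?T"
      using p by (simp add: eqv)
  qed
qed

lemma in_PCat_prod:
  fixes C :: "'i \<Rightarrow> ('o, 'm) category"
  assumes "\<And>i. i \<in> I \<Longrightarrow> in_PCat (C i)"
  shows "in_PCat (prod_cat I C)"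
proof -
  have "\<exists>(T :: 'o path_structure) F. triple T \<and> is_functor (C i) (path_cat T) F \<and>
      bij_betw (FObj F) (Obj (C i)) (Obj (path_cat T)) \<and> bij_betw (FArr F) (Arr (C i)) (Arr (path_cat T))"
    if "i \<in> I" for i
    using assms[OF that] unfolding in_PCat_def isomorphic_def by blast
  then obtain T :: "'i \<Rightarrow> 'o path_structure" and F where
    T: "\<And>i. i \<in> I \<Longrightarrow> triple (T i)" and F: "\<And>i. i \<in> I \<Longrightarrow> is_functor (C i) (path_cat (T i)) (F i)" and
    bij: "\<And>i. i \<in> I \<Longrightarrow> bij_betw (FObj (F i)) (Obj (C i)) (Obj (path_cat (T i)))"
      "\<And>i. i \<in> I \<Longrightarrow> bij_betw (FArr (F i)) (Arr (C i)) (Arr (path_cat (T i)))"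
    by metis
  let ?T = "prod_triple I T"
  let ?A = "prod_cat I C"
  interpret T: triple ?T using prod_triple_triple T by blast
  have pts: "Points ?T = (\<Pi>\<^sub>E i\<in>I. Points (T i))" by (simp add: prod_triple_def Let_def)
  have pth: "\<gamma> \<in> Paths ?T \<longleftrightarrow> \<gamma> \<in> all_paths (Points ?T) \<and> (\<forall>i\<in>I. coord i \<gamma> \<in> Paths (T i))" for \<gamma>
    by (simp add: prod_triple_def Let_def)
  have eqv: "(\<gamma>, \<gamma>') \<in> Equiv ?T \<longleftrightarrow> \<gamma> \<in> Paths ?T \<and> \<gamma>' \<in> Paths ?T \<and>
      (\<forall>i\<in>I. (coord i \<gamma>, coord i \<gamma>') \<in> Equiv (T i))" for \<gamma> \<gamma>'
    by (simp add: prod_triple_def Let_def)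
  \<comment> \<open>A family of classes is sent to the set of all paths whose coordinates lie in
    them, which avoids choosing representatives; \<open>cls\<close> shows that this set is one class
    as soon as a representative exists.\<close>
  define \<Theta> where "\<Theta> = \<lparr>FObj = (\<lambda>x. \<lambda>i\<in>I. FObj (F i) (x i)),
    FArr = (\<lambda>f. {\<gamma> \<in> Paths ?T. \<forall>i\<in>I. coord i \<gamma> \<in> FArr (F i) (f i)})\<rparr>"
  have A: "is_category ?A" using F by (intro prod_category) (simp add: is_functor_def)
  have cls: "FArr \<Theta> f = path_class ?T \<gamma>"
    if "\<gamma> \<in> Paths ?T" "\<And>i. i \<in> I \<Longrightarrow> FArr (F i) (f i) = path_class (T i) (coord i \<gamma>)" for f \<gamma>
    using that by (auto simp: \<Theta>_def path_class_def eqv)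
  have rep: "\<exists>\<gamma>. \<gamma> \<in> Paths ?T \<and> (\<forall>i\<in>I. FArr (F i) (f i) = path_class (T i) (coord i \<gamma>)) \<and>
      \<gamma> 0 = FObj \<Theta> x \<and> \<gamma> 1 = FObj \<Theta> y" if f: "f \<in> hom ?A x y" for f x y
  proof -
    have "\<exists>\<gamma>. \<gamma> \<in> Paths (T i) \<and> FArr (F i) (f i) = path_class (T i) \<gamma> \<and>
        \<gamma> 0 = FObj (F i) (x i) \<and> \<gamma> 1 = FObj (F i) (y i)" if i: "i \<in> I" for i
    proof -
      have "f i \<in> hom (C i) (x i) (y i)" using f i by (auto simp: prod_cat_hom)
      from functor_hom[OF F[OF i] this] show ?thesis by (rule triple.path_arr[OF T[OF i]]) blast
    qed
    then obtain g where g: "\<And>i. i \<in> I \<Longrightarrow> g i \<in> Paths (T i) \<and> FArr (F i) (f i) = path_class (T i) (g i) \<and>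
        g i 0 = FObj (F i) (x i) \<and> g i 1 = FObj (F i) (y i)" by metis
    \<comment> \<open>Representatives chosen in each coordinate, reassembled into one path of the
      product.\<close>
    let ?\<gamma> = "\<lambda>t\<in>{0..1}. \<lambda>i\<in>I. g i t"
    have co: "coord i ?\<gamma> = g i" if i: "i \<in> I" for i
      using triple.path_ext[OF T[OF i], of "g i"] g[OF i] i by (auto simp: coord_def fun_eq_iff restrict_def)
    have "g i t \<in> Points (T i)" if "i \<in> I" "t \<in> {0..1}" for i t
      using triple.path_im[OF T[OF that(1)], of "g i"] g[OF that(1)] that(2) by (auto simp: im_def)
    then have "?\<gamma> \<in> Paths ?T" using g by (auto simp: pth co all_paths_def pts)
    moreover have "?\<gamma> 0 = FObj \<Theta> x" "?\<gamma> 1 = FObj \<Theta> y" using g by (auto simp: \<Theta>_def fun_eq_iff restrict_def)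
    ultimately show ?thesis using g co by (intro exI[of _ ?\<gamma>]) auto
  qed
  have func: "is_functor ?A (path_cat ?T) \<Theta>"
  proof (rule is_functorI[OF A T.path_category])
    fix x assume "x \<in> Obj ?A"
    then have x: "\<And>i. i \<in> I \<Longrightarrow> x i \<in> Obj (C i)" by (auto simp: prod_cat_def)
    have o: "FObj (F i) (x i) \<in> Points (T i)" if "i \<in> I" for i
      using functor_obj[OF F[OF that] x[OF that]] triple.path_cat_simps(1)[OF T[OF that]] by simp
    then show obj: "FObj \<Theta> x \<in> Obj (path_cat ?T)" by (auto simp: \<Theta>_def pts)
    have "FArr \<Theta> (Ident ?A x) = path_class ?T (const_path (FObj \<Theta> x))"
    proof (rule cls)
      show "const_path (FObj \<Theta> x) \<in> Paths ?T" using T.const obj by simp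
      show "FArr (F i) (Ident ?A x i) = path_class (T i) (coord i (const_path (FObj \<Theta> x)))" if "i \<in> I" for i
        using functor_ident[OF F[OF that] x[OF that]] triple.path_cat_simps(2)[OF T[OF that]] that
        by (simp add: coord_const \<Theta>_def prod_cat_def)
    qed
    then show "FArr \<Theta> (Ident ?A x) = Ident (path_cat ?T) (FObj \<Theta> x)" by simp
  next
    fix x y f assume f: "f \<in> hom ?A x y"
    obtain \<gamma> where "\<gamma> \<in> Paths ?T" "\<forall>i\<in>I. FArr (F i) (f i) = path_class (T i) (coord i \<gamma>)"
      "\<gamma> 0 = FObj \<Theta> x" "\<gamma> 1 = FObj \<Theta> y" using rep[OF f] by blast
    then show "FArr \<Theta> f \<in> hom (path_cat ?T) (FObj \<Theta> x) (FObj \<Theta> y)"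
      using cls[of \<gamma> f] T.path_class_hom[of \<gamma>] by simp
  next
    fix x y z f g assume f: "f \<in> hom ?A x y" and g: "g \<in> hom ?A y z"
    obtain \<gamma> where \<gamma>: "\<gamma> \<in> Paths ?T" "\<forall>i\<in>I. FArr (F i) (f i) = path_class (T i) (coord i \<gamma>)"
      "\<gamma> 1 = FObj \<Theta> y" using rep[OF f] by blast
    obtain \<delta> where \<delta>: "\<delta> \<in> Paths ?T" "\<forall>i\<in>I. FArr (F i) (g i) = path_class (T i) (coord i \<delta>)"
      "\<delta> 0 = FObj \<Theta> y" using rep[OF g] by blast
    have "FArr \<Theta> (Comp ?A g f) = path_class ?T (\<gamma> \<cdot> \<delta>)"
    proof (rule cls)
      show "\<gamma> \<cdot> \<delta> \<in> Paths ?T" using T.concat \<gamma> \<delta> by simp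
      fix i assume i: "i \<in> I"
      have "f i \<in> hom (C i) (x i) (y i)" "g i \<in> hom (C i) (y i) (z i)" using f g i by (auto simp: prod_cat_hom)
      then have "FArr (F i) (Comp ?A g f i) = Comp (path_cat (T i)) (FArr (F i) (g i)) (FArr (F i) (f i))"
        using functor_comp[OF F[OF i]] i by (simp add: prod_cat_def)
      then show "FArr (F i) (Comp ?A g f i) = path_class (T i) (coord i (\<gamma> \<cdot> \<delta>))"
        using triple.path_comp[OF T[OF i], of "coord i \<gamma>" "coord i \<delta>"] \<gamma> \<delta> i
        by (simp add: coord_concat pth)
    qed
    then show "FArr \<Theta> (Comp ?A g f) = Comp (path_cat ?T) (FArr \<Theta> g) (FArr \<Theta> f)"
      using T.path_comp[of \<gamma> \<delta>] cls[of \<gamma> f] cls[of \<delta> g] \<gamma> \<delta> by simp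
  qed
  have arr_rep: "\<exists>\<gamma>. \<gamma> \<in> Paths ?T \<and> (\<forall>i\<in>I. FArr (F i) (f i) = path_class (T i) (coord i \<gamma>))"
    if "f \<in> Arr ?A" for f using rep[OF arr_hom[OF that]] by blast
  have "bij_betw (FObj \<Theta>) (Obj ?A) (Obj (path_cat ?T))"
    unfolding bij_betw_def
  proof
    show "inj_on (FObj \<Theta>) (Obj ?A)"
    proof (rule inj_onI)
      fix x y assume xy: "x \<in> Obj ?A" "y \<in> Obj ?A" "FObj \<Theta> x = FObj \<Theta> y"
      show "x = y"
      proof (rule PiE_ext)
        show "x \<in> (\<Pi>\<^sub>E i\<in>I. Obj (C i))" "y \<in> (\<Pi>\<^sub>E i\<in>I. Obj (C i))" using xy by (auto simp: prod_cat_def)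
        fix i assume i: "i \<in> I"
        then have "FObj (F i) (x i) = FObj (F i) (y i)"
          using fun_cong[OF xy(3), of i] by (simp add: \<Theta>_def)
        then show "x i = y i"
          using inj_onD[OF bij_betw_imp_inj_on[OF bij(1)[OF i]]] xy i by (auto simp: prod_cat_def)
      qed
    qed
    show "FObj \<Theta> ` Obj ?A = Obj (path_cat ?T)"
    proof (intro equalityI subsetI)
      fix z assume "z \<in> FObj \<Theta> ` Obj ?A"
      then show "z \<in> Obj (path_cat ?T)" using functor_obj[OF func] by blast
    next
      fix z assume "z \<in> Obj (path_cat ?T)"
      then have z: "z \<in> (\<Pi>\<^sub>E i\<in>I. Points (T i))" by (simp add: pts)
      let ?x = "\<lambda>i\<in>I. inv_into (Obj (C i)) (FObj (F i)) (z i)"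
      have "z i \<in> FObj (F i) ` Obj (C i)" if i: "i \<in> I" for i
        using bij_betw_imp_surj_on[OF bij(1)[OF i]] z i triple.path_cat_simps(1)[OF T[OF i]] by auto
      then have x: "?x \<in> Obj ?A" "\<And>i. i \<in> I \<Longrightarrow> FObj (F i) (?x i) = z i"
        by (auto simp: prod_cat_def inv_into_into f_inv_into_f)
      then have z_eq: "FObj \<Theta> ?x = z" using z by (auto simp: \<Theta>_def fun_eq_iff restrict_def PiE_def extensional_def)
      show "z \<in> FObj \<Theta> ` Obj ?A" using imageI[OF x(1), of "FObj \<Theta>"] by (simp only: z_eq)
    qed
  qed
  moreover have "bij_betw (FArr \<Theta>) (Arr ?A) (Arr (path_cat ?T))"
    unfolding bij_betw_def
  proof
    show "inj_on (FArr \<Theta>) (Arr ?A)"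
    proof (rule inj_onI)
      fix f g assume fg: "f \<in> Arr ?A" "g \<in> Arr ?A" "FArr \<Theta> f = FArr \<Theta> g"
      obtain \<gamma> where \<gamma>: "\<gamma> \<in> Paths ?T" "\<forall>i\<in>I. FArr (F i) (f i) = path_class (T i) (coord i \<gamma>)"
        using arr_rep[OF fg(1)] by blast
      obtain \<delta> where \<delta>: "\<delta> \<in> Paths ?T" "\<forall>i\<in>I. FArr (F i) (g i) = path_class (T i) (coord i \<delta>)"
        using arr_rep[OF fg(2)] by blast
      have "path_class ?T \<gamma> = path_class ?T \<delta>" using cls[of \<gamma> f] cls[of \<delta> g] fg(3) \<gamma> \<delta> by simp
      then have "(\<gamma>, \<delta>) \<in> Equiv ?T" using T.path_class_eq_iff[OF \<gamma>(1) \<delta>(1)] by blast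
      then have eq: "FArr (F i) (f i) = FArr (F i) (g i)" if "i \<in> I" for i
        using triple.path_class_eq_iff[OF T[OF that]] \<gamma> \<delta> that by (auto simp: eqv pth)
      show "f = g"
      proof (rule PiE_ext)
        show "f \<in> (\<Pi>\<^sub>E i\<in>I. Arr (C i))" "g \<in> (\<Pi>\<^sub>E i\<in>I. Arr (C i))" using fg by (auto simp: prod_cat_def)
        fix i assume i: "i \<in> I"
        then show "f i = g i"
          using inj_onD[OF bij_betw_imp_inj_on[OF bij(2)[OF i]] eq[OF i]] fg i by (auto simp: prod_cat_def)
      qed
    qed
    show "FArr \<Theta> ` Arr ?A = Arr (path_cat ?T)"
    proof (intro equalityI subsetI)
      fix c assume "c \<in> FArr \<Theta> ` Arr ?A"
      then show "c \<in> Arr (path_cat ?T)" using functor_hom[OF func arr_hom] by (auto simp: hom_def)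
    next
      fix c assume "c \<in> Arr (path_cat ?T)"
      then obtain \<gamma> where \<gamma>: "\<gamma> \<in> Paths ?T" "c = path_class ?T \<gamma>" by (auto simp: path_cat_def)
      let ?f = "\<lambda>i\<in>I. inv_into (Arr (C i)) (FArr (F i)) (path_class (T i) (coord i \<gamma>))"
      have "path_class (T i) (coord i \<gamma>) \<in> FArr (F i) ` Arr (C i)" if i: "i \<in> I" for i
        using bij_betw_imp_surj_on[OF bij(2)[OF i]] \<gamma>(1) i by (auto simp: path_cat_def pth)
      then have f: "?f \<in> Arr ?A" "\<And>i. i \<in> I \<Longrightarrow> FArr (F i) (?f i) = path_class (T i) (coord i \<gamma>)"
        by (auto simp: prod_cat_def inv_into_into f_inv_into_f)
      then have c_eq: "FArr \<Theta> ?f = c" using cls[OF \<gamma>(1), of ?f] \<gamma>(2) by blast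
      show "c \<in> FArr \<Theta> ` Arr ?A" using imageI[OF f(1), of "FArr \<Theta>"] by (simp only: c_eq)
    qed
  qed
  ultimately show ?thesis
    unfolding in_PCat_def isomorphic_def using func T.triple_axioms by blast
qed

section \<open>The category of pixels is a path category\<close>

locale screen_functor = triple_screen T P + pixel_functor "path_cat T" "Sigma_P T P" P D F
  for T :: "'x path_structure" and P and D :: "('x set, 'n) category" and F
begin

abbreviation V :: "'x pth \<Rightarrow> 'n" where
  "V \<gamma> \<equiv> FArr F (path_class T \<gamma>)"

text \<open>On the interval from \<open>a\<close> to \<open>b\<close>, after affine rescaling,
  \<open>\<delta>\<close> is the pixel trace of the single path \<open>\<gamma>\<close>. Degenerate
  intervals are allowed; a path tracked there stays in one pixel.\<close>

definition tracks :: "(real \<Rightarrow> 'x set) \<Rightarrow> real \<Rightarrow> real \<Rightarrow> 'x pth \<Rightarrow> bool" where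
  "tracks \<delta> a b \<gamma> \<longleftrightarrow> a \<le> b \<and> \<gamma> \<in> Paths T \<and> (\<forall>t\<in>{0..1}. \<delta> (a + (b - a) * t) = blk (\<gamma> t))"

text \<open>The pixel path \<open>\<delta>\<close> is piecewise the image of paths in \<open>T\<close>, and \<open>v\<close> is the arrow that it
  represents.\<close>

inductive represents :: "(real \<Rightarrow> 'x set) \<Rightarrow> real \<Rightarrow> real \<Rightarrow> 'n \<Rightarrow> bool" where
  track: "tracks \<delta> a b \<gamma> \<Longrightarrow> represents \<delta> a b (V \<gamma>)"
| join: "represents \<delta> a m v \<Longrightarrow> represents \<delta> m b w \<Longrightarrow> represents \<delta> a b (Comp D w v)"

lemma path_point: "\<gamma> \<in> Paths T \<Longrightarrow> t \<in> {0..1} \<Longrightarrow> \<gamma> t \<in> Points T"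
  using path_im[of \<gamma>] unfolding im_def by blast

lemma blk_point: "\<gamma> \<in> Paths T \<Longrightarrow> t \<in> {0..1} \<Longrightarrow> blk (\<gamma> t) \<in> P \<and> \<gamma> t \<in> blk (\<gamma> t)"
  using path_point blk_mem by simp

lemma V_hom: "\<gamma> \<in> Paths T \<Longrightarrow> V \<gamma> \<in> hom D (blk (\<gamma> 0)) (blk (\<gamma> 1))"
  using F_hom_blk path_class_hom by blast

lemma V_concat:
  assumes "\<gamma> \<in> Paths T" "\<gamma>' \<in> Paths T" "\<gamma> 1 = \<gamma>' 0"
  shows "V (\<gamma> \<cdot> \<gamma>') = Comp D (V \<gamma>') (V \<gamma>)"
  using functor_comp[OF F_functor path_class_hom[OF assms(1)], of "path_class T \<gamma>'" "\<gamma>' 1"]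
    path_class_hom[OF assms(2)] path_comp[OF assms] assms(3) by simp

lemma V_equiv: "(\<gamma>, \<gamma>') \<in> Equiv T \<Longrightarrow> V \<gamma> = V \<gamma>'"
  using path_class_eq_iff equiv_paths by metis

lemma V_pixel:
  assumes "\<rho> \<in> Paths T" "A \<in> P" "im \<rho> \<subseteq> A"
  shows "V \<rho> = Ident D A"
proof (rule F_S[OF assms(2) _ _ path_class_hom[OF assms(1)]])
  show "\<rho> 0 \<in> A" using ends_in_im assms(3) by blast
  show "path_class T \<rho> \<in> S" using class_in_Sigma[OF assms(1)] assms(2,3) by (auto simp: in_pixel_def)
qed

lemma blk_im: "A \<in> P \<Longrightarrow> im \<rho> \<subseteq> A \<Longrightarrow> t \<in> {0..1} \<Longrightarrow> blk (\<rho> t) = A"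
  using blk_eq[of A "\<rho> t"] unfolding im_def by blast

text \<open>(S5) compares paths with equal ends, whereas these two agree only up to pixels. Both are
  extended inside the end pixels, by a span at the start and a cospan at the end, which
  \<open>F\<close> does not see; then (S4) and (S5) apply.\<close>

lemma V_track_unique:
  assumes \<gamma>: "\<gamma> \<in> Paths T" "\<gamma>' \<in> Paths T" and eq: "\<And>t. t \<in> {0..1} \<Longrightarrow> blk (\<gamma> t) = blk (\<gamma>' t)"
  shows "V \<gamma> = V \<gamma>'"
proof -
  let ?A = "blk (\<gamma> 0)" and ?B = "blk (\<gamma> 1)"
  have A: "?A \<in> P" "\<gamma> 0 \<in> ?A" "\<gamma>' 0 \<in> ?A" and B: "?B \<in> P" "\<gamma> 1 \<in> ?B" "\<gamma>' 1 \<in> ?B"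
    using blk_point[OF \<gamma>(1)] blk_point[OF \<gamma>(2)] eq[of 0] eq[of 1] by auto
  obtain \<rho> \<rho>' where r: "\<rho> \<in> Paths T" "\<rho>' \<in> Paths T" "im \<rho> \<subseteq> ?A" "im \<rho>' \<subseteq> ?A" "\<rho> 0 = \<rho>' 0"
    "\<rho> 1 = \<gamma> 0" "\<rho>' 1 = \<gamma>' 0" using S2_span[OF A] .
  obtain w s t where st: "s \<in> S" "t \<in> S" "s \<in> hom C (\<gamma> 1) w" "t \<in> hom C (\<gamma>' 1) w"
    using cospan[OF B] by blast
  obtain \<sigma> where s: "\<sigma> \<in> Paths T" "\<sigma> 0 = \<gamma> 1" "\<sigma> 1 = w" "in_pixel P \<sigma>"
    using Sigma_hom[OF st(1,3)] by metis
  obtain \<sigma>' where s': "\<sigma>' \<in> Paths T" "\<sigma>' 0 = \<gamma>' 1" "\<sigma>' 1 = w" "in_pixel P \<sigma>'"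
    using Sigma_hom[OF st(2,4)] by metis
  have im: "im \<sigma> \<subseteq> ?B" "im \<sigma>' \<subseteq> ?B" using in_pixel_im[OF s(4) B(1)] in_pixel_im[OF s'(4) B(1)] s s' B by auto
  \<comment> \<open>The bracketing is to the left, so the pieces occupy the first quarter, the
    second quarter and the second half; hence the cases below.\<close>
  let ?e = "\<rho> \<cdot> \<gamma> \<cdot> \<sigma>" and ?e' = "\<rho>' \<cdot> \<gamma>' \<cdot> \<sigma>'"
  have p: "\<rho> \<cdot> \<gamma> \<in> Paths T" "\<rho>' \<cdot> \<gamma>' \<in> Paths T" using concat r \<gamma> by auto
  have e: "?e \<in> Paths T" "?e' \<in> Paths T" using concat p s s' by auto
  have blk_e: "blk (?e u) = blk (?e' u)" if u: "u \<in> {0..1}" for u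
  proof -
    consider "u \<le> 1/4" | "1/4 < u" "u \<le> 1/2" | "1/2 < u" by linarith
    then show ?thesis
    proof cases
      case 1
      then have "?e u = \<rho> (4 * u)" "?e' u = \<rho>' (4 * u)" "4 * u \<in> {0..1}" using u by (auto simp: concat_path_def)
      then show ?thesis using blk_im[OF A(1)] r by simp
    next
      case 2
      then have "?e u = \<gamma> (4 * u - 1)" "?e' u = \<gamma>' (4 * u - 1)" "4 * u - 1 \<in> {0..1}" using u by (auto simp: concat_path_def)
      then show ?thesis using eq by simp
    next
      case 3
      then have "?e u = \<sigma> (2 * u - 1)" "?e' u = \<sigma>' (2 * u - 1)" "2 * u - 1 \<in> {0..1}" using u by (auto simp: concat_path_def)
      then show ?thesis using blk_im[OF B(1)] im by simp
    qed
  qed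
  obtain Is As where ad: "admits P ?e Is As" using S4[OF e(1)] by blast
  \<comment> \<open>The partition and the pixels that (S4) gives for \<open>?e\<close> serve
    \<open>?e'\<close> too, because both paths are in the same pixel at every time.\<close>
  have "?e' u \<in> As ! i" if i: "i < length Is" "u \<in> Is ! i" for i u
  proof -
    have "Is ! i \<subseteq> {0..1}" using ad i(1) by (auto simp: admits_def partition_on_def)
    then have u: "u \<in> {0..1}" using i by blast
    have "?e u \<in> As ! i" "As ! i \<in> P" using ad i by (auto simp: admits_def image_subset_iff)
    then have "blk (?e' u) = As ! i" using blk_e[OF u] blk_eq by simp
    then show ?thesis using blk_point[OF e(2) u] by simp
  qed
  then have "admits P ?e' Is As" using ad by (auto simp: admits_def image_subset_iff)
  then have "(?e, ?e') \<in> Equiv T" using S5[OF e _ _ ad] r s s' by simp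
  then have "V ?e = V ?e'" by (rule V_equiv)
  moreover have "V ?e = V \<gamma>"
    using V_concat[OF p(1) s(1)] V_concat[OF r(1) \<gamma>(1)] V_pixel[OF r(1) A(1) r(3)] V_pixel[OF s(1) B(1) im(1)]
      D.comp_ident_hom[OF V_hom[OF \<gamma>(1)]] r s by simp
  moreover have "V ?e' = V \<gamma>'"
    using V_concat[OF p(2) s'(1)] V_concat[OF r(2) \<gamma>(2)] V_pixel[OF r(2) A(1) r(4)] V_pixel[OF s'(1) B(1) im(2)]
      D.comp_ident_hom[OF V_hom[OF \<gamma>(2)]] r s' eq[of 0] eq[of 1] by simp
  ultimately show ?thesis by simp
qed

lemma V_reparam:
  assumes "\<gamma> \<in> Paths T" "reparametrization \<phi>" "\<phi> 0 = 0" "\<phi> 1 = 1"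
  shows "V (reparam \<gamma> \<phi>) = V \<gamma>"
  using V_equiv[OF equiv_reparam[OF assms]] by simp

text \<open>The two restrictions of \<open>\<gamma>\<close>, each stretched to the unit interval,
  concatenate to a reparametrization of \<open>\<gamma>\<close>, which has the same arrow.\<close>

lemma tracks_split:
  assumes "tracks \<delta> a c \<gamma>" "a \<le> b" "b \<le> c"
  obtains \<gamma>1 \<gamma>2 where "tracks \<delta> a b \<gamma>1" "tracks \<delta> b c \<gamma>2" "V \<gamma> = Comp D (V \<gamma>2) (V \<gamma>1)"
proof -
  \<comment> \<open>The cut point in the parameter of \<open>\<gamma>\<close>. If
    \<open>a = c\<close>, division by zero gives \<open>l = 0\<close>, and \<open>l_eq\<close> still
    holds because then \<open>b = a\<close>.\<close>
  define l where "l = (b - a) / (c - a)"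
  have l: "0 \<le> l" "l \<le> 1" using assms by (auto simp: l_def divide_le_eq)
  have l_eq: "(c - a) * l = b - a" using assms by (auto simp: l_def)
  \<comment> \<open>\<open>?\<phi>\<close> runs through the part up to \<open>l\<close> on the first
    half of the unit interval and through the rest on the second half.\<close>
  let ?\<phi>1 = "\<lambda>t. l * t" and ?\<phi>2 = "\<lambda>t. l + (1 - l) * t" and ?\<phi> = "\<lambda>t. l * min (2 * t) 1 + (1 - l) * max 0 (2 * t - 1)"
  let ?\<gamma>1 = "reparam \<gamma> ?\<phi>1" and ?\<gamma>2 = "reparam \<gamma> ?\<phi>2"
  have \<gamma>: "\<gamma> \<in> Paths T" "\<And>t. t \<in> {0..1} \<Longrightarrow> \<delta> (a + (c - a) * t) = blk (\<gamma> t)"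
    using assms by (auto simp: tracks_def)
  have rep: "reparametrization ?\<phi>1" "reparametrization ?\<phi>2" "reparametrization ?\<phi>"
    using l by (auto intro!: reparametrizationI continuous_intros mono_onI mult_left_mono add_mono min.mono max.mono)
  then have p: "?\<gamma>1 \<in> Paths T" "?\<gamma>2 \<in> Paths T" using reparam[OF \<gamma>(1)] by auto
  have in1: "?\<phi>1 t \<in> {0..1}" "?\<phi>2 t \<in> {0..1}" if "t \<in> {0..1}" for t
    using rep that by (auto simp: reparametrization_def image_subset_iff)
  have "\<delta> (a + (b - a) * t) = blk (?\<gamma>1 t)" if t: "t \<in> {0..1}" for t
  proof -
    have "a + (c - a) * ?\<phi>1 t = a + (b - a) * t" by (simp only: mult.assoc[symmetric] l_eq)
    then show ?thesis using \<gamma>(2)[OF in1(1)[OF t]] t by (simp only: reparam_def restrict_apply if_True)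
  qed
  moreover have "\<delta> (b + (c - b) * t) = blk (?\<gamma>2 t)" if t: "t \<in> {0..1}" for t
  proof -
    have "a + (c - a) * ?\<phi>2 t = a + (c - a) * l + ((c - a) - (c - a) * l) * t" by (simp add: algebra_simps)
    also have "\<dots> = b + (c - b) * t" unfolding l_eq by simp
    finally show ?thesis using \<gamma>(2)[OF in1(2)[OF t]] t by (simp only: reparam_def restrict_apply if_True)
  qed
  ultimately have tr: "tracks \<delta> a b ?\<gamma>1" "tracks \<delta> b c ?\<gamma>2" using assms p by (auto simp: tracks_def)
  have join: "?\<gamma>1 1 = ?\<gamma>2 0" by (simp add: reparam_def)
  have "reparam \<gamma> ?\<phi> = ?\<gamma>1 \<cdot> ?\<gamma>2"
  proof
    fix t :: real
    show "reparam \<gamma> ?\<phi> t = (?\<gamma>1 \<cdot> ?\<gamma>2) t"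
    proof (cases "t \<le> 1/2")
      case True
      then have "min (2 * t) 1 = 2 * t" "max 0 (2 * t - 1) = 0" by auto
      then show ?thesis using True by (simp add: reparam_def concat_path_def)
    next
      case False
      then have "min (2 * t) 1 = 1" "max 0 (2 * t - 1) = 2 * t - 1" by auto
      then show ?thesis using False by (simp add: reparam_def concat_path_def)
    qed
  qed
  then have "V \<gamma> = V (?\<gamma>1 \<cdot> ?\<gamma>2)" using V_reparam[OF \<gamma>(1) rep(3)] by simp
  also have "\<dots> = Comp D (V ?\<gamma>2) (V ?\<gamma>1)" using V_concat[OF p join] .
  finally show ?thesis using that tr by blast
qed

lemma represents_le: "represents \<delta> a b v \<Longrightarrow> a \<le> b"
  by (induction rule: represents.induct) (auto simp: tracks_def)

lemma represents_hom: "represents \<delta> a b v \<Longrightarrow> v \<in> hom D (\<delta> a) (\<delta> b)"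
proof (induction rule: represents.induct)
  case (track \<delta> a b \<gamma>)
  then have \<gamma>: "\<gamma> \<in> Paths T" "\<And>t. t \<in> {0..1} \<Longrightarrow> \<delta> (a + (b - a) * t) = blk (\<gamma> t)"
    by (auto simp: tracks_def)
  show ?case using V_hom[OF \<gamma>(1)] \<gamma>(2)[of 0] \<gamma>(2)[of 1] by simp
next
  case (join \<delta> a m v b w)
  then show ?case using D.comp_hom by blast
qed

text \<open>A cut falls into one side of each gluing point; the other side is attached to the
  adjacent piece by associativity.\<close>

lemma represents_split:
  assumes "represents \<delta> a c v" "a \<le> b" "b \<le> c"
  shows "\<exists>v1 v2. represents \<delta> a b v1 \<and> represents \<delta> b c v2 \<and> v = Comp D v2 v1"
  using assms
proof (induction rule: represents.induct)
  case (track \<delta> a c \<gamma>)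
  then show ?case using tracks_split represents.track by metis
next
  case (join \<delta> a m v c w)
  note hv = represents_hom[OF join.hyps(1)] and hw = represents_hom[OF join.hyps(2)]
  show ?case
  proof (cases "b \<le> m")
    case True
    then obtain v1 v2 where v: "represents \<delta> a b v1" "represents \<delta> b m v2" "v = Comp D v2 v1"
      using join by blast
    have "Comp D w v = Comp D (Comp D w v2) v1"
      unfolding v(3) using D.assoc_hom[OF represents_hom[OF v(1)] represents_hom[OF v(2)] hw] .
    then show ?thesis using v(1) represents.join[OF v(2) join.hyps(2)] by blast
  next
    case False
    then obtain w1 w2 where w: "represents \<delta> m b w1" "represents \<delta> b c w2" "w = Comp D w2 w1"
      using join by fastforce
    have "Comp D w v = Comp D w2 (Comp D w1 v)"
      unfolding w(3) using D.assoc_hom[OF hv represents_hom[OF w(1)] represents_hom[OF w(2)]] by simp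
    then show ?thesis using w(2) represents.join[OF join.hyps(1) w(1)] by blast
  qed
qed

lemma represents_track:
  assumes "represents \<delta> a b v" "tracks \<delta> a b \<gamma>"
  shows "v = V \<gamma>"
  using assms
proof (induction arbitrary: \<gamma> rule: represents.induct)
  case (track \<delta> a b \<gamma>')
  have "blk (\<gamma>' t) = blk (\<gamma> t)" if "t \<in> {0..1}" for t
    using track that unfolding tracks_def by metis
  then show ?case using V_track_unique track unfolding tracks_def by blast
next
  case (join \<delta> a m v b w)
  obtain \<gamma>1 \<gamma>2 where "tracks \<delta> a m \<gamma>1" "tracks \<delta> m b \<gamma>2" "V \<gamma> = Comp D (V \<gamma>2) (V \<gamma>1)"
    using tracks_split[OF join.prems represents_le[OF join.hyps(1)] represents_le[OF join.hyps(2)]] .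
  then show ?case using join.IH by simp
qed

text \<open>One derivation is cut at the gluing points of the other until single traces remain,
  where \<open>represents_track\<close> decides. Hence the represented arrow is a function of the
  path of pixels, and equivalence by it is transitive.\<close>

lemma represents_unique:
  assumes "represents \<delta> a b v" "represents \<delta> a b v'"
  shows "v = v'"
  using assms
proof (induction arbitrary: v' rule: represents.induct)
  case (track \<delta> a b \<gamma>)
  then show ?case using represents_track by metis
next
  case (join \<delta> a m v b w)
  obtain v1 v2 where "represents \<delta> a m v1" "represents \<delta> m b v2" "v' = Comp D v2 v1"
    using represents_split[OF join.prems represents_le[OF join.hyps(1)] represents_le[OF join.hyps(2)]] by blast
  then show ?case using join.IH by simp
qed

lemma represents_affine:
  assumes "represents \<delta> a b v" "0 \<le> q" "\<And>t. t \<in> {a..b} \<Longrightarrow> \<delta>' (p + q * t) = \<delta> t"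
  shows "represents \<delta>' (p + q * a) (p + q * b) v"
  using assms
proof (induction rule: represents.induct)
  case (track \<delta> a b \<gamma>)
  have "\<delta>' (p + q * a + (p + q * b - (p + q * a)) * t) = blk (\<gamma> t)" if t: "t \<in> {0..1}" for t
  proof -
    have ab: "a \<le> b" using track by (simp add: tracks_def)
    have "a + (b - a) * t \<in> {a..b}" using t ab mult_left_le[of t "b - a"] by auto
    then have "\<delta>' (p + q * (a + (b - a) * t)) = blk (\<gamma> t)"
      using track t unfolding tracks_def by metis
    then show ?thesis by (simp add: algebra_simps)
  qed
  then have "tracks \<delta>' (p + q * a) (p + q * b) \<gamma>"
    using track by (auto simp: tracks_def mult_left_mono)
  then show ?case by (rule represents.track)
next
  case (join \<delta> a m v b w)
  show ?case
    using join.IH[OF join.prems(1)] join.prems(2) represents_le[OF join.hyps(1)] represents_le[OF join.hyps(2)]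
    by (intro represents.join[of \<delta>' _ "p + q * m"]) auto
qed

text \<open>A reparametrization is not given as continuous; preservation of intervals is used
  directly as the intermediate value property.\<close>

lemma reparametrization_between:
  assumes "reparametrization \<phi>" "a \<in> {0..1}" "b \<in> {0..1}" "a \<le> b" "m \<in> {\<phi> a..\<phi> b}"
  obtains n where "n \<in> {a..b}" "\<phi> n = m"
proof -
  have "is_interval (\<phi> ` {a..b})" using assms by (auto simp: reparametrization_def is_interval_cc)
  moreover have "\<phi> a \<in> \<phi> ` {a..b}" "\<phi> b \<in> \<phi> ` {a..b}" using assms by auto
  ultimately have "m \<in> \<phi> ` {a..b}" using assms(5) unfolding is_interval_1 by auto
  then show ?thesis using that by auto
qed

lemma reparametrization_restrict:
  assumes \<phi>: "reparametrization \<phi>" and ab: "a \<in> {0..1}" "b \<in> {0..1}" "a \<le> b" and lt: "\<phi> a < \<phi> b"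
  shows "reparametrization (\<lambda>t. (\<phi> (a + (b - a) * t) - \<phi> a) / (\<phi> b - \<phi> a))" (is "reparametrization ?\<psi>")
proof -
  have arg: "a + (b - a) * t \<in> {a..b}" if "t \<in> {0..1}" for t
    using that ab mult_left_le[of t "b - a"] by auto
  have mono: "\<phi> u \<le> \<phi> v" if "u \<in> {0..1}" "v \<in> {0..1}" "u \<le> v" for u v
    using \<phi> that by (auto simp: reparametrization_def mono_on_def)
  have bounds: "?\<psi> t \<in> {0..1}" if "t \<in> {0..1}" for t
    using mono[of a "a + (b - a) * t"] mono[of "a + (b - a) * t" b] arg[OF that] ab lt
    by (auto simp: field_simps)
  have "mono_on {0..1} ?\<psi>"
  proof (rule mono_onI)
    fix r s :: real assume rs: "r \<in> {0..1}" "s \<in> {0..1}" "r \<le> s"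
    have "\<phi> (a + (b - a) * r) \<le> \<phi> (a + (b - a) * s)"
      using mono arg[OF rs(1)] arg[OF rs(2)] ab rs(3) by (simp add: mult_left_mono)
    then show "?\<psi> r \<le> ?\<psi> s" using lt by (simp add: divide_right_mono)
  qed
  moreover have "is_interval (?\<psi> ` I)" if I: "I \<subseteq> {0..1}" "is_interval I" for I
  proof -
    have affine: "is_interval ((\<lambda>t. p + q * t) ` J)" if "is_interval J" for p q :: real and J
    proof -
      have "continuous_on J (\<lambda>t. p + q * t)" by (intro continuous_intros)
      then show ?thesis using connected_continuous_image that by (simp add: is_interval_connected_1)
    qed
    have "is_interval ((\<lambda>t. a + (b - a) * t) ` I)" by (rule affine[OF I(2)])
    moreover have "(\<lambda>t. a + (b - a) * t) ` I \<subseteq> {0..1}" using arg I(1) ab by fastforce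
    ultimately have "is_interval (\<phi> ` (\<lambda>t. a + (b - a) * t) ` I)" using \<phi> by (auto simp: reparametrization_def)
    from affine[OF this, of "- \<phi> a / (\<phi> b - \<phi> a)" "1 / (\<phi> b - \<phi> a)"]
    show ?thesis by (simp add: image_image diff_divide_distrib)
  qed
  ultimately show ?thesis using bounds by (auto simp: reparametrization_def)
qed

text \<open>A gluing point \<open>m\<close> has a preimage under \<open>\<phi>\<close>, so the
  derivation pulls back piece by piece. On a single trace \<open>\<phi>\<close> is normalized to a
  reparametrization that fixes 0 and 1, which preserves the arrow.\<close>

lemma represents_reparam:
  assumes "represents \<delta> c d v" and \<phi>: "reparametrization \<phi>"
    and "a \<in> {0..1}" "b \<in> {0..1}" "a \<le> b" "\<phi> a = c" "\<phi> b = d" "\<And>t. t \<in> {a..b} \<Longrightarrow> \<delta>' t = \<delta> (\<phi> t)"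
  shows "represents \<delta>' a b v"
  using assms(1,3-)
proof (induction arbitrary: a b rule: represents.induct)
  case (track \<delta> c d \<gamma>)
  have \<gamma>: "c \<le> d" "\<gamma> \<in> Paths T" "\<And>t. t \<in> {0..1} \<Longrightarrow> \<delta> (c + (d - c) * t) = blk (\<gamma> t)"
    using track.hyps by (auto simp: tracks_def)
  have arg: "a + (b - a) * t \<in> {a..b}" if "t \<in> {0..1}" for t
    using that track.prems mult_left_le[of t "b - a"] by auto
  have mono: "\<phi> u \<le> \<phi> v" if "u \<in> {0..1}" "v \<in> {0..1}" "u \<le> v" for u v
    using \<phi> that by (auto simp: reparametrization_def mono_on_def)
  show ?case
  proof (cases "c < d")
    case True
    let ?\<psi> = "\<lambda>t. (\<phi> (a + (b - a) * t) - \<phi> a) / (\<phi> b - \<phi> a)"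
    have \<psi>: "reparametrization ?\<psi>"
      using reparametrization_restrict[OF \<phi> track.prems(1-3)] True track.prems by simp
    have "V (reparam \<gamma> ?\<psi>) = V \<gamma>"
      by (rule V_reparam[OF \<gamma>(2) \<psi>]) (use True track.prems in auto)
    moreover have "tracks \<delta>' a b (reparam \<gamma> ?\<psi>)"
    proof -
      have "\<delta>' (a + (b - a) * t) = blk (reparam \<gamma> ?\<psi> t)" if t: "t \<in> {0..1}" for t
      proof -
        have "?\<psi> t \<in> {0..1}" using \<psi> t by (auto simp: reparametrization_def image_subset_iff)
        then have "\<delta> (c + (d - c) * ?\<psi> t) = blk (\<gamma> (?\<psi> t))" by (rule \<gamma>(3))
        moreover have "c + (d - c) * ?\<psi> t = \<phi> (a + (b - a) * t)" using True track.prems by simp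
        ultimately show ?thesis using track.prems(6)[OF arg[OF t]] t by (simp add: reparam_def)
      qed
      then show ?thesis using reparam[OF \<gamma>(2) \<psi>] track.prems by (simp add: tracks_def)
    qed
    ultimately show ?thesis using represents.track by metis
  next
    \<comment> \<open>Normalizing would divide by zero here. Instead \<open>\<phi>\<close> is
      constant on the interval and \<open>\<gamma>\<close> stays in the pixel
      \<open>\<delta> c\<close>, so \<open>\<gamma>\<close> itself tracks
      \<open>\<delta>'\<close>.\<close>
    case False
    then have cd: "c = d" using \<gamma>(1) by simp
    have "\<delta>' (a + (b - a) * t) = blk (\<gamma> t)" if t: "t \<in> {0..1}" for t
    proof -
      have "\<phi> (a + (b - a) * t) = c"
        using mono[of a "a + (b - a) * t"] mono[of "a + (b - a) * t" b] arg[OF t] track.prems cd by force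
      then show ?thesis using track.prems(6)[OF arg[OF t]] \<gamma>(3)[OF t] cd by simp
    qed
    then have "tracks \<delta>' a b \<gamma>" using track.prems \<gamma>(2) by (simp add: tracks_def)
    then show ?thesis by (rule represents.track)
  qed
next
  case (join \<delta> c m v d w)
  have "m \<in> {\<phi> a..\<phi> b}" using represents_le[OF join.hyps(1)] represents_le[OF join.hyps(2)] join.prems by simp
  then obtain n where n: "n \<in> {a..b}" "\<phi> n = m"
    using reparametrization_between[OF \<phi> join.prems(1-3)] by blast
  have "represents \<delta>' a n v"
    by (rule join.IH(1)) (use n join.prems in auto)
  moreover have "represents \<delta>' n b w"
    by (rule join.IH(2)) (use n join.prems in auto)
  ultimately show ?case by (rule represents.join)
qed

text \<open>On a trace an identity forces the path into one pixel, by \<open>S_reflect\<close>; at a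
  gluing point both factors are identities, by \<open>D_factor_ident\<close>.\<close>

lemma represents_ident:
  assumes "represents \<delta> a b v" "v = Ident D A" "A \<in> P" "t \<in> {a..b}"
  shows "\<delta> t = A"
  using assms
proof (induction rule: represents.induct)
  case (track \<delta> a b \<gamma>)
  have \<gamma>: "a \<le> b" "\<gamma> \<in> Paths T" "\<And>t. t \<in> {0..1} \<Longrightarrow> \<delta> (a + (b - a) * t) = blk (\<gamma> t)"
    using track by (auto simp: tracks_def)
  have "path_class T \<gamma> \<in> S" using S_reflect[OF path_class_hom[OF \<gamma>(2)]] track.prems by blast
  then obtain B where B: "B \<in> P" "im \<gamma> \<subseteq> B" using class_in_Sigma[OF \<gamma>(2)] by (auto simp: in_pixel_def)
  have "Ident D B = Ident D A" using V_pixel[OF \<gamma>(2) B] track.prems by simp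
  then have "B = A" using D.ident_hom B(1) track.prems(2) obj_D by (metis homD)
  show ?case
  proof (cases "a = b")
    case True
    then show ?thesis using \<gamma>(3)[of 0] track.prems blk_im[OF B, of 0] \<open>B = A\<close> by simp
  next
    case False
    then have "(t - a) / (b - a) \<in> {0..1}" "a + (b - a) * ((t - a) / (b - a)) = t"
      using track.prems \<gamma>(1) by (auto simp: divide_le_eq)
    then show ?thesis using \<gamma>(3) blk_im[OF B] \<open>B = A\<close> by metis
  qed
next
  case (join \<delta> a m v b w)
  note h = represents_hom[OF join.hyps(1)] represents_hom[OF join.hyps(2)]
  have "Comp D w v \<in> hom D A A" using join.prems(1,2) D.ident_hom obj_D by simp
  then have "\<delta> a = A" using D.comp_hom[OF h] by (auto simp: hom_def)
  then have "v = Ident D A" "w = Ident D A" using D_factor_ident[OF h] join.prems(1) by auto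
  then show ?case using join.IH join.prems by (cases "t \<le> m") auto
qed

section \<open>The triple whose points are the pixels\<close>

definition pixel_triple :: "'x set path_structure" where
  "pixel_triple = (let \<Gamma> = {\<delta> \<in> all_paths P. \<exists>v. represents \<delta> 0 1 v} in
    \<lparr>Points = P, Paths = \<Gamma>,
     Equiv = {(\<delta>, \<delta>'). \<delta> \<in> \<Gamma> \<and> \<delta>' \<in> \<Gamma> \<and> (\<exists>v. represents \<delta> 0 1 v \<and> represents \<delta>' 0 1 v)}\<rparr>)"

lemma pixel_points: "Points pixel_triple = P"
  by (simp add: pixel_triple_def Let_def)

lemma pixel_paths: "\<delta> \<in> Paths pixel_triple \<longleftrightarrow> \<delta> \<in> all_paths P \<and> (\<exists>v. represents \<delta> 0 1 v)"
  by (simp add: pixel_triple_def Let_def)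

lemma pixel_equiv: "(\<delta>, \<delta>') \<in> Equiv pixel_triple \<longleftrightarrow> \<delta> \<in> all_paths P \<and> \<delta>' \<in> all_paths P \<and>
    (\<exists>v. represents \<delta> 0 1 v \<and> represents \<delta>' 0 1 v)"
  by (auto simp: pixel_triple_def Let_def)

lemma represents_concat:
  assumes "represents \<delta> 0 1 v" "represents \<delta>' 0 1 w" "\<delta> 1 = \<delta>' 0"
  shows "represents (\<delta> \<cdot> \<delta>') 0 1 (Comp D w v)"
proof -
  have "represents (\<delta> \<cdot> \<delta>') (0 + 1/2 * 0) (0 + 1/2 * 1) v"
    by (rule represents_affine[OF assms(1)]) (auto simp: concat_path_def)
  moreover have "represents (\<delta> \<cdot> \<delta>') (1/2 + 1/2 * 0) (1/2 + 1/2 * 1) w"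
    by (rule represents_affine[OF assms(2)]) (use assms(3) in \<open>auto simp: concat_path_def\<close>)
  ultimately show ?thesis using represents.join[of _ 0 "1/2" _ 1] by simp
qed

lemma represents_const:
  assumes "A \<in> P" shows "represents (const_path A) 0 1 (Ident D A)"
proof -
  obtain x where x: "x \<in> A" using block_nonempty assms by blast
  have c: "const_path x \<in> Paths T" using const block_obj[OF assms x] by simp
  have "tracks (const_path A) 0 1 (const_path x)"
    using c blk_eq[OF assms x] by (simp add: tracks_def const_path_def)
  then show ?thesis using represents.track V_pixel[OF c assms] x by fastforce
qed

text \<open>Each axiom is a property of represented arrows: gluing gives (a),
  \<open>represents_reparam\<close> gives (b) and (e), \<open>represents_ident\<close> gives (d),
  and cancellation in \<open>D\<close> gives (f).\<close>

lemma pixel_triple_triple: "triple pixel_triple"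
proof
  show "Points pixel_triple \<noteq> {}"
    using points_nonempty partition by (auto simp: pixel_points partition_on_def)
  show "Paths pixel_triple \<subseteq> all_paths (Points pixel_triple)" by (auto simp: pixel_points pixel_paths)
  show "equiv (Paths pixel_triple) (Equiv pixel_triple)"
  proof (rule equivI)
    show "Equiv pixel_triple \<subseteq> Paths pixel_triple \<times> Paths pixel_triple"
      by (auto simp: pixel_equiv pixel_paths)
    show "refl_on (Paths pixel_triple) (Equiv pixel_triple)"
      by (auto simp: refl_on_def pixel_equiv pixel_paths)
    show "sym (Equiv pixel_triple)" by (auto simp: sym_def pixel_equiv)
    show "trans (Equiv pixel_triple)"
      by (rule transI) (use represents_unique in \<open>auto simp: pixel_equiv\<close>, blast)
  qed
next
  fix \<gamma> \<gamma>' assume "(\<gamma>, \<gamma>') \<in> Equiv pixel_triple"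
  then obtain v where "represents \<gamma> 0 1 v" "represents \<gamma>' 0 1 v" by (auto simp: pixel_equiv)
  then show "\<gamma> 0 = \<gamma>' 0 \<and> \<gamma> 1 = \<gamma>' 1" using represents_hom[of \<gamma> 0 1 v] represents_hom[of \<gamma>' 0 1 v]
    by (auto simp: hom_def)
next
  fix \<gamma> \<gamma>' assume "\<gamma> \<in> Paths pixel_triple" "\<gamma>' \<in> Paths pixel_triple" "\<gamma> 1 = \<gamma>' 0"
  then show "\<gamma> \<cdot> \<gamma>' \<in> Paths pixel_triple"
    using represents_concat concat_all_paths unfolding pixel_paths by blast
next
  fix \<gamma> \<phi> assume g: "\<gamma> \<in> Paths pixel_triple" and \<phi>: "reparametrization \<phi>"
  obtain v where v: "represents \<gamma> 0 1 v" using g by (auto simp: pixel_paths)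
  have b: "0 \<le> \<phi> 0" "\<phi> 0 \<le> \<phi> 1" "\<phi> 1 \<le> 1"
    using \<phi> by (auto simp: reparametrization_def image_subset_iff mono_on_def)
  \<comment> \<open>In (b) the ends need not be fixed, so the represented path is first cut down to
    the range from \<open>\<phi> 0\<close> to \<open>\<phi> 1\<close>.\<close>
  obtain v1 v2 where "represents \<gamma> (\<phi> 0) 1 v1" using represents_split[OF v, of "\<phi> 0"] b by auto
  then obtain v3 where v3: "represents \<gamma> (\<phi> 0) (\<phi> 1) v3" using represents_split[of \<gamma> "\<phi> 0" 1 v1 "\<phi> 1"] b by auto
  have "represents (reparam \<gamma> \<phi>) 0 1 v3"
    by (rule represents_reparam[OF v3 \<phi>]) (auto simp: reparam_def)
  then show "reparam \<gamma> \<phi> \<in> Paths pixel_triple"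
    using g reparam_all_paths[OF _ \<phi>] by (auto simp: pixel_paths)
next
  fix A assume "A \<in> Points pixel_triple"
  then show "const_path A \<in> Paths pixel_triple"
    using represents_const const_all_paths by (auto simp: pixel_paths pixel_points)
next
  fix A \<gamma> assume A: "A \<in> Points pixel_triple" and e: "(\<gamma>, const_path A) \<in> Equiv pixel_triple"
  have "represents \<gamma> 0 1 (Ident D A)"
    using e represents_unique[OF represents_const] A by (auto simp: pixel_equiv pixel_points)
  then have "\<gamma> t = A" if "t \<in> {0..1}" for t
    using represents_ident that A by (auto simp: pixel_points)
  moreover have "\<gamma> \<in> extensional {0..1}" using e by (auto simp: pixel_equiv all_paths_def PiE_def)
  ultimately have "\<gamma> = const_path A"
    by (auto simp: const_path_def fun_eq_iff restrict_def extensional_def)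
  then show "\<exists>y. \<gamma> = const_path y" by blast
next
  fix \<gamma> \<phi> assume g: "\<gamma> \<in> Paths pixel_triple" and \<phi>: "reparametrization \<phi>" "\<phi> 0 = 0" "\<phi> 1 = 1"
  obtain v where v: "represents \<gamma> 0 1 v" using g by (auto simp: pixel_paths)
  have "represents (reparam \<gamma> \<phi>) 0 1 v"
    by (rule represents_reparam[OF v \<phi>(1)]) (use \<phi> in \<open>auto simp: reparam_def\<close>)
  then show "(\<gamma>, reparam \<gamma> \<phi>) \<in> Equiv pixel_triple"
    using g v reparam_all_paths[OF _ \<phi>(1)] by (auto simp: pixel_paths pixel_equiv)
next
  fix \<gamma> \<gamma>' \<rho> \<rho>' assume p: "\<gamma> \<in> Paths pixel_triple" "\<gamma>' \<in> Paths pixel_triple"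
    "\<rho> \<in> Paths pixel_triple" "\<rho>' \<in> Paths pixel_triple"
    "\<rho> 1 = \<gamma> 0" "\<gamma> 1 = \<rho>' 0" "\<rho> 1 = \<gamma>' 0" "\<gamma>' 1 = \<rho>' 0"
    "\<rho> \<cdot> \<gamma> \<cdot> \<rho>' \<in> Paths pixel_triple" "\<rho> \<cdot> \<gamma>' \<cdot> \<rho>' \<in> Paths pixel_triple"
  obtain v v' r r' where v: "represents \<gamma> 0 1 v" "represents \<gamma>' 0 1 v'" "represents \<rho> 0 1 r" "represents \<rho>' 0 1 r'"
    using p by (auto simp: pixel_paths)
  have h: "v \<in> hom D (\<rho> 1) (\<rho>' 0)" "v' \<in> hom D (\<rho> 1) (\<rho>' 0)" "r \<in> hom D (\<rho> 0) (\<rho> 1)" "r' \<in> hom D (\<rho>' 0) (\<rho>' 1)"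
    using v[THEN represents_hom] p by auto
  have c: "represents (\<rho> \<cdot> \<gamma> \<cdot> \<rho>') 0 1 (Comp D r' (Comp D v r))"
    "represents (\<rho> \<cdot> \<gamma>' \<cdot> \<rho>') 0 1 (Comp D r' (Comp D v' r))"
    using represents_concat[OF represents_concat[OF v(3,1) p(5)] v(4)]
      represents_concat[OF represents_concat[OF v(3,2) p(7)] v(4)] p by simp_all
  have "(\<rho> \<cdot> \<gamma> \<cdot> \<rho>', \<rho> \<cdot> \<gamma>' \<cdot> \<rho>') \<in> Equiv pixel_triple \<longleftrightarrow> Comp D r' (Comp D v r) = Comp D r' (Comp D v' r)"
    using p(9,10) c represents_unique unfolding pixel_equiv pixel_paths by metis
  also have "\<dots> \<longleftrightarrow> v = v'"
    using D_cancel_left[OF D.comp_hom[OF h(3,1)] D.comp_hom[OF h(3,2)] h(4)] D_cancel_right[OF h(3,1,2)] by blast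
  also have "\<dots> \<longleftrightarrow> (\<gamma>, \<gamma>') \<in> Equiv pixel_triple"
    using p(1,2) v represents_unique unfolding pixel_equiv pixel_paths by metis
  finally show "(\<gamma>, \<gamma>') \<in> Equiv pixel_triple \<longleftrightarrow> (\<rho> \<cdot> \<gamma> \<cdot> \<rho>', \<rho> \<cdot> \<gamma>' \<cdot> \<rho>') \<in> Equiv pixel_triple" by simp
qed

text \<open>An arrow corresponds to the set of all paths of pixels that represent it. This set is
  nonempty since the pixel trace of any lift belongs to it.\<close>

lemma in_PCat_pixels: "in_PCat D"
proof -
  interpret Q: triple pixel_triple by (rule pixel_triple_triple)
  define \<Theta> where "\<Theta> = \<lparr>FObj = (\<lambda>A :: 'x set. A), FArr = (\<lambda>d. {\<delta> \<in> Paths pixel_triple. represents \<delta> 0 1 d})\<rparr>"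
  have cls: "FArr \<Theta> v = path_class pixel_triple \<delta>" if "\<delta> \<in> all_paths P" "represents \<delta> 0 1 v" for \<delta> v
    using that by (auto simp: \<Theta>_def path_class_def pixel_equiv pixel_paths dest: represents_unique[OF that(2)])
  have rep: "\<exists>\<delta>. \<delta> \<in> all_paths P \<and> represents \<delta> 0 1 d \<and> \<delta> 0 = X \<and> \<delta> 1 = Y" if d: "d \<in> hom D X Y" for d X Y
  proof -
    obtain f x y where f: "f \<in> hom C x y" "FArr F f = d" using lift[OF d] by metis
    obtain \<gamma> where \<gamma>: "\<gamma> \<in> Paths T" "f = path_class T \<gamma>" using path_arr[OF f(1)] by metis
    let ?\<delta> = "\<lambda>t\<in>{0..1}. blk (\<gamma> t)"
    have "tracks ?\<delta> 0 1 \<gamma>" using \<gamma>(1) by (simp add: tracks_def)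
    then have r: "represents ?\<delta> 0 1 d" using represents.track f \<gamma> by metis
    moreover have "?\<delta> \<in> all_paths P" using blk_point[OF \<gamma>(1)] by (auto simp: all_paths_def)
    moreover have "?\<delta> 0 = X" "?\<delta> 1 = Y" using represents_hom[OF r] d by (auto simp: hom_def)
    ultimately show ?thesis by blast
  qed
  have func: "is_functor D (path_cat pixel_triple) \<Theta>"
  proof (rule is_functorI[OF D.is_category_axioms Q.path_category])
    fix A assume "A \<in> Obj D"
    then have A: "A \<in> P" using obj_D by simp
    then show "FObj \<Theta> A \<in> Obj (path_cat pixel_triple)" by (simp add: \<Theta>_def pixel_points)
    show "FArr \<Theta> (Ident D A) = Ident (path_cat pixel_triple) (FObj \<Theta> A)"
      using cls[OF const_all_paths[OF A] represents_const[OF A]] by (simp add: \<Theta>_def)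
  next
    fix X Y d assume d: "d \<in> hom D X Y"
    obtain \<delta> where "\<delta> \<in> all_paths P" "represents \<delta> 0 1 d" "\<delta> 0 = X" "\<delta> 1 = Y" using rep[OF d] by blast
    then show "FArr \<Theta> d \<in> hom (path_cat pixel_triple) (FObj \<Theta> X) (FObj \<Theta> Y)"
      using cls[of \<delta> d] Q.path_class_hom[of \<delta>] by (auto simp: pixel_paths \<Theta>_def)
  next
    fix X Y Z d e assume d: "d \<in> hom D X Y" and e: "e \<in> hom D Y Z"
    obtain \<delta> where \<delta>: "\<delta> \<in> all_paths P" "represents \<delta> 0 1 d" "\<delta> 1 = Y" using rep[OF d] by blast
    obtain \<epsilon> where \<epsilon>: "\<epsilon> \<in> all_paths P" "represents \<epsilon> 0 1 e" "\<epsilon> 0 = Y" using rep[OF e] by blast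
    have "FArr \<Theta> (Comp D e d) = path_class pixel_triple (\<delta> \<cdot> \<epsilon>)"
      using cls[OF concat_all_paths[OF \<delta>(1) \<epsilon>(1)] represents_concat[OF \<delta>(2) \<epsilon>(2)]] \<delta> \<epsilon> by simp
    then show "FArr \<Theta> (Comp D e d) = Comp (path_cat pixel_triple) (FArr \<Theta> e) (FArr \<Theta> d)"
      using cls[OF \<delta>(1,2)] cls[OF \<epsilon>(1,2)] Q.path_comp[of \<delta> \<epsilon>] \<delta> \<epsilon> by (auto simp: pixel_paths)
  qed
  have "bij_betw (FObj \<Theta>) (Obj D) (Obj (path_cat pixel_triple))"
    using obj_D by (simp add: \<Theta>_def pixel_points bij_betw_def inj_on_def)
  moreover have "bij_betw (FArr \<Theta>) (Arr D) (Arr (path_cat pixel_triple))"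
    unfolding bij_betw_def
  proof
    show "inj_on (FArr \<Theta>) (Arr D)"
    proof (rule inj_onI)
      fix d e assume de: "d \<in> Arr D" "e \<in> Arr D" "FArr \<Theta> d = FArr \<Theta> e"
      obtain \<delta> where \<delta>: "\<delta> \<in> all_paths P" "represents \<delta> 0 1 d" using rep[OF arr_hom[OF de(1)]] by blast
      then have "\<delta> \<in> FArr \<Theta> d" by (auto simp: \<Theta>_def pixel_paths)
      then have "represents \<delta> 0 1 e" unfolding de(3) by (simp add: \<Theta>_def)
      then show "d = e" using represents_unique[OF \<delta>(2)] by blast
    qed
    show "FArr \<Theta> ` Arr D = Arr (path_cat pixel_triple)"
    proof (intro equalityI subsetI)
      fix c assume "c \<in> FArr \<Theta> ` Arr D"
      then show "c \<in> Arr (path_cat pixel_triple)" using functor_hom[OF func arr_hom] by (auto simp: hom_def)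
    next
      fix c assume "c \<in> Arr (path_cat pixel_triple)"
      then obtain \<delta> where d: "\<delta> \<in> Paths pixel_triple" "c = path_class pixel_triple \<delta>" by (auto simp: path_cat_def)
      then obtain v where v: "represents \<delta> 0 1 v" "\<delta> \<in> all_paths P" by (auto simp: pixel_paths)
      show "c \<in> FArr \<Theta> ` Arr D"
        using cls[OF v(2,1)] d(2) homD[OF represents_hom[OF v(1)]] by (intro image_eqI[of _ _ v]) auto
    qed
  qed
  ultimately show ?thesis
    unfolding in_PCat_def isomorphic_def using func Q.triple_axioms by blast
qed

end

section \<open>The site of screens\<close>

lemma screen_functor_pixelation:
  assumes T: "triple T" and P: "screen T P" and H: "pix_equivalence T P s H"
  shows "screen_functor T P (pixelation T P s) (comp_functor H (pix_p T P))"
proof -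
  interpret triple_screen T P using T P by (simp add: triple_screen_def)
  let ?L = "localization C S" and ?p = "loc_functor C S"
  have eqv: "is_equivalence ?L (pixelation T P s) H"
    using H by (simp add: pix_equivalence_def pix_loc_def)
  then have Hf: "is_functor ?L (pixelation T P s) H" by (simp add: is_equivalence_def)
  interpret L: is_category ?L using Hf by (simp add: is_functor_def)
  interpret D: is_category "pixelation T P s" using Hf by (simp add: is_functor_def)
  have p: "is_functor C ?L ?p" by (rule loc_functor_functor) unfold_locales
  have p_hom: "FArr ?p f \<in> hom ?L x y" if "f \<in> hom C x y" for f x y
    using functor_hom[OF p that] by (simp add: loc_functor_def)
  have obj: "Obj (pixelation T P s) = P"
    by (simp add: pixelation_def quot_cat_def pix_quiver_def)
  have H_obj: "FObj H x = A" if "A \<in> P" "x \<in> A" for A x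
    using H that by (simp add: pix_equivalence_def)
  have H_S: "FArr H (FArr ?p c) = Ident (pixelation T P s) A"
    if A: "A \<in> P" "x \<in> A" and c: "c \<in> S" "c \<in> hom C x y" for A c x y
  proof -
    obtain \<rho> where \<rho>: "\<rho> \<in> Paths T" "\<rho> 0 = x" "\<rho> 1 = y" "c = path_class T \<rho>" "in_pixel P \<rho>"
      using Sigma_hom[OF c] .
    have im: "im \<rho> \<subseteq> A" using in_pixel_im[OF \<rho>(5) A(1)] \<rho>(2) A(2) by simp
    then have y: "y \<in> A" using ends_in_im[of \<rho>] \<rho>(3) by auto
    \<comment> \<open>\<open>H\<close> is prescribed on fractions, not on \<open>p\<close> of an
      element of \<open>S\<close>. With the constant path at the end as denominator, the constant
      numerator shows that the image of \<open>?J\<close> is an identity; the numerator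
      \<open>\<rho>\<close> then gives the claim.\<close>
    let ?c = "const_path y" and ?J = "loc_inverse C S (path_class T (const_path y))"
    have yo: "y \<in> Points T" using block_obj[OF A(1) y] by simp
    have cp: "?c \<in> Paths T" "path_class T ?c \<in> S" "path_class T ?c \<in> hom C y y"
      using const[OF yo] class_in_Sigma[of ?c] path_class_hom[of ?c] A(1) y by (auto simp: in_pixel_def)
    have J: "?J \<in> hom ?L y y"
      using cp(2) homD[OF cp(3)] word_hom[of y "[Inr (path_class T ?c)]" y] yo by (simp add: loc_inverse_def)
    have pc: "FArr ?p (path_class T ?c) = Ident ?L y"
      using functor_ident[OF p, of y] yo by (simp add: loc_functor_def)
    have frac: "FArr H (Comp ?L ?J (FArr ?p (path_class T \<sigma>))) = Ident (pixelation T P s) A"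
      if "\<sigma> \<in> Paths T" "\<sigma> 1 = y" "im \<sigma> \<subseteq> A" for \<sigma>
      using H A(1) that cp(1) y unfolding pix_equivalence_def pix_fraction_def fraction_def by simp
    have "FArr H ?J = Ident (pixelation T P s) A"
      using frac[of ?c] cp(1) y pc L.comp_ident_hom(1)[OF J] by simp
    moreover have "FArr H (Comp ?L ?J (FArr ?p c)) = Comp (pixelation T P s) (FArr H ?J) (FArr H (FArr ?p c))"
      using functor_comp[OF Hf p_hom[OF c(2)] J] .
    moreover have "FArr H (FArr ?p c) \<in> hom (pixelation T P s) A A"
      using functor_hom[OF Hf p_hom[OF c(2)]] H_obj A y by simp
    ultimately show ?thesis
      using frac[OF \<rho>(1,3) im] \<rho>(4) D.comp_ident_hom(2) by simp
  qed
  have "pixel_functor C S P (pixelation T P s) (comp_functor H ?p)"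
    by (rule pixel_functor_localization[OF eqv obj H_obj H_S])
  then show ?thesis
    unfolding screen_functor_def pix_p_def using triple_screen_axioms by blast
qed

lemma meet_commute: "P \<sqinter>\<^sub>P Q = Q \<sqinter>\<^sub>P P"
  unfolding meet_def by (auto simp: Int_commute)

lemma partition_block_eq:
  "partition_on X P \<Longrightarrow> A \<in> P \<Longrightarrow> B \<in> P \<Longrightarrow> x \<in> A \<Longrightarrow> x \<in> B \<Longrightarrow> A = B"
  by (auto simp: partition_on_def disjoint_def)

lemma screen_partition: "P \<in> screens T \<Longrightarrow> partition_on (Points T) P"
  by (simp add: screens_def screen_def)

text \<open>The common coarsening \<open>R\<close> bounds the count: a pixel of the meet inside
  \<open>B\<close> is \<open>B \<inter> Y\<close>, where \<open>Y\<close> is one of the finitely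
  many pixels of \<open>Q\<close> in the pixel of \<open>R\<close> around \<open>B\<close>.\<close>

lemma finitary_meet:
  assumes P: "finitary_refinement T P R" and Q: "finitary_refinement T Q R"
    and meet: "P \<sqinter>\<^sub>P Q \<in> screens T"
  shows "finitary_refinement T (P \<sqinter>\<^sub>P Q) P"
proof -
  have scr: "P \<in> screens T" "Q \<in> screens T" "R \<in> screens T"
    using P Q by (auto simp: finitary_refinement_def)
  note part = scr[THEN screen_partition]
  have "\<exists>Y\<in>P. A \<subseteq> Y" if "A \<in> P \<sqinter>\<^sub>P Q" for A using that by (auto simp: meet_def)
  then have "refines (Points T) (P \<sqinter>\<^sub>P Q) P"
    using part screen_partition[OF meet] by (auto simp: refines_def)
  moreover have "finite {A \<in> P \<sqinter>\<^sub>P Q. A \<subseteq> B}" if B: "B \<in> P" for B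
  proof -
    obtain R0 where R0: "R0 \<in> R" "B \<subseteq> R0"
      using P B by (auto simp: finitary_refinement_def refines_def)
    have "{A \<in> P \<sqinter>\<^sub>P Q. A \<subseteq> B} \<subseteq> (\<lambda>Y. B \<inter> Y) ` {Y \<in> Q. Y \<subseteq> R0}"
    proof
      fix A assume "A \<in> {A \<in> P \<sqinter>\<^sub>P Q. A \<subseteq> B}"
      then obtain X Y x where *: "X \<in> P" "Y \<in> Q" "A = X \<inter> Y" "x \<in> A" "A \<subseteq> B" by (auto simp: meet_def)
      then have "X = B" using partition_block_eq[OF part(1) *(1) B, of x] by auto
      obtain R1 where R1: "R1 \<in> R" "Y \<subseteq> R1"
        using Q *(2) by (auto simp: finitary_refinement_def refines_def)
      then have "R1 = R0" using partition_block_eq[OF part(3) R1(1) R0(1), of x] * R0(2) by auto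
      then show "A \<in> (\<lambda>Y. B \<inter> Y) ` {Y \<in> Q. Y \<subseteq> R0}" using * R1 \<open>X = B\<close> by auto
    qed
    moreover have "finite {Y \<in> Q. Y \<subseteq> R0}" using Q R0 by (auto simp: finitary_refinement_def)
    ultimately show ?thesis by (rule finite_surj[rotated])
  qed
  ultimately show ?thesis using meet scr by (simp add: finitary_refinement_def)
qed

section \<open>The presheaf of pixelations and the equalizer diagram\<close>

locale screen_site = triple T
  for T :: "'x path_structure" +
  fixes s :: "'x set set \<Rightarrow> 'x set \<Rightarrow> 'x"
    and H :: "'x set set \<Rightarrow> ('x, 'x pix_loc_arrow, 'x set, 'x pix_arrow) cfunctor"
  assumes meet_screen: "\<And>P Q. P \<in> screens T \<Longrightarrow> Q \<in> screens T \<Longrightarrow> P \<sqinter>\<^sub>P Q \<in> screens T"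
    and equivalence: "\<And>P. P \<in> screens T \<Longrightarrow> pix_equivalence T P (s P) (H P)"
begin

abbreviation "pix P \<equiv> pixelation T P (s P)"
abbreviation "proj P \<equiv> comp_functor (H P) (pix_p T P)"
abbreviation "le \<equiv> finitary_refinement T"
abbreviation "init_of P Q G \<equiv>
  pixel_init (path_cat T) (Sigma_P T P) P (pix P) (proj P) (Sigma_P T Q) Q (pix Q) (proj Q) G"

lemma screen_functor: "P \<in> screens T \<Longrightarrow> screen_functor T P (pix P) (proj P)"
  using screen_functor_pixelation[OF triple_axioms _ equivalence] by (simp add: screens_def)

lemma pixel_functor_screen:
  "P \<in> screens T \<Longrightarrow> pixel_functor (path_cat T) (Sigma_P T P) P (pix P) (proj P)"
  using screen_functor by (auto simp: screen_functor_def)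

lemma Hp_proj: "Hp T H P \<gamma> = FArr (proj P) (path_class T \<gamma>)"
  by (simp add: Hp_def)

text \<open>Resolves the definite descriptions in \<open>Init\<close>: on objects by existence and
  uniqueness of initial pixels, on arrows by \<open>eq_iff\<close>.\<close>

lemma Init_init:
  assumes le: "le P Q"
  shows "init_of P Q (Init T s H P Q)"
proof -
  have scr: "P \<in> screens T" "Q \<in> screens T" using le by (auto simp: finitary_refinement_def)
  interpret fine: screen_functor T P "pix P" "proj P" by (rule screen_functor[OF scr(1)])
  interpret coarse: screen_functor T Q "pix Q" "proj Q" by (rule screen_functor[OF scr(2)])
  interpret pixel_refinement "path_cat T" "Sigma_P T P" P "pix P" "proj P" "Sigma_P T Q" Q "pix Q" "proj Q"
  proof
    show "Sigma_P T P \<subseteq> Sigma_P T Q"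
    proof
      fix c assume "c \<in> Sigma_P T P"
      then obtain \<rho> A where \<rho>: "\<rho> \<in> Paths T" "A \<in> P" "im \<rho> \<subseteq> A" "c = path_class T \<rho>"
        by (auto simp: Sigma_P_def in_pixel_def)
      obtain A' where "A' \<in> Q" "A \<subseteq> A'"
        using le \<rho>(2) by (auto simp: finitary_refinement_def refines_def)
      then have "in_pixel Q \<rho>" using \<rho>(3) by (auto simp: in_pixel_def)
      then show "c \<in> Sigma_P T Q" using coarse.class_in_Sigma[OF \<rho>(1)] \<rho>(4) by simp
    qed
  qed (use le in \<open>auto simp: finitary_refinement_def refines_def\<close>)
  have initial_iff: "is_initial_pixel T P X A \<longleftrightarrow> initial X A" if X: "X \<in> Q" for X A
  proof -
    have path: "(\<exists>\<gamma>\<in>Paths T. \<gamma> 0 = x \<and> \<gamma> 1 = y \<and> im \<gamma> \<subseteq> X) \<longleftrightarrow>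
        (\<exists>c\<in>Sigma_P T Q. c \<in> hom (path_cat T) x y)" if "x \<in> X" for x y
    proof
      assume "\<exists>\<gamma>\<in>Paths T. \<gamma> 0 = x \<and> \<gamma> 1 = y \<and> im \<gamma> \<subseteq> X"
      then obtain \<gamma> where \<gamma>: "\<gamma> \<in> Paths T" "\<gamma> 0 = x" "\<gamma> 1 = y" "im \<gamma> \<subseteq> X" by blast
      then have "path_class T \<gamma> \<in> Sigma_P T Q"
        using coarse.class_in_Sigma[OF \<gamma>(1)] X by (auto simp: in_pixel_def)
      then show "\<exists>c\<in>Sigma_P T Q. c \<in> hom (path_cat T) x y"
        using path_class_hom[OF \<gamma>(1)] \<gamma>(2,3) by auto
    next
      assume "\<exists>c\<in>Sigma_P T Q. c \<in> hom (path_cat T) x y"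
      then obtain c where c: "c \<in> Sigma_P T Q" "c \<in> hom (path_cat T) x y" by blast
      obtain \<gamma> where "\<gamma> \<in> Paths T" "\<gamma> 0 = x" "\<gamma> 1 = y" "in_pixel Q \<gamma>"
        using coarse.Sigma_hom[OF c] by metis
      then show "\<exists>\<gamma>\<in>Paths T. \<gamma> 0 = x \<and> \<gamma> 1 = y \<and> im \<gamma> \<subseteq> X"
        using coarse.in_pixel_im[of \<gamma> X] X that by blast
    qed
    \<comment> \<open>\<open>is_initial_pixel\<close> quantifies over points of fine pixels inside
      \<open>X\<close>; by refinement these are all the points of \<open>X\<close>.\<close>
    have all: "(\<forall>B\<in>P. B \<subseteq> X \<longrightarrow> (\<forall>y\<in>B. \<Phi> y)) \<longleftrightarrow> (\<forall>y\<in>X. \<Phi> y)" for \<Phi>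
    proof
      assume all: "\<forall>B\<in>P. B \<subseteq> X \<longrightarrow> (\<forall>y\<in>B. \<Phi> y)"
      show "\<forall>y\<in>X. \<Phi> y"
      proof
        fix y assume y: "y \<in> X"
        have "fine.blk y \<in> P" "y \<in> fine.blk y"
          using fine.blk_mem[of y] coarse.block_obj[OF X y] by auto
        then show "\<Phi> y" using all block_sub[OF X, of "fine.blk y" y] y by blast
      qed
    qed blast
    show ?thesis
      unfolding is_initial_pixel_def initial_def all using path by (meson subsetD)
  qed
  have ip: "initial X (init_pixel T P X)" if X: "X \<in> Q" for X
  proof -
    obtain A where A: "initial X A" using initial_exists[OF X] .
    have "init_pixel T P X = A"
      unfolding init_pixel_def
      by (rule the_equality) (use A initial_iff[OF X] initial_unique[OF X] in auto)
    then show ?thesis using A by simp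
  qed
  show ?thesis
  proof
    show "initial X (FObj (Init T s H P Q) X)" if "X \<in> Q" for X
      using ip[OF that] by (simp add: Init_def)
  next
    fix X Y x y h
    assume XY: "X \<in> Q" "Y \<in> Q" and "x \<in> FObj (Init T s H P Q) X" "y \<in> FObj (Init T s H P Q) Y"
      and h: "h \<in> hom (path_cat T) x y"
    then have x: "x \<in> init_pixel T P X" and y: "y \<in> init_pixel T P Y" by (auto simp: Init_def)
    have IX: "init_pixel T P X \<in> P" "init_pixel T P X \<subseteq> X" and IY: "init_pixel T P Y \<in> P" "init_pixel T P Y \<subseteq> Y"
      using ip[OF XY(1)] ip[OF XY(2)] by (auto simp: initial_def)
    have "FArr (proj Q) h \<in> hom (pix Q) X Y"
      using coarse.F_hom[OF h XY(1) _ XY(2)] x y IX IY by blast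
    then have ends: "Dom (pix Q) (FArr (proj Q) h) = X" "Cod (pix Q) (FArr (proj Q) h) = Y"
      by (auto simp: hom_def)
    obtain \<gamma> where \<gamma>: "\<gamma> \<in> Paths T" "\<gamma> 0 = x" "\<gamma> 1 = y" "h = path_class T \<gamma>" using path_arr[OF h] .
    have "FArr (Init T s H P Q) (FArr (proj Q) h) = (THE g. \<exists>\<gamma>\<in>Paths T.
        \<gamma> 0 \<in> init_pixel T P X \<and> \<gamma> 1 \<in> init_pixel T P Y \<and>
        FArr (proj Q) (path_class T \<gamma>) = FArr (proj Q) h \<and> g = FArr (proj P) (path_class T \<gamma>))"
      unfolding Init_def Hp_proj by (simp only: cfunctor.simps ends)
    also have "\<dots> = FArr (proj P) h"
    proof (rule the_equality)
      show "\<exists>\<gamma>\<in>Paths T. \<gamma> 0 \<in> init_pixel T P X \<and> \<gamma> 1 \<in> init_pixel T P Y \<and>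
          FArr (proj Q) (path_class T \<gamma>) = FArr (proj Q) h \<and> FArr (proj P) h = FArr (proj P) (path_class T \<gamma>)"
        using \<gamma> x y by blast
    next
      fix g assume "\<exists>\<gamma>\<in>Paths T. \<gamma> 0 \<in> init_pixel T P X \<and> \<gamma> 1 \<in> init_pixel T P Y \<and>
          FArr (proj Q) (path_class T \<gamma>) = FArr (proj Q) h \<and> g = FArr (proj P) (path_class T \<gamma>)"
      then obtain \<delta> where \<delta>: "\<delta> \<in> Paths T" "\<delta> 0 \<in> init_pixel T P X" "\<delta> 1 \<in> init_pixel T P Y"
        "FArr (proj Q) (path_class T \<delta>) = FArr (proj Q) h" "g = FArr (proj P) (path_class T \<delta>)" by blast
      show "g = FArr (proj P) h"
        using eq_iff[OF IX(1) IY(1) \<delta>(2) x \<delta>(3) y path_class_hom[OF \<delta>(1)] h] \<delta>(4,5) by blast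
    qed
    finally show "FArr (Init T s H P Q) (FArr (proj Q) h) = FArr (proj P) h" .
  qed
qed

text \<open>Reads the order back from the locale, so that reflexivity and transitivity of refinement
  follow from the identity and composites of \<open>pixel_init\<close>.\<close>

lemma init_finitary:
  assumes "init_of P Q G" "P \<in> screens T" "Q \<in> screens T"
  shows "le P Q"
proof -
  interpret pixel_init "path_cat T" "Sigma_P T P" P "pix P" "proj P" "Sigma_P T Q" Q "pix Q" "proj Q" G
    by fact
  show ?thesis
    using assms(2,3) screen_partition[OF assms(2)] screen_partition[OF assms(3)] refine finite_blocks
    by (simp add: finitary_refinement_def refines_def)
qed

lemma le_screens: "le P Q \<Longrightarrow> P \<in> screens T \<and> Q \<in> screens T"
  by (simp add: finitary_refinement_def)

lemma le_refl: "P \<in> screens T \<Longrightarrow> le P P"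
  using init_finitary[OF pixel_init_id[OF pixel_functor_screen]] by blast

lemma le_trans: "le P Q \<Longrightarrow> le Q R \<Longrightarrow> le P R"
  using init_finitary[OF pixel_init_comp[OF Init_init Init_init]] le_screens by blast

lemma thin: "thin_category (screens T) le"
  unfolding thin_category_def using le_screens le_refl le_trans by blast

text \<open>Stability under pullback is met by the empty covering, which every screen has; its
  condition on members is vacuous.\<close>

lemma coverage: "is_coverage (screens T) le (screen_coverage T)"
  unfolding is_coverage_def
proof (intro conjI ballI)
  fix x assume "x \<in> screen_coverage T"
  then show "case x of (U, n, V) \<Rightarrow> U \<in> screens T \<and> (\<forall>i\<in>{1..n}. le (V i) U)"
    by (auto simp: screen_coverage_def is_join_cover_def)
next
  fix x assume "x \<in> screen_coverage T"
  have "(U, 0, V) \<in> screen_coverage T" if "U \<in> screens T" for U V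
    using that by (auto simp: screen_coverage_def)
  then have *: "\<exists>n' V'. (U', n', V') \<in> screen_coverage T \<and> (\<forall>j\<in>{1..n'}. \<exists>i\<in>{1..n}. le (V' j) (V i))"
    if "le U' U" for U' U n V
    using le_screens[OF that] by (intro exI[of _ 0] exI[of _ V]) auto
  obtain U n V where x: "x = (U, n, V)" by (cases x)
  show "case x of (U, n, V) \<Rightarrow> \<forall>U'. le U' U \<longrightarrow>
      (\<exists>n' V'. (U', n', V') \<in> screen_coverage T \<and> (\<forall>j\<in>{1..n'}. \<exists>i\<in>{1..n}. le (V' j) (V i)))"
    unfolding x prod.case using * by blast
qed

lemma Init_functor: "le P Q \<Longrightarrow> is_functor (pix Q) (pix P) (Init T s H P Q)"
  using pixel_init.G_functor[OF Init_init] .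

lemma Init_comp:
  "le P Q \<Longrightarrow> le Q R \<Longrightarrow>
    functor_eq (pix R) (Init T s H P R) (comp_functor (Init T s H P Q) (Init T s H Q R))"
  using pixel_init_unique[OF Init_init pixel_init_comp[OF Init_init Init_init]] le_trans by blast

lemma pix_in_PCat: "P \<in> screens T \<Longrightarrow> in_PCat (pix P)"
  using screen_functor.in_PCat_pixels[OF screen_functor] .

lemma presheaf: "PCat_presheaf (screens T) le pix (Init T s H)"
  unfolding PCat_presheaf_def
  using pix_in_PCat Init_functor Init_comp
    pixel_init_unique[OF Init_init[OF le_refl] pixel_init_id[OF pixel_functor_screen]]
  by blast

text \<open>\<open>Init_prod\<close> is injective on objects and arrows, and compatible families lie
  in its image, so \<open>functor_factorization\<close> gives the universal property.\<close>

lemma equalizer: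
  assumes cover: "is_join_cover T P n Ps"
  shows "PCat_equalizer TYPE('z) (pix P) (prod_cat {1..n} (\<lambda>i. pix (Ps i)))
    (prod_cat {1..n} (\<lambda>j. prod_cat {1..n} (\<lambda>k. pix (Ps j \<sqinter>\<^sub>P Ps k))))
    (Init_prod T s H P n Ps) (pr0 T s H n Ps) (pr1 T s H n Ps)"
proof -
  let ?I = "{1..n}"
  let ?M = "\<lambda>j k. Ps j \<sqinter>\<^sub>P Ps k"
  let ?B = "prod_cat ?I (\<lambda>i. pix (Ps i))"
  let ?E = "Init_prod T s H P n Ps"
  have n: "?I \<noteq> {}" and P: "P \<in> screens T" "P = join (Points T) ?I Ps"
    and Pi: "\<And>i. i \<in> ?I \<Longrightarrow> Ps i \<in> screens T" "\<And>i. i \<in> ?I \<Longrightarrow> le (Ps i) P"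
    using cover by (auto simp: is_join_cover_def)
  have M: "?M j k \<in> screens T" "le (?M j k) (Ps j)" "le (?M j k) (Ps k)" if "j \<in> ?I" "k \<in> ?I" for j k
  proof -
    show "?M j k \<in> screens T" using meet_screen Pi that by blast
    then show "le (?M j k) (Ps j)" using finitary_meet Pi that by blast
    show "le (?M j k) (Ps k)"
      using finitary_meet[OF Pi(2)[OF that(2)] Pi(2)[OF that(1)]] meet_screen[OF Pi(1)[OF that(2)] Pi(1)[OF that(1)]]
      by (simp add: meet_commute)
  qed
  have MP: "le (?M j k) P" if "j \<in> ?I" "k \<in> ?I" for j k
    using le_trans[OF M(2)[OF that] Pi(2)[OF that(1)]] .
  have cat: "is_category (pix Q)" if "Q \<in> screens T" for Q
    using Init_functor[OF le_refl[OF that]] by (simp add: is_functor_def)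
  have B: "is_category ?B" using cat Pi by (intro prod_category) blast
  have E: "is_functor (pix P) ?B ?E"
    unfolding Init_prod_def using prod_functor[OF cat[OF P(1)] Init_functor[OF Pi(2)]] .
  have pr: "is_functor ?B (pix (Ps j)) \<lparr>FObj = (\<lambda>x. x j), FArr = (\<lambda>f. f j)\<rparr>" if "j \<in> ?I" for j
    using cat Pi that by (intro proj_functor) blast+
  have comps: "is_functor ?B (pix (?M j k)) (comp_functor (Init T s H (?M j k) (Ps j)) \<lparr>FObj = (\<lambda>x. x j), FArr = (\<lambda>f. f j)\<rparr>)"
    "is_functor ?B (pix (?M j k)) (comp_functor (Init T s H (?M j k) (Ps k)) \<lparr>FObj = (\<lambda>x. x k), FArr = (\<lambda>f. f k)\<rparr>)"
    if "j \<in> ?I" "k \<in> ?I" for j k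
    using functor_comp_functor[OF pr Init_functor] M that by blast+
  \<comment> \<open>For fixed \<open>j\<close>, the inner products of the functors that project to a
    factor and then apply \<open>Init\<close>; a second product over \<open>j\<close> yields
    \<open>pr0\<close> and \<open>pr1\<close>.\<close>
  have "is_functor ?B (prod_cat ?I (\<lambda>k. pix (?M j k)))
      \<lparr>FObj = (\<lambda>A. \<lambda>k\<in>?I. FObj (Init T s H (?M j k) (Ps j)) (A j)),
       FArr = (\<lambda>f. \<lambda>k\<in>?I. FArr (Init T s H (?M j k) (Ps j)) (f j))\<rparr>"
    "is_functor ?B (prod_cat ?I (\<lambda>k. pix (?M j k)))
      \<lparr>FObj = (\<lambda>A. \<lambda>k\<in>?I. FObj (Init T s H (?M j k) (Ps k)) (A k)),
       FArr = (\<lambda>f. \<lambda>k\<in>?I. FArr (Init T s H (?M j k) (Ps k)) (f k))\<rparr>"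
    if "j \<in> ?I" for j
    using prod_functor[where I = ?I and C = "\<lambda>k. pix (?M j k)", OF B comps(1)[OF that]]
      prod_functor[where I = ?I and C = "\<lambda>k. pix (?M j k)", OF B comps(2)[OF that]]
    by (simp_all only: comp_functor_def comp_def cfunctor.simps)
  from prod_functor[where I = ?I and C = "\<lambda>j. prod_cat ?I (\<lambda>k. pix (?M j k))", OF B this(1)]
    prod_functor[where I = ?I and C = "\<lambda>j. prod_cat ?I (\<lambda>k. pix (?M j k))", OF B this(2)]
  have pr01: "is_functor ?B (prod_cat ?I (\<lambda>j. prod_cat ?I (\<lambda>k. pix (?M j k)))) (pr0 T s H n Ps)"
    "is_functor ?B (prod_cat ?I (\<lambda>j. prod_cat ?I (\<lambda>k. pix (?M j k)))) (pr1 T s H n Ps)"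
    unfolding pr0_def pr1_def by simp_all
  have I_jk: "FObj (Init T s H (?M j k) (Ps j)) (FObj (Init T s H (Ps j) P) A) = FObj (Init T s H (?M j k) P) A"
      "FObj (Init T s H (?M j k) (Ps k)) (FObj (Init T s H (Ps k) P) A) = FObj (Init T s H (?M j k) P) A"
    if "j \<in> ?I" "k \<in> ?I" "A \<in> Obj (pix P)" for j k A
    using Init_comp[OF M(2)[OF that(1,2)] Pi(2)[OF that(1)]] Init_comp[OF M(3)[OF that(1,2)] Pi(2)[OF that(2)]] that(3)
    by (simp_all add: functor_eq_def comp_functor_def)
  have I_jk_arr: "FArr (Init T s H (?M j k) (Ps j)) (FArr (Init T s H (Ps j) P) f) = FArr (Init T s H (?M j k) P) f"
      "FArr (Init T s H (?M j k) (Ps k)) (FArr (Init T s H (Ps k) P) f) = FArr (Init T s H (?M j k) P) f"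
    if "j \<in> ?I" "k \<in> ?I" "f \<in> Arr (pix P)" for j k f
    using Init_comp[OF M(2)[OF that(1,2)] Pi(2)[OF that(1)]] Init_comp[OF M(3)[OF that(1,2)] Pi(2)[OF that(2)]] that(3)
    by (simp_all add: functor_eq_def comp_functor_def)
  have comm: "functor_eq (pix P) (comp_functor (pr0 T s H n Ps) ?E) (comp_functor (pr1 T s H n Ps) ?E)"
    unfolding functor_eq_def comp_functor_def pr0_def pr1_def Init_prod_def
    using I_jk I_jk_arr by (auto intro!: restrict_ext)
  have obj_pix: "Obj (pix Q) = Q" if "Q \<in> screens T" for Q
    using pixel_functor_screen[OF that] by (simp add: pixel_functor_def pixel_quotient_def pixel_quotient_axioms_def)
  note G = Init_init[OF Pi(2)]
  obtain i0 where i0: "i0 \<in> ?I" using n by blast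
  \<comment> \<open>A single component already gives injectivity: \<open>Init\<close> is faithful
    and injective on objects, and the latter makes arrows with equal images parallel.\<close>
  interpret G0: pixel_init "path_cat T" "Sigma_P T (Ps i0)" "Ps i0" "pix (Ps i0)" "proj (Ps i0)"
    "Sigma_P T P" P "pix P" "proj P" "Init T s H (Ps i0) P" by (rule G[OF i0])
  have E_simps: "FObj ?E A i = FObj (Init T s H (Ps i) P) A" "FArr ?E f i = FArr (Init T s H (Ps i) P) f"
    if "i \<in> ?I" for A f i using that by (auto simp: Init_prod_def)
  have inj_obj: "inj_on (FObj ?E) (Obj (pix P))"
  proof (rule inj_onI)
    fix A B assume "A \<in> Obj (pix P)" "B \<in> Obj (pix P)" "FObj ?E A = FObj ?E B"
    then show "A = B" using G0.G_obj_inj E_simps(1)[OF i0] obj_pix[OF P(1)] by metis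
  qed
  have inj_arr: "inj_on (FArr ?E) (Arr (pix P))"
  proof (rule inj_onI)
    fix f g assume fg: "f \<in> Arr (pix P)" "g \<in> Arr (pix P)" "FArr ?E f = FArr ?E g"
    then have eq: "FArr (Init T s H (Ps i0) P) f = FArr (Init T s H (Ps i0) P) g"
      using E_simps(2)[OF i0] by metis
    have "Dom (pix P) f \<in> P" "Cod (pix P) f \<in> P" "Dom (pix P) g \<in> P" "Cod (pix P) g \<in> P"
      using G0.coarse.D.dom_obj G0.coarse.D.cod_obj fg obj_pix[OF P(1)] by auto
    then have "Dom (pix P) g = Dom (pix P) f" "Cod (pix P) g = Cod (pix P) f"
      using G0.G_hom[OF arr_hom[OF fg(1)]] G0.G_hom[OF arr_hom[OF fg(2)]] eq G0.G_obj_inj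
      by (simp_all add: hom_def)
    then show "f = g" using G0.G_faithful[OF arr_hom[OF fg(1)] _ eq] fg(2) by (simp add: hom_def)
  qed
  have factor: "\<exists>L. is_functor (path_cat Z) (pix P) L \<and> functor_eq (path_cat Z) (comp_functor ?E L) K \<and>
      (\<forall>L'. is_functor (path_cat Z) (pix P) L' \<and> functor_eq (path_cat Z) (comp_functor ?E L') K \<longrightarrow>
        functor_eq (path_cat Z) L' L)"
    if K: "is_functor (path_cat Z) ?B K"
      and eqK: "functor_eq (path_cat Z) (comp_functor (pr0 T s H n Ps) K) (comp_functor (pr1 T s H n Ps) K)"
    for Z :: "'z path_structure" and K
  proof -
    have objs: "\<exists>A\<in>P. FObj K z = FObj ?E A" if z: "z \<in> Obj (path_cat Z)" for z
    proof -
      have Kz: "FObj K z \<in> (\<Pi>\<^sub>E i\<in>?I. Obj (pix (Ps i)))"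
        using functor_obj[OF K z] by (simp add: prod_cat_def)
      have compat: "FObj (Init T s H (?M j k) (Ps j)) (FObj K z j) = FObj (Init T s H (?M j k) (Ps k)) (FObj K z k)"
        if "j \<in> ?I" "k \<in> ?I" for j k
      proof -
        have "FObj (pr0 T s H n Ps) (FObj K z) j k = FObj (pr1 T s H n Ps) (FObj K z) j k"
          using eqK z by (simp add: functor_eq_def comp_functor_def)
        then show ?thesis using that by (simp add: pr0_def pr1_def)
      qed
      have mem: "FObj K z i \<in> Ps i" if "i \<in> ?I" for i
        using PiE_mem[OF Kz that] obj_pix[OF Pi(1)[OF that]] by simp
      have "P = join (Obj (path_cat T)) ?I Ps" using P(2) by simp
      then obtain A where A: "A \<in> P" "\<And>i. i \<in> ?I \<Longrightarrow> FObj K z i = FObj (Init T s H (Ps i) P) A"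
        using compatible_pixels_initial[where A = "FObj K z", OF n G Init_init[OF M(2)] Init_init[OF M(3)] _ mem compat]
        by blast
      have "FObj K z = FObj ?E A"
      proof (rule extensionalityI[where A = ?I])
        show "FObj K z \<in> extensional ?I" using Kz by (simp add: PiE_def)
        show "FObj ?E A \<in> extensional ?I" by (simp add: Init_prod_def)
      qed (use A(2) E_simps in auto)
      then show ?thesis using A(1) by blast
    qed
    have arrs: "FArr K f \<in> FArr ?E ` Arr (pix P)" if f: "f \<in> Arr (path_cat Z)" for f
    proof -
      interpret Z: is_category "path_cat Z" using K by (simp add: is_functor_def)
      let ?x = "Dom (path_cat Z) f" and ?y = "Cod (path_cat Z) f"
      obtain A where A: "A \<in> P" "FObj K ?x = FObj ?E A" using objs Z.dom_obj[OF f] by blast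
      obtain A' where A': "A' \<in> P" "FObj K ?y = FObj ?E A'" using objs Z.cod_obj[OF f] by blast
      have Kf: "FArr K f \<in> (\<Pi>\<^sub>E i\<in>?I. hom (pix (Ps i)) (FObj ?E A i) (FObj ?E A' i))"
        using functor_hom[OF K arr_hom[OF f]] unfolding A A' prod_cat_hom by blast
      have "\<exists>g\<in>hom (pix P) A A'. FArr (Init T s H (Ps i) P) g = FArr K f i" if i: "i \<in> ?I" for i
      proof -
        have "FArr K f i \<in> hom (pix (Ps i)) (FObj (Init T s H (Ps i) P) A) (FObj (Init T s H (Ps i) P) A')"
          using PiE_mem[OF Kf i] E_simps(1)[OF i] by simp
        then show ?thesis using pixel_init.G_full[OF G[OF i] A(1) A'(1)] by metis
      qed
      then obtain g where g: "\<And>i. i \<in> ?I \<Longrightarrow> g i \<in> hom (pix P) A A'"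
        "\<And>i. i \<in> ?I \<Longrightarrow> FArr (Init T s H (Ps i) P) (g i) = FArr K f i" by metis
      \<comment> \<open>Each component has its own lift by fullness. Two lifts agree after
        \<open>Init\<close> to the meet of their screens, which is faithful on arrows of
        \<open>pix P\<close>.\<close>
      have g_eq: "g i = g i0" if i: "i \<in> ?I" for i
      proof -
        have "FArr (pr0 T s H n Ps) (FArr K f) i i0 = FArr (pr1 T s H n Ps) (FArr K f) i i0"
          using eqK f by (simp add: functor_eq_def comp_functor_def)
        then have "FArr (Init T s H (?M i i0) (Ps i)) (FArr K f i) = FArr (Init T s H (?M i i0) (Ps i0)) (FArr K f i0)"
          using i i0 by (simp add: pr0_def pr1_def)
        then have "FArr (Init T s H (?M i i0) P) (g i) = FArr (Init T s H (?M i i0) P) (g i0)"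
          using I_jk_arr[OF i i0] homD[OF g(1)[OF i]] homD[OF g(1)[OF i0]] g(2)[OF i] g(2)[OF i0] by metis
        then show ?thesis
          by (rule pixel_init.G_faithful[OF Init_init[OF MP[OF i i0]] g(1)[OF i] g(1)[OF i0]])
      qed
      have "FArr K f = FArr ?E (g i0)"
      proof (rule extensionalityI[where A = ?I])
        show "FArr K f \<in> extensional ?I" using Kf by (simp add: PiE_def)
        show "FArr ?E (g i0) \<in> extensional ?I" by (simp add: Init_prod_def)
        show "FArr K f i = FArr ?E (g i0) i" if "i \<in> ?I" for i
          using g(2)[OF that] g_eq[OF that] E_simps(2)[OF that] by simp
      qed
      then show ?thesis using homD[OF g(1)[OF i0]] by blast
    qed
    show ?thesis
    proof (rule functor_factorization[OF E K inj_obj inj_arr])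
      show "FObj K z \<in> FObj ?E ` Obj (pix P)" if "z \<in> Obj (path_cat Z)" for z
        using objs[OF that] obj_pix[OF P(1)] by auto
    qed (rule arrs)
  qed
  have "in_PCat ?B" by (intro in_PCat_prod pix_in_PCat Pi)
  moreover have "in_PCat (prod_cat ?I (\<lambda>j. prod_cat ?I (\<lambda>k. pix (?M j k))))"
    by (intro in_PCat_prod pix_in_PCat M)
  ultimately show ?thesis
    unfolding PCat_equalizer_def
    by (intro conjI allI impI pix_in_PCat[OF P(1)] E pr01 comm) (assumption | elim conjE, rule factor)+
qed

end

theorem theorem4p18:
  fixes T :: "'x path_structure"
    and s :: "'x set set \<Rightarrow> 'x set \<Rightarrow> 'x"
    and H :: "'x set set \<Rightarrow> ('x, 'x pix_loc_arrow, 'x set, 'x pix_arrow) cfunctor"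
  assumes "triple T"
    and "screens T \<noteq> {}"
    and "\<And>P Q. P \<in> screens T \<Longrightarrow> Q \<in> screens T \<Longrightarrow> P \<sqinter>\<^sub>P Q \<in> screens T"
    and "\<And>P A. P \<in> screens T \<Longrightarrow> A \<in> P \<Longrightarrow> s P A \<in> A"
    and "\<And>P. P \<in> screens T \<Longrightarrow> pix_equivalence T P (s P) (H P)"
  shows "thin_category (screens T) (finitary_refinement T)
    \<and> is_coverage (screens T) (finitary_refinement T) (screen_coverage T)
    \<and> PCat_presheaf (screens T) (finitary_refinement T)
        (\<lambda>P. pixelation T P (s P)) (Init T s H)
    \<and> (\<forall>P n Ps. is_join_cover T P n Ps \<longrightarrow>
        PCat_equalizer TYPE('z)
          (pixelation T P (s P))
          (prod_cat {1..n} (\<lambda>i. pixelation T (Ps i) (s (Ps i))))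
          (prod_cat {1..n} (\<lambda>j. prod_cat {1..n} (\<lambda>k.
             pixelation T (Ps j \<sqinter>\<^sub>P Ps k) (s (Ps j \<sqinter>\<^sub>P Ps k)))))
          (Init_prod T s H P n Ps) (pr0 T s H n Ps) (pr1 T s H n Ps))"
proof -
  interpret triple T by fact
  interpret screen_site T s H
    by unfold_locales (use assms in auto)
  show ?thesis using thin coverage presheaf equalizer by blast
qed

end
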